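(* Let $\mathcal K$ be a representable plumbus with enhanced 2-classifier $u:\Omega_\bullet\to\Omega$, and let $(T,i,m)$ be a fully opfibrantly cartesian enhanced 2-monad on $\mathcal K$. Then $\mathrm{PsAlg}(T)$, the enhanced 2-category of pseudo-$T$-algebras and lax $T$-morphisms, is a representable plumbus.
   Context: Enhanced 2-categories. An enhanced 2-category $\mathcal K$ is a 2-category, whose 1-cells are called loose (written $\rightsquigarrow$), with a wide and locally full sub-2-category whose 1-cells are called tight (written $\to$). It is repletely enhanced if $f$ tight and $f\cong g$ imply $g$ tight. An enhanced 2-monad $(T,i,m)$ is a 2-monad with $T$ preserving tight 1-cells and $i,m$ having tight components. A tight terminal object is a terminal object $1$ all of whose maps $X\to 1$ are tight. Algebras. A lax $T$-algebra is $(A,\alpha,\upsilon,\mu)$ with $\alpha:TA\to A$ tight, $\upsilon:\mathrm{id}_A\Rightarrow\alpha i_A$ and $\mu:\alpha\circ T\alpha\Rightarrow\alpha\circ m_A$ such that $(\mu\, i_{TA})(\upsilon\alpha)=\mathrm{id}_\alpha$, $(\mu\, Ti_A)(\alpha\, T\upsilon)=\mathrm{id}_\alpha$, $(\mu\, m_{TA})(\mu\, T^2\alpha)=(\mu\, Tm_A)(\alpha\, T\mu)$; it is a pseudo-$T$-algebra if $\upsilon,\mu$ are invertible. A lax $T$-morphism $(f,\bar f):(A,\alpha)\rightsquigarrow(B,\beta)$ is a loose $f$ with $\bar f:\beta\circ Tf\Rightarrow f\circ\alpha$ such that $f\upsilon_A=(\bar f i_A)(\upsilon_B f)$ and $(f\mu_A)(\bar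 f\,T\alpha)(\beta\,T\bar f)=(\bar f m_A)(\mu_B\,T^2f)$; it is pseudo if $\bar f$ is invertible and strict if $\bar f$ is an identity. A $T$-2-morphism $f\Rightarrow f'$ is a 2-cell $\varphi$ with $(\varphi\alpha)\bar f=\bar f'(\beta\,T\varphi)$. $\mathrm{PsAlg}(T)$ (the paper's $\mathrm{Alg}^{\mathrm{ps}}_{\mathrm{lx},t\mathrm{ps}}(T)$) is the enhanced 2-category of pseudo-$T$-algebras, lax $T$-morphisms as loose 1-cells, pseudo-$T$-morphisms with tight underlying 1-cell as tight 1-cells, and $T$-2-morphisms. Discrete opfibrations and pullbacks. A tight discrete opfibration is a tight $p:E\to B$ such that for all $e:X\rightsquigarrow E$, $b:X\rightsquigarrow B$, $\varphi:pe\Rightarrow b$ there is a unique 2-cell $\lambda$ with domain $e$ and $p\lambda=\varphi$. A left-tight pullback of a tight $f:B\to C$ along a loose $g:A\rightsquigarrow C$ is a (strict 2-categorical) pullback whose projection $p_A$ to $A$ is tight and detects tightness: $h$ is tight whenever $p_Ah$ is. Plumbus. A smallness structure on $\mathcal K$ is a class of tight discrete opfibrations, called small, stable under left-tight pullback along arbitrary loose 1-cells, with strictly functorial chosen such pullbacks. A plumbus is a repletely enhanced 2-category with a tight terminal object and a smallness structure. Let $\mathrm{SDO}(\mathcal K)$ be the enhanced 2-category of small discrete opfibrations, commuting squares with loose sides (tight when both sides are tight), and pairs of compatible 2-cells. The small discrete opfibrations of $\mathrm{PsAlg}(T)$ are the strict $T$-morphisms whose underlying map is small in $\mathcal K$.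 Representability. An enhanced 2-classifier is a small discrete opfibration $u:\Omega_\bullet\to\Omega$ that is marked-lax terminal in $\mathrm{SDO}(\mathcal K)$ (marked squares being the pullback squares), explicitly: (1) every small $p:E\to B$ has a chosen pullback square $(d_\bullet p:E\rightsquigarrow\Omega_\bullet,\ dp:B\rightsquigarrow\Omega)$ from $p$ to $u$; (2) for every commuting square $(g:E\rightsquigarrow E',f:B\rightsquigarrow B')$ from small $p$ to small $p'$ there is a unique pair of 2-cells $\gamma_\bullet:d_\bullet p\Rightarrow d_\bullet p'\circ g$, $\gamma:dp\Rightarrow dp'\circ f$ with $u\gamma_\bullet=\gamma p$; (3) these are invertible if the square is a pullback; (4) there is an isomorphism $(d_\bullet u,du)\cong(\mathrm{id},\mathrm{id})$. A plumbus with an enhanced 2-classifier is representable; one always assumes then that $\mathrm{id}_1$ is small. A small $p$ is perfect if its classifying map $dp$ is tight. Fully opfibrantly cartesian. $(T,i,m)$ is fully opfibrantly cartesian if (A) $Tu$ is a small discrete opfibration, (B) $T$ preserves pullbacks of $u$, (C) $Tu$ is perfect, (D) the naturality squares of $i$ and $m$ at $u$ are pullbacks.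
   Formalization: Stability of small maps under left-tight pullback is required only of the chosen pullbacks: strict T-morphisms with small underlying map are not closed under all left-tight pullbacks, since composing with an invertible non-strict pseudo-morphism gives a left-tight pullback that is not strict. *)

theory Defs
  imports Main
begin

section \<open>Enhanced 2-categories\<close>

text \<open>
  A (strict) 2-category together with a class of tight 1-cells.  Composition is written in
  application order and is only meaningful on composable arguments.  The sub-2-category of tight
  1-cells is wide and locally full, so it is determined by its 1-cells.
\<close>

record ('o, 'a, 'c) enh2cat =
  Ob :: "'o set"
  Loose :: "'a set"
  Tight :: "'a set"
  Two :: "'c set"
  src :: "'a \<Rightarrow> 'o"
  tgt :: "'a \<Rightarrow> 'o"
  Src :: "'c \<Rightarrow> 'a"
  Tgt :: "'c \<Rightarrow> 'a"
  Id1 :: "'o \<Rightarrow> 'a"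
  Id2 :: "'a \<Rightarrow> 'c"
  comp :: "'a \<Rightarrow> 'a \<Rightarrow> 'a" (infixr "\<cdot>\<index>" 80)
  vcomp :: "'c \<Rightarrow> 'c \<Rightarrow> 'c" (infixr "\<bullet>\<index>" 70)
  hcomp :: "'c \<Rightarrow> 'c \<Rightarrow> 'c" (infixr "\<star>\<index>" 75)

definition one_cell :: "('o, 'a, 'c) enh2cat \<Rightarrow> 'a \<Rightarrow> 'o \<Rightarrow> 'o \<Rightarrow> bool"
    ("\<guillemotleft>_ : _ \<leadsto>\<index> _\<guillemotright>") where
  "\<guillemotleft>f : A \<leadsto>\<^bsub>K\<^esub> B\<guillemotright> \<longleftrightarrow> f \<in> Loose K \<and> src K f = A \<and> tgt K f = B"

definition two_cell :: "('o, 'a, 'c) enh2cat \<Rightarrow> 'c \<Rightarrow> 'a \<Rightarrow> 'a \<Rightarrow> bool"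
    ("\<guillemotleft>_ : _ \<Rightarrow>\<index> _\<guillemotright>") where
  "\<guillemotleft>\<phi> : f \<Rightarrow>\<^bsub>K\<^esub> g\<guillemotright> \<longleftrightarrow> \<phi> \<in> Two K \<and> Src K \<phi> = f \<and> Tgt K \<phi> = g"

definition lwhisker :: "('o, 'a, 'c) enh2cat \<Rightarrow> 'a \<Rightarrow> 'c \<Rightarrow> 'c" (infixr "\<rhd>\<index>" 75) where
  "f \<rhd>\<^bsub>K\<^esub> \<phi> = Id2 K f \<star>\<^bsub>K\<^esub> \<phi>"

definition rwhisker :: "('o, 'a, 'c) enh2cat \<Rightarrow> 'c \<Rightarrow> 'a \<Rightarrow> 'c" (infixl "\<lhd>\<index>" 75) where
  "\<phi> \<lhd>\<^bsub>K\<^esub> f = \<phi> \<star>\<^bsub>K\<^esub> Id2 K f"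

context
  fixes K :: "('o, 'a, 'c) enh2cat" (structure)
begin

definition invertible_two_cell :: "'c \<Rightarrow> bool" where
  "invertible_two_cell \<phi> \<longleftrightarrow> \<phi> \<in> Two K \<and>
     (\<exists>\<psi>. \<guillemotleft>\<psi> : Tgt K \<phi> \<Rightarrow> Src K \<phi>\<guillemotright> \<and>
        \<psi> \<bullet> \<phi> = Id2 K (Src K \<phi>) \<and> \<phi> \<bullet> \<psi> = Id2 K (Tgt K \<phi>))"

end

locale two_category =
  fixes K :: "('o, 'a, 'c) enh2cat" (structure)
  assumes src_Ob: "f \<in> Loose K \<Longrightarrow> src K f \<in> Ob K"
    and tgt_Ob: "f \<in> Loose K \<Longrightarrow> tgt K f \<in> Ob K"
    and Id1_cell: "A \<in> Ob K \<Longrightarrow> \<guillemotleft>Id1 K A : A \<leadsto> A\<guillemotright>"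
    and comp_cell: "\<lbrakk>\<guillemotleft>f : A \<leadsto> B\<guillemotright>; \<guillemotleft>g : B \<leadsto> C\<guillemotright>\<rbrakk> \<Longrightarrow> \<guillemotleft>g \<cdot> f : A \<leadsto> C\<guillemotright>"
    and comp_Id1_left: "\<guillemotleft>f : A \<leadsto> B\<guillemotright> \<Longrightarrow> Id1 K B \<cdot> f = f"
    and comp_Id1_right: "\<guillemotleft>f : A \<leadsto> B\<guillemotright> \<Longrightarrow> f \<cdot> Id1 K A = f"
    and comp_assoc: "\<lbrakk>\<guillemotleft>f : A \<leadsto> B\<guillemotright>; \<guillemotleft>g : B \<leadsto> C\<guillemotright>; \<guillemotleft>h : C \<leadsto> D\<guillemotright>\<rbrakk>
          \<Longrightarrow> (h \<cdot> g) \<cdot> f = h \<cdot> (g \<cdot> f)"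
    and Src_Loose: "\<phi> \<in> Two K \<Longrightarrow> Src K \<phi> \<in> Loose K"
    and Tgt_Loose: "\<phi> \<in> Two K \<Longrightarrow> Tgt K \<phi> \<in> Loose K"
    and parallel_src: "\<phi> \<in> Two K \<Longrightarrow> src K (Src K \<phi>) = src K (Tgt K \<phi>)"
    and parallel_tgt: "\<phi> \<in> Two K \<Longrightarrow> tgt K (Src K \<phi>) = tgt K (Tgt K \<phi>)"
    and Id2_cell: "f \<in> Loose K \<Longrightarrow> \<guillemotleft>Id2 K f : f \<Rightarrow> f\<guillemotright>"
    and vcomp_cell: "\<lbrakk>\<guillemotleft>\<phi> : f \<Rightarrow> g\<guillemotright>; \<guillemotleft>\<psi> : g \<Rightarrow> h\<guillemotright>\<rbrakk> \<Longrightarrow> \<guillemotleft>\<psi> \<bullet> \<phi> : f \<Rightarrow> h\<guillemotright>"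
    and vcomp_Id2_left: "\<guillemotleft>\<phi> : f \<Rightarrow> g\<guillemotright> \<Longrightarrow> Id2 K g \<bullet> \<phi> = \<phi>"
    and vcomp_Id2_right: "\<guillemotleft>\<phi> : f \<Rightarrow> g\<guillemotright> \<Longrightarrow> \<phi> \<bullet> Id2 K f = \<phi>"
    and vcomp_assoc: "\<lbrakk>\<guillemotleft>\<phi> : f \<Rightarrow> g\<guillemotright>; \<guillemotleft>\<psi> : g \<Rightarrow> h\<guillemotright>; \<guillemotleft>\<chi> : h \<Rightarrow> k\<guillemotright>\<rbrakk>
          \<Longrightarrow> (\<chi> \<bullet> \<psi>) \<bullet> \<phi> = \<chi> \<bullet> (\<psi> \<bullet> \<phi>)"
    and hcomp_cell: "\<lbrakk>\<guillemotleft>\<phi> : f \<Rightarrow> f'\<guillemotright>; \<guillemotleft>\<psi> : g \<Rightarrow> g'\<guillemotright>; tgt K f = src K g\<rbrakk>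
          \<Longrightarrow> \<guillemotleft>\<psi> \<star> \<phi> : g \<cdot> f \<Rightarrow> g' \<cdot> f'\<guillemotright>"
    and hcomp_Id2_left: "\<lbrakk>\<phi> \<in> Two K; tgt K (Src K \<phi>) = B\<rbrakk> \<Longrightarrow> Id2 K (Id1 K B) \<star> \<phi> = \<phi>"
    and hcomp_Id2_right: "\<lbrakk>\<phi> \<in> Two K; src K (Src K \<phi>) = A\<rbrakk> \<Longrightarrow> \<phi> \<star> Id2 K (Id1 K A) = \<phi>"
    and hcomp_assoc: "\<lbrakk>\<phi> \<in> Two K; \<psi> \<in> Two K; \<chi> \<in> Two K;
          tgt K (Src K \<phi>) = src K (Src K \<psi>); tgt K (Src K \<psi>) = src K (Src K \<chi>)\<rbrakk>
          \<Longrightarrow> (\<chi> \<star> \<psi>) \<star> \<phi> = \<chi> \<star> (\<psi> \<star> \<phi>)"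
    and hcomp_Id2: "\<lbrakk>\<guillemotleft>f : A \<leadsto> B\<guillemotright>; \<guillemotleft>g : B \<leadsto> C\<guillemotright>\<rbrakk> \<Longrightarrow> Id2 K g \<star> Id2 K f = Id2 K (g \<cdot> f)"
    and interchange: "\<lbrakk>\<guillemotleft>\<phi> : f \<Rightarrow> f'\<guillemotright>; \<guillemotleft>\<phi>' : f' \<Rightarrow> f''\<guillemotright>; \<guillemotleft>\<psi> : g \<Rightarrow> g'\<guillemotright>; \<guillemotleft>\<psi>' : g' \<Rightarrow> g''\<guillemotright>;
          tgt K f = src K g\<rbrakk>
          \<Longrightarrow> (\<psi>' \<bullet> \<psi>) \<star> (\<phi>' \<bullet> \<phi>) = (\<psi>' \<star> \<phi>') \<bullet> (\<psi> \<star> \<phi>)"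

locale enhanced_2_category = two_category K
  for K :: "('o, 'a, 'c) enh2cat" (structure) +
  assumes Tight_Loose: "Tight K \<subseteq> Loose K"
    and Id1_Tight: "A \<in> Ob K \<Longrightarrow> Id1 K A \<in> Tight K"
    and comp_Tight: "\<lbrakk>f \<in> Tight K; g \<in> Tight K; tgt K f = src K g\<rbrakk> \<Longrightarrow> g \<cdot> f \<in> Tight K"

locale repletely_enhanced_2_category = enhanced_2_category K
  for K :: "('o, 'a, 'c) enh2cat" (structure) +
  assumes replete: "\<lbrakk>f \<in> Tight K; \<guillemotleft>\<phi> : f \<Rightarrow> g\<guillemotright>; invertible_two_cell K \<phi>\<rbrakk> \<Longrightarrow> g \<in> Tight K"

section \<open>Terminal objects, discrete opfibrations and pullbacks\<close>

context
  fixes K :: "('o, 'a, 'c) enh2cat" (structure)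
begin

definition tight_terminal :: "'o \<Rightarrow> bool" where
  "tight_terminal t \<longleftrightarrow> t \<in> Ob K \<and>
     (\<forall>X\<in>Ob K. \<exists>!f. \<guillemotleft>f : X \<leadsto> t\<guillemotright>) \<and>
     (\<forall>X f g. \<guillemotleft>f : X \<leadsto> t\<guillemotright> \<and> \<guillemotleft>g : X \<leadsto> t\<guillemotright> \<longrightarrow> (\<exists>!\<phi>. \<guillemotleft>\<phi> : f \<Rightarrow> g\<guillemotright>)) \<and>
     (\<forall>X f. \<guillemotleft>f : X \<leadsto> t\<guillemotright> \<longrightarrow> f \<in> Tight K)"

definition tight_discrete_opfibration :: "'a \<Rightarrow> bool" where
  "tight_discrete_opfibration p \<longleftrightarrow> p \<in> Tight K \<and>
     (\<forall>X e b \<phi>. \<guillemotleft>e : X \<leadsto> src K p\<guillemotright> \<and> \<guillemotleft>b : X \<leadsto> tgt K p\<guillemotright> \<and> \<guillemotleft>\<phi> : p \<cdot> e \<Rightarrow> b\<guillemotright> \<longrightarrow>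
        (\<exists>!l. l \<in> Two K \<and> Src K l = e \<and> p \<rhd> l = \<phi>))"

text \<open>
  \<open>square p p' g f\<close>: the pair \<open>(g, f)\<close> is a commuting square \<open>p' \<cdot> g = f \<cdot> p\<close> from \<open>p\<close> to \<open>p'\<close>,
  with \<open>g\<close> between the sources and \<open>f\<close> between the targets.
\<close>

definition square :: "'a \<Rightarrow> 'a \<Rightarrow> 'a \<Rightarrow> 'a \<Rightarrow> bool" where
  "square p p' g f \<longleftrightarrow> p \<in> Loose K \<and> p' \<in> Loose K \<and>
     \<guillemotleft>g : src K p \<leadsto> src K p'\<guillemotright> \<and> \<guillemotleft>f : tgt K p \<leadsto> tgt K p'\<guillemotright> \<and> p' \<cdot> g = f \<cdot> p"

text \<open>The square exhibits \<open>p\<close> as the strict 2-categorical pullback of \<open>p'\<close> along \<open>f\<close>.\<close>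

definition pullback_square :: "'a \<Rightarrow> 'a \<Rightarrow> 'a \<Rightarrow> 'a \<Rightarrow> bool" where
  "pullback_square p p' g f \<longleftrightarrow> square p p' g f \<and>
     (\<forall>X x y. \<guillemotleft>x : X \<leadsto> tgt K p\<guillemotright> \<and> \<guillemotleft>y : X \<leadsto> src K p'\<guillemotright> \<and> f \<cdot> x = p' \<cdot> y \<longrightarrow>
        (\<exists>!h. \<guillemotleft>h : X \<leadsto> src K p\<guillemotright> \<and> p \<cdot> h = x \<and> g \<cdot> h = y)) \<and>
     (\<forall>X h k \<xi> \<eta>. \<guillemotleft>h : X \<leadsto> src K p\<guillemotright> \<and> \<guillemotleft>k : X \<leadsto> src K p\<guillemotright> \<and>
        \<guillemotleft>\<xi> : p \<cdot> h \<Rightarrow> p \<cdot> k\<guillemotright> \<and> \<guillemotleft>\<eta> : g \<cdot> h \<Rightarrow> g \<cdot> k\<guillemotright> \<and> f \<rhd> \<xi> = p' \<rhd> \<eta> \<longrightarrow>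
        (\<exists>!\<theta>. \<guillemotleft>\<theta> : h \<Rightarrow> k\<guillemotright> \<and> p \<rhd> \<theta> = \<xi> \<and> g \<rhd> \<theta> = \<eta>))"

definition left_tight_pullback :: "'a \<Rightarrow> 'a \<Rightarrow> 'a \<Rightarrow> 'a \<Rightarrow> bool" where
  "left_tight_pullback p p' g f \<longleftrightarrow> pullback_square p p' g f \<and> p' \<in> Tight K \<and> p \<in> Tight K \<and>
     (\<forall>X h. \<guillemotleft>h : X \<leadsto> src K p\<guillemotright> \<and> p \<cdot> h \<in> Tight K \<longrightarrow> h \<in> Tight K)"

text \<open>
  For squares \<open>(g, f)\<close> and \<open>(g', f')\<close> from \<open>p\<close> to \<open>p'\<close>: a 2-cell between them in the enhanced
  2-category of discrete opfibrations.
\<close>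

definition square_cell :: "'a \<Rightarrow> 'a \<Rightarrow> 'a \<times> 'a \<Rightarrow> 'a \<times> 'a \<Rightarrow> 'c \<times> 'c \<Rightarrow> bool" where
  "square_cell p p' gf gf' \<gamma> \<longleftrightarrow>
     \<guillemotleft>fst \<gamma> : fst gf \<Rightarrow> fst gf'\<guillemotright> \<and> \<guillemotleft>snd \<gamma> : snd gf \<Rightarrow> snd gf'\<guillemotright> \<and> p' \<rhd> fst \<gamma> = snd \<gamma> \<lhd> p"

end

section \<open>Plumbuses and their representability\<close>

text \<open>
  \<open>PbL p f\<close> is the chosen pullback of \<open>p\<close> along \<open>f\<close>, as a 1-cell into the source of \<open>f\<close>, and
  \<open>PbT p f\<close> is the other projection, into the source of \<open>p\<close>.
\<close>

record 'a smallness =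
  Small :: "'a set"
  PbL :: "'a \<Rightarrow> 'a \<Rightarrow> 'a"
  PbT :: "'a \<Rightarrow> 'a \<Rightarrow> 'a"

text \<open>
  Stability refers to the chosen pullbacks.  It must not be required of every left-tight pullback:
  the strict morphisms among algebras are not closed under composition with invertible
  pseudo-morphisms, although such a composite is again a left-tight pullback along an identity.
\<close>

locale smallness_structure = enhanced_2_category K
  for K :: "('o, 'a, 'c) enh2cat" (structure) +
  fixes S :: "'a smallness"
  assumes small_opfibration: "p \<in> Small S \<Longrightarrow> tight_discrete_opfibration K p"
    and chosen_pullback: "\<lbrakk>p \<in> Small S; \<guillemotleft>f : A \<leadsto> tgt K p\<guillemotright>\<rbrakk>
          \<Longrightarrow> left_tight_pullback K (PbL S p f) p (PbT S p f) f"
    and chosen_pullback_small: "\<lbrakk>p \<in> Small S; \<guillemotleft>f : A \<leadsto> tgt K p\<guillemotright>\<rbrakk> \<Longrightarrow> PbL S p f \<in> Small S"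
    and PbL_Id1: "p \<in> Small S \<Longrightarrow> PbL S p (Id1 K (tgt K p)) = p"
    and PbT_Id1: "p \<in> Small S \<Longrightarrow> PbT S p (Id1 K (tgt K p)) = Id1 K (src K p)"
    and PbL_comp: "\<lbrakk>p \<in> Small S; \<guillemotleft>f : A \<leadsto> tgt K p\<guillemotright>; \<guillemotleft>g : B \<leadsto> A\<guillemotright>\<rbrakk>
          \<Longrightarrow> PbL S p (f \<cdot> g) = PbL S (PbL S p f) g"
    and PbT_comp: "\<lbrakk>p \<in> Small S; \<guillemotleft>f : A \<leadsto> tgt K p\<guillemotright>; \<guillemotleft>g : B \<leadsto> A\<guillemotright>\<rbrakk>
          \<Longrightarrow> PbT S p (f \<cdot> g) = PbT S p f \<cdot> PbT S (PbL S p f) g"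

locale plumbus = repletely_enhanced_2_category K + smallness_structure K S
  for K :: "('o, 'a, 'c) enh2cat" (structure) and S :: "'a smallness" +
  fixes one :: 'o
  assumes one_terminal: "tight_terminal K one"

text \<open>
  \<open>Univ\<close> is the classifier \<open>u\<close>, and the classifying square of \<open>p\<close> has top side \<open>ClT p\<close>
  (written $d_\bullet p$ in the literature) and bottom side \<open>ClB p\<close> (written $dp$).
\<close>

record 'a classifier =
  Univ :: 'a
  ClT :: "'a \<Rightarrow> 'a"
  ClB :: "'a \<Rightarrow> 'a"

locale representable_plumbus = plumbus K S one
  for K :: "('o, 'a, 'c) enh2cat" (structure) and S :: "'a smallness" and one :: 'o +
  fixes C :: "'a classifier"
  assumes Univ_small: "Univ C \<in> Small S"
    and classifying_square: "p \<in> Small S \<Longrightarrow> pullback_square K p (Univ C) (ClT C p) (ClB C p)"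
    and classifying_cell: "\<lbrakk>p \<in> Small S; p' \<in> Small S; square K p p' g f\<rbrakk>
          \<Longrightarrow> \<exists>!\<gamma>. square_cell K p (Univ C) (ClT C p, ClB C p) (ClT C p' \<cdot> g, ClB C p' \<cdot> f) \<gamma>"
    and classifying_cell_invertible: "\<lbrakk>p \<in> Small S; p' \<in> Small S; pullback_square K p p' g f;
          square_cell K p (Univ C) (ClT C p, ClB C p) (ClT C p' \<cdot> g, ClB C p' \<cdot> f) \<gamma>\<rbrakk>
          \<Longrightarrow> invertible_two_cell K (fst \<gamma>) \<and> invertible_two_cell K (snd \<gamma>)"
    and classifying_Univ: "\<exists>\<gamma>. square_cell K (Univ C) (Univ C) (ClT C (Univ C), ClB C (Univ C))
            (Id1 K (src K (Univ C)), Id1 K (tgt K (Univ C))) \<gamma> \<and>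
          invertible_two_cell K (fst \<gamma>) \<and> invertible_two_cell K (snd \<gamma>)"
    and Id1_one_small: "Id1 K one \<in> Small S"

definition perfect :: "('o, 'a, 'c) enh2cat \<Rightarrow> 'a smallness \<Rightarrow> 'a classifier \<Rightarrow> 'a \<Rightarrow> bool" where
  "perfect K S C p \<longleftrightarrow> p \<in> Small S \<and> ClB C p \<in> Tight K"

section \<open>Enhanced 2-monads\<close>

record ('o, 'a, 'c) e2monad =
  T0 :: "'o \<Rightarrow> 'o"
  T1 :: "'a \<Rightarrow> 'a"
  T2 :: "'c \<Rightarrow> 'c"
  unit :: "'o \<Rightarrow> 'a"
  mult :: "'o \<Rightarrow> 'a"

locale enhanced_2_monad = enhanced_2_category K
  for K :: "('o, 'a, 'c) enh2cat" (structure) +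
  fixes T :: "('o, 'a, 'c) e2monad"
  assumes T0_Ob: "A \<in> Ob K \<Longrightarrow> T0 T A \<in> Ob K"
    and T1_cell: "\<guillemotleft>f : A \<leadsto> B\<guillemotright> \<Longrightarrow> \<guillemotleft>T1 T f : T0 T A \<leadsto> T0 T B\<guillemotright>"
    and T2_cell: "\<guillemotleft>\<phi> : f \<Rightarrow> g\<guillemotright> \<Longrightarrow> \<guillemotleft>T2 T \<phi> : T1 T f \<Rightarrow> T1 T g\<guillemotright>"
    and T1_Id1: "A \<in> Ob K \<Longrightarrow> T1 T (Id1 K A) = Id1 K (T0 T A)"
    and T1_comp: "\<lbrakk>\<guillemotleft>f : A \<leadsto> B\<guillemotright>; \<guillemotleft>g : B \<leadsto> D\<guillemotright>\<rbrakk> \<Longrightarrow> T1 T (g \<cdot> f) = T1 T g \<cdot> T1 T f"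
    and T2_Id2: "f \<in> Loose K \<Longrightarrow> T2 T (Id2 K f) = Id2 K (T1 T f)"
    and T2_vcomp: "\<lbrakk>\<guillemotleft>\<phi> : f \<Rightarrow> g\<guillemotright>; \<guillemotleft>\<psi> : g \<Rightarrow> h\<guillemotright>\<rbrakk> \<Longrightarrow> T2 T (\<psi> \<bullet> \<phi>) = T2 T \<psi> \<bullet> T2 T \<phi>"
    and T2_hcomp: "\<lbrakk>\<phi> \<in> Two K; \<psi> \<in> Two K; tgt K (Src K \<phi>) = src K (Src K \<psi>)\<rbrakk>
          \<Longrightarrow> T2 T (\<psi> \<star> \<phi>) = T2 T \<psi> \<star> T2 T \<phi>"
    and T1_Tight: "f \<in> Tight K \<Longrightarrow> T1 T f \<in> Tight K"
    and unit_cell: "A \<in> Ob K \<Longrightarrow> \<guillemotleft>unit T A : A \<leadsto> T0 T A\<guillemotright>"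
    and unit_Tight: "A \<in> Ob K \<Longrightarrow> unit T A \<in> Tight K"
    and unit_natural: "\<guillemotleft>f : A \<leadsto> B\<guillemotright> \<Longrightarrow> unit T B \<cdot> f = T1 T f \<cdot> unit T A"
    and unit_natural2: "\<lbrakk>\<guillemotleft>\<phi> : f \<Rightarrow> g\<guillemotright>; \<guillemotleft>f : A \<leadsto> B\<guillemotright>\<rbrakk>
          \<Longrightarrow> unit T B \<rhd> \<phi> = T2 T \<phi> \<lhd> unit T A"
    and mult_cell: "A \<in> Ob K \<Longrightarrow> \<guillemotleft>mult T A : T0 T (T0 T A) \<leadsto> T0 T A\<guillemotright>"
    and mult_Tight: "A \<in> Ob K \<Longrightarrow> mult T A \<in> Tight K"
    and mult_natural: "\<guillemotleft>f : A \<leadsto> B\<guillemotright> \<Longrightarrow> mult T B \<cdot> T1 T (T1 T f) = T1 T f \<cdot> mult T A"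
    and mult_natural2: "\<lbrakk>\<guillemotleft>\<phi> : f \<Rightarrow> g\<guillemotright>; \<guillemotleft>f : A \<leadsto> B\<guillemotright>\<rbrakk>
          \<Longrightarrow> mult T B \<rhd> T2 T (T2 T \<phi>) = T2 T \<phi> \<lhd> mult T A"
    and mult_unit: "A \<in> Ob K \<Longrightarrow> mult T A \<cdot> unit T (T0 T A) = Id1 K (T0 T A)"
    and mult_T_unit: "A \<in> Ob K \<Longrightarrow> mult T A \<cdot> T1 T (unit T A) = Id1 K (T0 T A)"
    and mult_mult: "A \<in> Ob K \<Longrightarrow> mult T A \<cdot> mult T (T0 T A) = mult T A \<cdot> T1 T (mult T A)"

definition fully_opfibrantly_cartesian ::
  "('o, 'a, 'c) enh2cat \<Rightarrow> 'a smallness \<Rightarrow> 'a classifier \<Rightarrow> ('o, 'a, 'c) e2monad \<Rightarrow> bool" where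
  "fully_opfibrantly_cartesian K S C T \<longleftrightarrow>
     (let u = Univ C; \<Omega>' = src K u; \<Omega> = tgt K u in
       T1 T u \<in> Small S \<and>
       (\<forall>p g f. pullback_square K p u g f \<longrightarrow>
          pullback_square K (T1 T p) (T1 T u) (T1 T g) (T1 T f)) \<and>
       perfect K S C (T1 T u) \<and>
       pullback_square K u (T1 T u) (unit T \<Omega>') (unit T \<Omega>) \<and>
       pullback_square K (T1 T (T1 T u)) (T1 T u) (mult T \<Omega>') (mult T \<Omega>))"

section \<open>Pseudo-algebras and lax morphisms\<close>

datatype ('o, 'a, 'c) alg =
  Alg (Car: 'o) (Act: 'a) (Unt: 'c) (Mul: 'c)

datatype ('o, 'a, 'c) alg_mor =
  Mor (Dom: "('o, 'a, 'c) alg") (Cod: "('o, 'a, 'c) alg") (Und: 'a) (Str: 'c)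

datatype ('o, 'a, 'c) alg_cell =
  Cell (From: "('o, 'a, 'c) alg_mor") (To: "('o, 'a, 'c) alg_mor") (Und2: 'c)

context
  fixes K :: "('o, 'a, 'c) enh2cat" (structure) and T :: "('o, 'a, 'c) e2monad"
begin

fun lax_algebra :: "('o, 'a, 'c) alg \<Rightarrow> bool" where
  "lax_algebra (Alg A \<alpha> \<upsilon> \<mu>) \<longleftrightarrow>
     A \<in> Ob K \<and> \<alpha> \<in> Tight K \<and> \<guillemotleft>\<alpha> : T0 T A \<leadsto> A\<guillemotright> \<and>
     \<guillemotleft>\<upsilon> : Id1 K A \<Rightarrow> \<alpha> \<cdot> unit T A\<guillemotright> \<and>
     \<guillemotleft>\<mu> : \<alpha> \<cdot> T1 T \<alpha> \<Rightarrow> \<alpha> \<cdot> mult T A\<guillemotright> \<and>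
     (\<mu> \<lhd> unit T (T0 T A)) \<bullet> (\<upsilon> \<lhd> \<alpha>) = Id2 K \<alpha> \<and>
     (\<mu> \<lhd> T1 T (unit T A)) \<bullet> (\<alpha> \<rhd> T2 T \<upsilon>) = Id2 K \<alpha> \<and>
     (\<mu> \<lhd> mult T (T0 T A)) \<bullet> (\<mu> \<lhd> T1 T (T1 T \<alpha>)) =
     (\<mu> \<lhd> T1 T (mult T A)) \<bullet> (\<alpha> \<rhd> T2 T \<mu>)"

definition pseudo_algebra :: "('o, 'a, 'c) alg \<Rightarrow> bool" where
  "pseudo_algebra A \<longleftrightarrow>
     lax_algebra A \<and> invertible_two_cell K (Unt A) \<and> invertible_two_cell K (Mul A)"

fun lax_morphism :: "('o, 'a, 'c) alg_mor \<Rightarrow> bool" where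
  "lax_morphism (Mor (Alg A \<alpha> \<upsilon>\<^sub>A \<mu>\<^sub>A) (Alg B \<beta> \<upsilon>\<^sub>B \<mu>\<^sub>B) f f') \<longleftrightarrow>
     lax_algebra (Alg A \<alpha> \<upsilon>\<^sub>A \<mu>\<^sub>A) \<and> lax_algebra (Alg B \<beta> \<upsilon>\<^sub>B \<mu>\<^sub>B) \<and>
     \<guillemotleft>f : A \<leadsto> B\<guillemotright> \<and> \<guillemotleft>f' : \<beta> \<cdot> T1 T f \<Rightarrow> f \<cdot> \<alpha>\<guillemotright> \<and>
     f \<rhd> \<upsilon>\<^sub>A = (f' \<lhd> unit T A) \<bullet> (\<upsilon>\<^sub>B \<lhd> f) \<and>
     (f \<rhd> \<mu>\<^sub>A) \<bullet> (f' \<lhd> T1 T \<alpha>) \<bullet> (\<beta> \<rhd> T2 T f') =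
     (f' \<lhd> mult T A) \<bullet> (\<mu>\<^sub>B \<lhd> T1 T (T1 T f))"

definition strict_morphism :: "('o, 'a, 'c) alg_mor \<Rightarrow> bool" where
  "strict_morphism F \<longleftrightarrow> lax_morphism F \<and> Str F = Id2 K (Und F \<cdot> Act (Dom F))"

fun alg_two_morphism :: "('o, 'a, 'c) alg_cell \<Rightarrow> bool" where
  "alg_two_morphism (Cell F G \<phi>) \<longleftrightarrow>
     lax_morphism F \<and> lax_morphism G \<and> Dom F = Dom G \<and> Cod F = Cod G \<and>
     \<guillemotleft>\<phi> : Und F \<Rightarrow> Und G\<guillemotright> \<and>
     (\<phi> \<lhd> Act (Dom F)) \<bullet> Str F = Str G \<bullet> (Act (Cod F) \<rhd> T2 T \<phi>)"

definition alg_id :: "('o, 'a, 'c) alg \<Rightarrow> ('o, 'a, 'c) alg_mor" where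
  "alg_id A = Mor A A (Id1 K (Car A)) (Id2 K (Act A))"

definition alg_comp ::
  "('o, 'a, 'c) alg_mor \<Rightarrow> ('o, 'a, 'c) alg_mor \<Rightarrow> ('o, 'a, 'c) alg_mor" where
  "alg_comp G F =
     Mor (Dom F) (Cod G) (Und G \<cdot> Und F) ((Und G \<rhd> Str F) \<bullet> (Str G \<lhd> T1 T (Und F)))"

definition PsAlg ::
  "(('o, 'a, 'c) alg, ('o, 'a, 'c) alg_mor, ('o, 'a, 'c) alg_cell) enh2cat" where
  "PsAlg =
    (let loose = {F. lax_morphism F \<and> pseudo_algebra (Dom F) \<and> pseudo_algebra (Cod F)} in
     \<lparr>Ob = {A. pseudo_algebra A},
      Loose = loose,
      Tight = {F \<in> loose. Und F \<in> Tight K \<and> invertible_two_cell K (Str F)},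
      Two = {\<Phi>. alg_two_morphism \<Phi> \<and> From \<Phi> \<in> loose \<and> To \<Phi> \<in> loose},
      src = Dom,
      tgt = Cod,
      Src = From,
      Tgt = To,
      Id1 = alg_id,
      Id2 = (\<lambda>F. Cell F F (Id2 K (Und F))),
      comp = alg_comp,
      vcomp = (\<lambda>\<Psi> \<Phi>. Cell (From \<Phi>) (To \<Psi>) (Und2 \<Psi> \<bullet> Und2 \<Phi>)),
      hcomp = (\<lambda>\<Psi> \<Phi>. Cell (alg_comp (From \<Psi>) (From \<Phi>)) (alg_comp (To \<Psi>) (To \<Phi>))
                 (Und2 \<Psi> \<star> Und2 \<Phi>))\<rparr>)"

definition small_strict :: "'a smallness \<Rightarrow> ('o, 'a, 'c) alg_mor set" where
  "small_strict S = {P \<in> Loose PsAlg. strict_morphism P \<and> Und P \<in> Small S}"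

end

end

theory Submission
  imports Defs
begin

text \<open>
  Everything is inherited from the underlying 2-category along two kinds of uniqueness.

  The first is uniqueness of lifts along a discrete opfibration.  If \<open>P\<close> is a strict morphism of
  algebras whose underlying 1-cell is a discrete opfibration \<open>p\<close>, then two 2-cells into the source of
  \<open>p\<close> agree as soon as their domains and their images under \<open>p\<close> agree, and composition with \<open>P\<close> acts
  on structure cells simply as whiskering by \<open>p\<close>.  Hence the equations defining lax
  morphisms and algebra 2-cells can be checked after applying \<open>p\<close> (\<open>lax_morphism_reflect\<close>,
  \<open>alg_two_morphism_reflect\<close>), and structure on the source of \<open>p\<close> can be created by lifting structure
  from its target.  In this way \<open>P\<close> is a discrete opfibration of algebras (\<open>PsAlg_dopf\<close>), the chosen
  pullback of \<open>p\<close> along a lax morphism carries exactly one algebra structure for which the projection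
  is strict and the square commutes (\<open>strict_pullback_exists\<close>, \<open>strict_pullback_unique\<close>), and the
  resulting square is a pullback of algebras (\<open>PsAlg_pullback\<close>).  Because the structure is unique, the
  chosen pullbacks of algebras inherit strict functoriality from those below
  (\<open>PsAlg_smallness\<close>).

  The second is the universal property of the classifier \<open>u\<close>, in the following form: a pullback
  square from \<open>p\<close> to \<open>u\<close> is initial among all squares from \<open>p\<close> to \<open>u\<close>, and the comparison
  with another pullback square is invertible (\<open>pullback_classifies\<close>).  Here \<open>p\<close> may be any pullback of
  \<open>u\<close>, not only a small one, since it is isomorphic to a chosen, small pullback; this is what
  makes the iterates \<open>T\<^sup>n u\<close> accessible.  As \<open>T\<close> preserves pullbacks of \<open>u\<close>, composing the image under
  \<open>T\<close> of a pullback square from \<open>p\<close> to \<open>u\<close> with the classifying square \<open>(\<omega>', \<omega>)\<close> of \<open>T u\<close> gives a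
  pullback square from \<open>T p\<close> to \<open>u\<close> (\<open>act_pullback\<close>).  Every coherence cell of the universal algebra
  and of the classifying morphisms is therefore the unique comparison out of such a pullback
  square, and every coherence equation is an equation between two such comparisons and holds by
  uniqueness.  The squares of \<open>i\<close> and \<open>m\<close> at \<open>u\<close> being pullbacks makes the unit and the
  multiplication of the universal algebra invertible, and perfection of \<open>T u\<close> makes its action tight.
\<close>

section \<open>Whiskering calculus\<close>

context two_category
begin

lemma twoD: "\<guillemotleft>\<phi> : f \<Rightarrow> g\<guillemotright> \<Longrightarrow> \<phi> \<in> Two K" "\<guillemotleft>\<phi> : f \<Rightarrow> g\<guillemotright> \<Longrightarrow> Src K \<phi> = f"
  "\<guillemotleft>\<phi> : f \<Rightarrow> g\<guillemotright> \<Longrightarrow> Tgt K \<phi> = g"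
  by (auto simp: two_cell_def)

lemma parallel:
  assumes "\<phi> \<in> Two K"
  shows "src K (Tgt K \<phi>) = src K (Src K \<phi>)" "tgt K (Tgt K \<phi>) = tgt K (Src K \<phi>)"
  using assms parallel_src parallel_tgt by auto

lemma comp_facts:
  assumes "f \<in> Loose K" "g \<in> Loose K" "tgt K f = src K g"
  shows "g \<cdot> f \<in> Loose K" "src K (g \<cdot> f) = src K f" "tgt K (g \<cdot> f) = tgt K g"
  using comp_cell[of f "src K f" "tgt K f" g "tgt K g"] assms by (auto simp: one_cell_def)

lemma Id1_facts:
  assumes "A \<in> Ob K"
  shows "Id1 K A \<in> Loose K" "src K (Id1 K A) = A" "tgt K (Id1 K A) = A"
  using Id1_cell[OF assms] by (auto simp: one_cell_def)

lemma Id1_comp: "f \<in> Loose K \<Longrightarrow> tgt K f = B \<Longrightarrow> Id1 K B \<cdot> f = f"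
  "f \<in> Loose K \<Longrightarrow> src K f = B \<Longrightarrow> f \<cdot> Id1 K B = f"
  using comp_Id1_left comp_Id1_right by (auto simp: one_cell_def)

lemma comp_right:
  "\<lbrakk>f \<in> Loose K; g \<in> Loose K; h \<in> Loose K; tgt K f = src K g; tgt K g = src K h\<rbrakk>
    \<Longrightarrow> (h \<cdot> g) \<cdot> f = h \<cdot> (g \<cdot> f)"
  using comp_assoc by (auto simp: one_cell_def)

lemma Id2_facts:
  assumes "f \<in> Loose K"
  shows "Id2 K f \<in> Two K" "Src K (Id2 K f) = f" "Tgt K (Id2 K f) = f"
  using Id2_cell[OF assms] by (auto simp: two_cell_def)

lemma vcomp_facts:
  assumes "\<phi> \<in> Two K" "\<psi> \<in> Two K" "Tgt K \<phi> = Src K \<psi>"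
  shows "\<psi> \<bullet> \<phi> \<in> Two K" "Src K (\<psi> \<bullet> \<phi>) = Src K \<phi>" "Tgt K (\<psi> \<bullet> \<phi>) = Tgt K \<psi>"
  using vcomp_cell[of \<phi> "Src K \<phi>" "Tgt K \<phi>" \<psi> "Tgt K \<psi>"] assms by (auto simp: two_cell_def)

lemma vcomp_Id2: "\<phi> \<in> Two K \<Longrightarrow> Tgt K \<phi> = f \<Longrightarrow> Id2 K f \<bullet> \<phi> = \<phi>"
  "\<phi> \<in> Two K \<Longrightarrow> Src K \<phi> = f \<Longrightarrow> \<phi> \<bullet> Id2 K f = \<phi>"
  using vcomp_Id2_left vcomp_Id2_right by (auto simp: two_cell_def)

lemma vcomp_right:
  "\<lbrakk>\<phi> \<in> Two K; \<psi> \<in> Two K; \<chi> \<in> Two K; Tgt K \<phi> = Src K \<psi>; Tgt K \<psi> = Src K \<chi>\<rbrakk>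
    \<Longrightarrow> (\<chi> \<bullet> \<psi>) \<bullet> \<phi> = \<chi> \<bullet> (\<psi> \<bullet> \<phi>)"
  using vcomp_assoc by (auto simp: two_cell_def)

lemma hcomp_facts:
  assumes "\<phi> \<in> Two K" "\<psi> \<in> Two K" "tgt K (Src K \<phi>) = src K (Src K \<psi>)"
  shows "\<psi> \<star> \<phi> \<in> Two K" "Src K (\<psi> \<star> \<phi>) = Src K \<psi> \<cdot> Src K \<phi>"
    "Tgt K (\<psi> \<star> \<phi>) = Tgt K \<psi> \<cdot> Tgt K \<phi>"
  using hcomp_cell[of \<phi> "Src K \<phi>" "Tgt K \<phi>" \<psi> "Src K \<psi>" "Tgt K \<psi>"] assms
  by (auto simp: two_cell_def)

lemma lwhisker_facts:
  assumes "f \<in> Loose K" "\<phi> \<in> Two K" "tgt K (Src K \<phi>) = src K f"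
  shows "f \<rhd> \<phi> \<in> Two K" "Src K (f \<rhd> \<phi>) = f \<cdot> Src K \<phi>" "Tgt K (f \<rhd> \<phi>) = f \<cdot> Tgt K \<phi>"
  using assms by (simp_all add: lwhisker_def hcomp_facts Id2_facts)

lemma rwhisker_facts:
  assumes "f \<in> Loose K" "\<phi> \<in> Two K" "src K (Src K \<phi>) = tgt K f"
  shows "\<phi> \<lhd> f \<in> Two K" "Src K (\<phi> \<lhd> f) = Src K \<phi> \<cdot> f" "Tgt K (\<phi> \<lhd> f) = Tgt K \<phi> \<cdot> f"
  using assms by (simp_all add: rwhisker_def hcomp_facts Id2_facts)

lemmas two_cat_typing = src_Ob tgt_Ob comp_facts Id1_facts Src_Loose Tgt_Loose parallel
  Id2_facts vcomp_facts lwhisker_facts rwhisker_facts hcomp_facts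

lemma hcomp_right:
  "\<lbrakk>\<phi> \<in> Two K; \<psi> \<in> Two K; \<chi> \<in> Two K;
    tgt K (Src K \<phi>) = src K (Src K \<psi>); tgt K (Src K \<psi>) = src K (Src K \<chi>)\<rbrakk>
    \<Longrightarrow> (\<chi> \<star> \<psi>) \<star> \<phi> = \<chi> \<star> (\<psi> \<star> \<phi>)"
  using hcomp_assoc by blast

lemma hcomp_Id2_Id2:
  "\<lbrakk>f \<in> Loose K; g \<in> Loose K; tgt K f = src K g\<rbrakk> \<Longrightarrow> Id2 K g \<star> Id2 K f = Id2 K (g \<cdot> f)"
  using hcomp_Id2 by (auto simp: one_cell_def)

lemma hcomp_vcomp:
  "\<lbrakk>\<phi> \<in> Two K; \<phi>' \<in> Two K; \<psi> \<in> Two K; \<psi>' \<in> Two K; Tgt K \<phi> = Src K \<phi>'; Tgt K \<psi> = Src K \<psi>';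
     tgt K (Src K \<phi>) = src K (Src K \<psi>)\<rbrakk>
    \<Longrightarrow> (\<psi>' \<bullet> \<psi>) \<star> (\<phi>' \<bullet> \<phi>) = (\<psi>' \<star> \<phi>') \<bullet> (\<psi> \<star> \<phi>)"
  using interchange by (auto simp: two_cell_def)

lemma lwhisker_lwhisker:
  "\<lbrakk>f \<in> Loose K; g \<in> Loose K; \<phi> \<in> Two K; tgt K (Src K \<phi>) = src K f; tgt K f = src K g\<rbrakk>
    \<Longrightarrow> (g \<cdot> f) \<rhd> \<phi> = g \<rhd> (f \<rhd> \<phi>)"
  by (simp add: lwhisker_def hcomp_Id2_Id2[symmetric] hcomp_right two_cat_typing)

lemma rwhisker_rwhisker:
  "\<lbrakk>f \<in> Loose K; g \<in> Loose K; \<phi> \<in> Two K; src K (Src K \<phi>) = tgt K f; tgt K g = src K f\<rbrakk>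
    \<Longrightarrow> (\<phi> \<lhd> f) \<lhd> g = \<phi> \<lhd> (f \<cdot> g)"
  by (simp add: rwhisker_def hcomp_Id2_Id2[symmetric] hcomp_right two_cat_typing)

lemma lwhisker_rwhisker:
  "\<lbrakk>f \<in> Loose K; g \<in> Loose K; \<phi> \<in> Two K; src K (Src K \<phi>) = tgt K g; tgt K (Src K \<phi>) = src K f\<rbrakk>
    \<Longrightarrow> f \<rhd> (\<phi> \<lhd> g) = (f \<rhd> \<phi>) \<lhd> g"
  by (simp add: lwhisker_def rwhisker_def hcomp_right two_cat_typing)

lemma lwhisker_Id1: "\<lbrakk>\<phi> \<in> Two K; tgt K (Src K \<phi>) = B\<rbrakk> \<Longrightarrow> Id1 K B \<rhd> \<phi> = \<phi>"
  by (simp add: lwhisker_def hcomp_Id2_left)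

lemma rwhisker_Id1: "\<lbrakk>\<phi> \<in> Two K; src K (Src K \<phi>) = B\<rbrakk> \<Longrightarrow> \<phi> \<lhd> Id1 K B = \<phi>"
  by (simp add: rwhisker_def hcomp_Id2_right)

lemma lwhisker_Id2: "\<lbrakk>f \<in> Loose K; g \<in> Loose K; tgt K f = src K g\<rbrakk> \<Longrightarrow> g \<rhd> Id2 K f = Id2 K (g \<cdot> f)"
  by (simp add: lwhisker_def hcomp_Id2_Id2)

lemma rwhisker_Id2: "\<lbrakk>f \<in> Loose K; g \<in> Loose K; tgt K f = src K g\<rbrakk> \<Longrightarrow> Id2 K g \<lhd> f = Id2 K (g \<cdot> f)"
  by (simp add: rwhisker_def hcomp_Id2_Id2)

lemma lwhisker_vcomp:
  "\<lbrakk>f \<in> Loose K; \<phi> \<in> Two K; \<psi> \<in> Two K; Tgt K \<phi> = Src K \<psi>; tgt K (Src K \<phi>) = src K f\<rbrakk>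
    \<Longrightarrow> f \<rhd> (\<psi> \<bullet> \<phi>) = (f \<rhd> \<psi>) \<bullet> (f \<rhd> \<phi>)"
  using hcomp_vcomp[of \<phi> \<psi> "Id2 K f" "Id2 K f"]
  by (simp add: lwhisker_def two_cat_typing vcomp_Id2)

lemma rwhisker_vcomp:
  "\<lbrakk>f \<in> Loose K; \<phi> \<in> Two K; \<psi> \<in> Two K; Tgt K \<phi> = Src K \<psi>; src K (Src K \<phi>) = tgt K f\<rbrakk>
    \<Longrightarrow> (\<psi> \<bullet> \<phi>) \<lhd> f = (\<psi> \<lhd> f) \<bullet> (\<phi> \<lhd> f)"
  using hcomp_vcomp[of "Id2 K f" "Id2 K f" \<phi> \<psi>]
  by (simp add: rwhisker_def two_cat_typing vcomp_Id2)

lemma hcomp_whisker: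
  assumes "\<phi> \<in> Two K" "\<psi> \<in> Two K" "tgt K (Src K \<phi>) = src K (Src K \<psi>)"
  shows "\<psi> \<star> \<phi> = (Tgt K \<psi> \<rhd> \<phi>) \<bullet> (\<psi> \<lhd> Src K \<phi>)"
    and "\<psi> \<star> \<phi> = (\<psi> \<lhd> Tgt K \<phi>) \<bullet> (Src K \<psi> \<rhd> \<phi>)"
  using hcomp_vcomp[of "Id2 K (Src K \<phi>)" \<phi> \<psi> "Id2 K (Tgt K \<psi>)"]
    hcomp_vcomp[of \<phi> "Id2 K (Tgt K \<phi>)" "Id2 K (Src K \<psi>)" \<psi>] assms
  by (simp_all add: lwhisker_def rwhisker_def two_cat_typing vcomp_Id2)

lemma whisker_exchange:
  assumes "\<phi> \<in> Two K" "\<psi> \<in> Two K" "tgt K (Src K \<phi>) = src K (Src K \<psi>)"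
  shows "(\<psi> \<lhd> Tgt K \<phi>) \<bullet> (Src K \<psi> \<rhd> \<phi>) = (Tgt K \<psi> \<rhd> \<phi>) \<bullet> (\<psi> \<lhd> Src K \<phi>)"
  using hcomp_whisker[OF assms] by simp

text \<open>
  The rules rewrite a pasting diagram to a right-nested vertical composite of cells of the form
  \<open>(f\<^sub>1 \<rhd> (f\<^sub>2 \<rhd> \<phi>)) \<lhd> (g\<^sub>1 \<cdot> g\<^sub>2)\<close>: left whiskers are nested and applied first, right whiskers are merged.
  Thus a known value of \<open>f \<rhd> \<phi>\<close> always occurs literally in the normal form, and the order of
  horizontally disjoint cells is left to explicit uses of the exchange law.
\<close>

lemmas two_cat_normalize = Id1_comp comp_right vcomp_Id2 vcomp_right lwhisker_lwhisker
  rwhisker_rwhisker lwhisker_rwhisker lwhisker_Id1 rwhisker_Id1 lwhisker_Id2 rwhisker_Id2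
  lwhisker_vcomp rwhisker_vcomp

lemmas two_cat = two_cat_typing two_cat_normalize

text \<open>
  Compositions are normalized to the right, so an equation between composable pairs is also needed
  with a further 1-cell or 2-cell attached; likewise for whiskering and vertical composition below.
\<close>

lemma comp_extend:
  assumes "q \<cdot> p = s \<cdot> r" "x \<in> Loose K" "p \<in> Loose K" "q \<in> Loose K" "r \<in> Loose K" "s \<in> Loose K"
    "tgt K p = src K q" "tgt K r = src K s" "tgt K x = src K p" "src K r = src K p"
  shows "q \<cdot> (p \<cdot> x) = s \<cdot> (r \<cdot> x)"
  using assms comp_right[of x p q] comp_right[of x r s] by simp

lemma lwhisker_extend:
  assumes "q \<cdot> p = s \<cdot> r" "x \<in> Two K" "p \<in> Loose K" "q \<in> Loose K" "r \<in> Loose K" "s \<in> Loose K"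
    "tgt K p = src K q" "tgt K r = src K s" "tgt K (Src K x) = src K p" "src K r = src K p"
  shows "q \<rhd> (p \<rhd> x) = s \<rhd> (r \<rhd> x)"
  using assms lwhisker_lwhisker[of p q x] lwhisker_lwhisker[of r s x] by simp

lemma vcomp_extend:
  assumes "a \<bullet> b = c" "a \<in> Two K" "b \<in> Two K" "Tgt K b = Src K a" "x \<in> Two K" "Tgt K x = Src K b"
  shows "a \<bullet> (b \<bullet> x) = c \<bullet> x"
  using assms vcomp_right[of x b a] by simp

lemma invertibleI:
  assumes "\<phi> \<in> Two K" "\<psi> \<in> Two K" "Src K \<psi> = Tgt K \<phi>" "Tgt K \<psi> = Src K \<phi>"
    "\<psi> \<bullet> \<phi> = Id2 K (Src K \<phi>)" "\<phi> \<bullet> \<psi> = Id2 K (Tgt K \<phi>)"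
  shows "invertible_two_cell K \<phi>"
  using assms by (auto simp: invertible_two_cell_def two_cell_def)

lemma invertibleE:
  assumes "invertible_two_cell K \<phi>"
  obtains \<psi> where "\<phi> \<in> Two K" "\<psi> \<in> Two K" "Src K \<psi> = Tgt K \<phi>" "Tgt K \<psi> = Src K \<phi>"
    "\<psi> \<bullet> \<phi> = Id2 K (Src K \<phi>)" "\<phi> \<bullet> \<psi> = Id2 K (Tgt K \<phi>)" "invertible_two_cell K \<psi>"
proof -
  obtain \<psi> where "\<phi> \<in> Two K" "\<psi> \<in> Two K" "Src K \<psi> = Tgt K \<phi>" "Tgt K \<psi> = Src K \<phi>"
    "\<psi> \<bullet> \<phi> = Id2 K (Src K \<phi>)" "\<phi> \<bullet> \<psi> = Id2 K (Tgt K \<phi>)"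
    using assms by (auto simp: invertible_two_cell_def two_cell_def)
  moreover from this have "invertible_two_cell K \<psi>" by (intro invertibleI) auto
  ultimately show ?thesis using that by blast
qed

lemma invertible_Id2: "f \<in> Loose K \<Longrightarrow> invertible_two_cell K (Id2 K f)"
  by (rule invertibleI[of _ "Id2 K f"]) (simp_all add: two_cat)

lemma invertible_lwhisker:
  assumes "invertible_two_cell K \<phi>" "f \<in> Loose K" "tgt K (Src K \<phi>) = src K f"
  shows "invertible_two_cell K (f \<rhd> \<phi>)"
proof -
  obtain \<psi> where \<psi>: "\<phi> \<in> Two K" "\<psi> \<in> Two K" "Src K \<psi> = Tgt K \<phi>" "Tgt K \<psi> = Src K \<phi>"
    "\<psi> \<bullet> \<phi> = Id2 K (Src K \<phi>)" "\<phi> \<bullet> \<psi> = Id2 K (Tgt K \<phi>)"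
    using assms(1) by (rule invertibleE)
  show ?thesis
    by (rule invertibleI[of _ "f \<rhd> \<psi>"])
      (use \<psi> assms(2,3) in \<open>simp_all add: two_cat flip: lwhisker_vcomp\<close>)
qed

lemma invertible_rwhisker:
  assumes "invertible_two_cell K \<phi>" "f \<in> Loose K" "src K (Src K \<phi>) = tgt K f"
  shows "invertible_two_cell K (\<phi> \<lhd> f)"
proof -
  obtain \<psi> where \<psi>: "\<phi> \<in> Two K" "\<psi> \<in> Two K" "Src K \<psi> = Tgt K \<phi>" "Tgt K \<psi> = Src K \<phi>"
    "\<psi> \<bullet> \<phi> = Id2 K (Src K \<phi>)" "\<phi> \<bullet> \<psi> = Id2 K (Tgt K \<phi>)"
    using assms(1) by (rule invertibleE)
  show ?thesis
    by (rule invertibleI[of _ "\<psi> \<lhd> f"])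
      (use \<psi> assms(2,3) in \<open>simp_all add: two_cat flip: rwhisker_vcomp\<close>)
qed

lemma invertible_vcomp:
  assumes "invertible_two_cell K \<phi>" "invertible_two_cell K \<psi>" "Tgt K \<phi> = Src K \<psi>"
  shows "invertible_two_cell K (\<psi> \<bullet> \<phi>)"
proof -
  obtain \<phi>' where p: "\<phi> \<in> Two K" "\<phi>' \<in> Two K" "Src K \<phi>' = Tgt K \<phi>" "Tgt K \<phi>' = Src K \<phi>"
    "\<phi>' \<bullet> \<phi> = Id2 K (Src K \<phi>)" "\<phi> \<bullet> \<phi>' = Id2 K (Tgt K \<phi>)"
    using assms(1) by (rule invertibleE)
  obtain \<psi>' where q: "\<psi> \<in> Two K" "\<psi>' \<in> Two K" "Src K \<psi>' = Tgt K \<psi>" "Tgt K \<psi>' = Src K \<psi>"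
    "\<psi>' \<bullet> \<psi> = Id2 K (Src K \<psi>)" "\<psi> \<bullet> \<psi>' = Id2 K (Tgt K \<psi>)"
    using assms(2) by (rule invertibleE)
  have "\<psi>' \<bullet> (\<psi> \<bullet> \<phi>) = \<phi>" "\<phi> \<bullet> (\<phi>' \<bullet> \<psi>') = \<psi>'"
    using p q assms(3) by (simp_all add: two_cat flip: vcomp_right)
  then show ?thesis
    by (intro invertibleI[of _ "\<phi>' \<bullet> \<psi>'"]) (use p q assms(3) in \<open>simp_all add: two_cat\<close>)
qed

lemma invertible_cancel_right:
  assumes "invertible_two_cell K \<psi>" "\<phi> \<in> Two K" "\<phi>' \<in> Two K" "Src K \<phi> = Tgt K \<psi>"
    "Src K \<phi>' = Tgt K \<psi>" "\<phi> \<bullet> \<psi> = \<phi>' \<bullet> \<psi>"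
  shows "\<phi> = \<phi>'"
proof -
  obtain \<psi>' where q: "\<psi> \<in> Two K" "\<psi>' \<in> Two K" "Src K \<psi>' = Tgt K \<psi>" "Tgt K \<psi>' = Src K \<psi>"
    "\<psi>' \<bullet> \<psi> = Id2 K (Src K \<psi>)" "\<psi> \<bullet> \<psi>' = Id2 K (Tgt K \<psi>)"
    using assms(1) by (rule invertibleE)
  have "\<phi> = (\<phi> \<bullet> \<psi>) \<bullet> \<psi>'"
    using q assms(2-5) by (simp add: two_cat)
  also have "\<dots> = (\<phi>' \<bullet> \<psi>) \<bullet> \<psi>'" using assms by simp
  also have "\<dots> = \<phi>'"
    using q assms(2-5) by (simp add: two_cat)
  finally show ?thesis .
qed

end

section \<open>Calculus of a 2-monad\<close>

context enhanced_2_monad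
begin

lemma Tight_LooseD: "f \<in> Tight K \<Longrightarrow> f \<in> Loose K"
  using Tight_Loose by blast

lemma T1_facts:
  assumes "f \<in> Loose K"
  shows "T1 T f \<in> Loose K" "src K (T1 T f) = T0 T (src K f)" "tgt K (T1 T f) = T0 T (tgt K f)"
  using T1_cell[of f "src K f" "tgt K f"] assms by (auto simp: one_cell_def)

lemma T2_facts:
  assumes "\<phi> \<in> Two K"
  shows "T2 T \<phi> \<in> Two K" "Src K (T2 T \<phi>) = T1 T (Src K \<phi>)" "Tgt K (T2 T \<phi>) = T1 T (Tgt K \<phi>)"
  using T2_cell[of \<phi> "Src K \<phi>" "Tgt K \<phi>"] assms by (auto simp: two_cell_def)

lemma unit_facts:
  assumes "A \<in> Ob K"
  shows "unit T A \<in> Loose K" "src K (unit T A) = A" "tgt K (unit T A) = T0 T A"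
  using unit_cell[OF assms] by (auto simp: one_cell_def)

lemma mult_facts:
  assumes "A \<in> Ob K"
  shows "mult T A \<in> Loose K" "src K (mult T A) = T0 T (T0 T A)" "tgt K (mult T A) = T0 T A"
  using mult_cell[OF assms] by (auto simp: one_cell_def)

lemmas monad_typing = T0_Ob T1_facts T2_facts unit_facts mult_facts

lemma T1_comp': "\<lbrakk>f \<in> Loose K; g \<in> Loose K; tgt K f = src K g\<rbrakk> \<Longrightarrow> T1 T (g \<cdot> f) = T1 T g \<cdot> T1 T f"
  using T1_comp by (auto simp: one_cell_def)

lemma T2_vcomp': "\<lbrakk>\<phi> \<in> Two K; \<psi> \<in> Two K; Tgt K \<phi> = Src K \<psi>\<rbrakk>
    \<Longrightarrow> T2 T (\<psi> \<bullet> \<phi>) = T2 T \<psi> \<bullet> T2 T \<phi>"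
  using T2_vcomp by (auto simp: two_cell_def)

lemma T2_lwhisker: "\<lbrakk>f \<in> Loose K; \<phi> \<in> Two K; tgt K (Src K \<phi>) = src K f\<rbrakk>
    \<Longrightarrow> T2 T (f \<rhd> \<phi>) = T1 T f \<rhd> T2 T \<phi>"
  by (simp add: lwhisker_def T2_hcomp T2_Id2 two_cat_typing)

lemma T2_rwhisker: "\<lbrakk>f \<in> Loose K; \<phi> \<in> Two K; src K (Src K \<phi>) = tgt K f\<rbrakk>
    \<Longrightarrow> T2 T (\<phi> \<lhd> f) = T2 T \<phi> \<lhd> T1 T f"
  by (simp add: rwhisker_def T2_hcomp T2_Id2 two_cat_typing)

lemma unit_nat: "\<lbrakk>f \<in> Loose K; tgt K f = B\<rbrakk> \<Longrightarrow> unit T B \<cdot> f = T1 T f \<cdot> unit T (src K f)"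
  using unit_natural by (auto simp: one_cell_def)

lemma mult_nat: "\<lbrakk>f \<in> Loose K; tgt K f = B\<rbrakk>
    \<Longrightarrow> mult T B \<cdot> T1 T (T1 T f) = T1 T f \<cdot> mult T (src K f)"
  using mult_natural by (auto simp: one_cell_def)

lemma mult_nat_extend: "\<lbrakk>f \<in> Loose K; tgt K f = B; x \<in> Loose K; tgt K x = T0 T (T0 T (src K f))\<rbrakk>
    \<Longrightarrow> mult T B \<cdot> (T1 T (T1 T f) \<cdot> x) = T1 T f \<cdot> (mult T (src K f) \<cdot> x)"
  by (rule comp_extend[OF mult_nat])
    (auto simp add: monad_typing two_cat_typing)

lemma T_unit_nat: "\<lbrakk>f \<in> Loose K; tgt K f = B\<rbrakk>
    \<Longrightarrow> T1 T (unit T B) \<cdot> T1 T f = T1 T (T1 T f) \<cdot> T1 T (unit T (src K f))"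
  by (auto simp add: monad_typing two_cat_typing unit_nat simp flip: T1_comp')

lemma T_mult_nat: "\<lbrakk>f \<in> Loose K; tgt K f = B\<rbrakk>
    \<Longrightarrow> T1 T (mult T B) \<cdot> T1 T (T1 T (T1 T f)) = T1 T (T1 T f) \<cdot> T1 T (mult T (src K f))"
  by (auto simp add: monad_typing two_cat_typing mult_nat simp flip: T1_comp')

text \<open>
  Naturality moves units and multiplications to the right of 1-cells; associativity prefers \<open>m \<cdot> m\<close> over \<open>m \<cdot> T m\<close>.
\<close>

lemmas monad_normalize = T1_Id1 T2_Id2 T1_comp' T2_vcomp' T2_lwhisker T2_rwhisker
  unit_nat mult_nat mult_nat_extend T_unit_nat T_mult_nat mult_unit mult_T_unit mult_mult[symmetric]

lemmas cat = two_cat monad_typing monad_normalize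

lemma invertible_T2:
  assumes "invertible_two_cell K \<phi>"
  shows "invertible_two_cell K (T2 T \<phi>)"
proof -
  obtain \<psi> where \<psi>: "\<phi> \<in> Two K" "\<psi> \<in> Two K" "Src K \<psi> = Tgt K \<phi>" "Tgt K \<psi> = Src K \<phi>"
    "\<psi> \<bullet> \<phi> = Id2 K (Src K \<phi>)" "\<phi> \<bullet> \<psi> = Id2 K (Tgt K \<phi>)"
    using assms(1) by (rule invertibleE)
  show ?thesis
    by (rule invertibleI[of _ "T2 T \<psi>"])
      (use \<psi> in \<open>simp_all add: two_cat monad_typing T2_Id2 flip: T2_vcomp'\<close>)
qed

section \<open>The 2-category of pseudo-algebras\<close>

lemma lax_algebraD:
  assumes "lax_algebra K T X"
  shows "Car X \<in> Ob K" "Act X \<in> Tight K" "Act X \<in> Loose K"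
    "src K (Act X) = T0 T (Car X)" "tgt K (Act X) = Car X"
    "Unt X \<in> Two K" "Src K (Unt X) = Id1 K (Car X)" "Tgt K (Unt X) = Act X \<cdot> unit T (Car X)"
    "Mul X \<in> Two K" "Src K (Mul X) = Act X \<cdot> T1 T (Act X)" "Tgt K (Mul X) = Act X \<cdot> mult T (Car X)"
  using assms by (cases X; auto simp: one_cell_def two_cell_def)+

lemma lax_algebra_laws:
  assumes "lax_algebra K T X"
  shows "(Mul X \<lhd> unit T (T0 T (Car X))) \<bullet> (Unt X \<lhd> Act X) = Id2 K (Act X)"
    "(Mul X \<lhd> T1 T (unit T (Car X))) \<bullet> (Act X \<rhd> T2 T (Unt X)) = Id2 K (Act X)"
    "(Mul X \<lhd> mult T (T0 T (Car X))) \<bullet> (Mul X \<lhd> T1 T (T1 T (Act X))) =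
     (Mul X \<lhd> T1 T (mult T (Car X))) \<bullet> (Act X \<rhd> T2 T (Mul X))"
  using assms by (cases X; simp)+

lemma lax_algebraI:
  assumes "Car X \<in> Ob K" "Act X \<in> Tight K"
    "src K (Act X) = T0 T (Car X)" "tgt K (Act X) = Car X"
    "Unt X \<in> Two K" "Src K (Unt X) = Id1 K (Car X)" "Tgt K (Unt X) = Act X \<cdot> unit T (Car X)"
    "Mul X \<in> Two K" "Src K (Mul X) = Act X \<cdot> T1 T (Act X)" "Tgt K (Mul X) = Act X \<cdot> mult T (Car X)"
    "(Mul X \<lhd> unit T (T0 T (Car X))) \<bullet> (Unt X \<lhd> Act X) = Id2 K (Act X)"
    "(Mul X \<lhd> T1 T (unit T (Car X))) \<bullet> (Act X \<rhd> T2 T (Unt X)) = Id2 K (Act X)"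
    "(Mul X \<lhd> mult T (T0 T (Car X))) \<bullet> (Mul X \<lhd> T1 T (T1 T (Act X))) =
     (Mul X \<lhd> T1 T (mult T (Car X))) \<bullet> (Act X \<rhd> T2 T (Mul X))"
  shows "lax_algebra K T X"
  using assms by (cases X) (auto simp: one_cell_def two_cell_def Tight_LooseD)

lemma lax_morphismD:
  assumes "lax_morphism K T F"
  shows "lax_algebra K T (Dom F)" "lax_algebra K T (Cod F)"
    "Und F \<in> Loose K" "src K (Und F) = Car (Dom F)" "tgt K (Und F) = Car (Cod F)"
    "Str F \<in> Two K" "Src K (Str F) = Act (Cod F) \<cdot> T1 T (Und F)"
    "Tgt K (Str F) = Und F \<cdot> Act (Dom F)"
proof -
  obtain A \<alpha> ua ma B \<beta> ub mb f f' where F: "F = Mor (Alg A \<alpha> ua ma) (Alg B \<beta> ub mb) f f'"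
    by (metis alg.exhaust alg_mor.exhaust)
  show "lax_algebra K T (Dom F)" "lax_algebra K T (Cod F)"
    "Und F \<in> Loose K" "src K (Und F) = Car (Dom F)" "tgt K (Und F) = Car (Cod F)"
    "Str F \<in> Two K" "Src K (Str F) = Act (Cod F) \<cdot> T1 T (Und F)"
    "Tgt K (Str F) = Und F \<cdot> Act (Dom F)"
    using assms by (auto simp: F one_cell_def two_cell_def)
qed

lemma lax_morphism_laws:
  assumes "lax_morphism K T F"
  shows "Und F \<rhd> Unt (Dom F) = (Str F \<lhd> unit T (Car (Dom F))) \<bullet> (Unt (Cod F) \<lhd> Und F)"
    "(Und F \<rhd> Mul (Dom F)) \<bullet> (Str F \<lhd> T1 T (Act (Dom F))) \<bullet> (Act (Cod F) \<rhd> T2 T (Str F)) =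
     (Str F \<lhd> mult T (Car (Dom F))) \<bullet> (Mul (Cod F) \<lhd> T1 T (T1 T (Und F)))"
proof -
  obtain A \<alpha> ua ma B \<beta> ub mb f f' where F: "F = Mor (Alg A \<alpha> ua ma) (Alg B \<beta> ub mb) f f'"
    by (metis alg.exhaust alg_mor.exhaust)
  show "Und F \<rhd> Unt (Dom F) = (Str F \<lhd> unit T (Car (Dom F))) \<bullet> (Unt (Cod F) \<lhd> Und F)"
    "(Und F \<rhd> Mul (Dom F)) \<bullet> (Str F \<lhd> T1 T (Act (Dom F))) \<bullet> (Act (Cod F) \<rhd> T2 T (Str F)) =
     (Str F \<lhd> mult T (Car (Dom F))) \<bullet> (Mul (Cod F) \<lhd> T1 T (T1 T (Und F)))"
    using assms by (auto simp: F)
qed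

lemma lax_morphismI:
  assumes "lax_algebra K T (Dom F)" "lax_algebra K T (Cod F)"
    "Und F \<in> Loose K" "src K (Und F) = Car (Dom F)" "tgt K (Und F) = Car (Cod F)"
    "Str F \<in> Two K" "Src K (Str F) = Act (Cod F) \<cdot> T1 T (Und F)"
    "Tgt K (Str F) = Und F \<cdot> Act (Dom F)"
    "Und F \<rhd> Unt (Dom F) = (Str F \<lhd> unit T (Car (Dom F))) \<bullet> (Unt (Cod F) \<lhd> Und F)"
    "(Und F \<rhd> Mul (Dom F)) \<bullet> (Str F \<lhd> T1 T (Act (Dom F))) \<bullet> (Act (Cod F) \<rhd> T2 T (Str F)) =
     (Str F \<lhd> mult T (Car (Dom F))) \<bullet> (Mul (Cod F) \<lhd> T1 T (T1 T (Und F)))"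
  shows "lax_morphism K T F"
proof -
  obtain A \<alpha> ua ma B \<beta> ub mb f f' where F: "F = Mor (Alg A \<alpha> ua ma) (Alg B \<beta> ub mb) f f'"
    by (metis alg.exhaust alg_mor.exhaust)
  show ?thesis
    using assms by (simp add: F one_cell_def two_cell_def)
qed

lemma alg_two_morphism_iff:
  "alg_two_morphism K T \<Phi> \<longleftrightarrow>
     lax_morphism K T (From \<Phi>) \<and> lax_morphism K T (To \<Phi>) \<and>
     Dom (To \<Phi>) = Dom (From \<Phi>) \<and> Cod (To \<Phi>) = Cod (From \<Phi>) \<and>
     Und2 \<Phi> \<in> Two K \<and> Src K (Und2 \<Phi>) = Und (From \<Phi>) \<and> Tgt K (Und2 \<Phi>) = Und (To \<Phi>) \<and>
     (Und2 \<Phi> \<lhd> Act (Dom (From \<Phi>))) \<bullet> Str (From \<Phi>) =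
     Str (To \<Phi>) \<bullet> (Act (Cod (From \<Phi>)) \<rhd> T2 T (Und2 \<Phi>))"
  by (cases \<Phi>) (auto simp: two_cell_def)

lemmas alg_typing = lax_algebraD lax_morphismD

lemma lax_morphism_id:
  assumes "lax_algebra K T X"
  shows "lax_morphism K T (alg_id K X)"
  using assms by (intro lax_morphismI) (simp_all add: alg_id_def alg_typing cat)

text \<open>
  The exchange law moves the structure cell of \<open>G\<close> past the image under \<open>T\<close> of that of \<open>F\<close>; then the
  multiplication law of \<open>F\<close>, whiskered by \<open>G\<close>, and that of \<open>G\<close>, whiskered by \<open>T\<^sup>2 F\<close>, apply in turn.
\<close>

lemma lax_morphism_comp:
  assumes F: "lax_morphism K T F" and G: "lax_morphism K T G" and FG: "Cod F = Dom G"
  shows "lax_morphism K T (alg_comp K T G F)"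
proof (rule lax_morphismI)
  note ty = lax_morphismD[OF F] lax_morphismD[OF G] lax_algebraD FG cat
  let ?f = "Und F" and ?g = "Und G" and ?ff = "Str F" and ?gg = "Str G"
  let ?\<alpha> = "Act (Dom F)" and ?\<beta> = "Act (Dom G)" and ?\<gamma> = "Act (Cod G)" and ?A = "Car (Dom F)"
  note FL = lax_morphism_laws[OF F, unfolded FG] and GL = lax_morphism_laws[OF G]
  have "?g \<rhd> (?f \<rhd> Unt (Dom F)) = ?g \<rhd> ((?ff \<lhd> unit T ?A) \<bullet> (Unt (Dom G) \<lhd> ?f))"
    by (simp only: FL)
  also have "\<dots> = ((?g \<rhd> ?ff) \<lhd> unit T ?A) \<bullet> (?g \<rhd> Unt (Dom G)) \<lhd> ?f"
    by (simp add: ty)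
  also have "\<dots> = ((?g \<rhd> ?ff) \<lhd> unit T ?A) \<bullet> (?gg \<lhd> (unit T (Car (Dom G)) \<cdot> ?f)) \<bullet> (Unt (Cod G) \<lhd> (?g \<cdot> ?f))"
    unfolding GL by (simp add: ty)
  finally show "Und (alg_comp K T G F) \<rhd> Unt (Dom (alg_comp K T G F)) =
    (Str (alg_comp K T G F) \<lhd> unit T (Car (Dom (alg_comp K T G F)))) \<bullet>
    (Unt (Cod (alg_comp K T G F)) \<lhd> Und (alg_comp K T G F))"
    by (simp add: alg_comp_def ty)
  have ex: "(?gg \<lhd> T1 T ?f \<cdot> T1 T ?\<alpha>) \<bullet> (?\<gamma> \<rhd> (T1 T ?g \<rhd> T2 T ?ff)) =
      (?g \<rhd> (?\<beta> \<rhd> T2 T ?ff)) \<bullet> (?gg \<lhd> T1 T ?\<beta> \<cdot> T1 T (T1 T ?f))"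
    using whisker_exchange[of "T2 T ?ff" ?gg] by (simp add: ty)
  have F2: "(?g \<rhd> (?f \<rhd> Mul (Dom F))) \<bullet> ((?g \<rhd> ?ff) \<lhd> T1 T ?\<alpha>) \<bullet> (?g \<rhd> (?\<beta> \<rhd> T2 T ?ff)) =
      ((?g \<rhd> ?ff) \<lhd> mult T ?A) \<bullet> ((?g \<rhd> Mul (Dom G)) \<lhd> T1 T (T1 T ?f))"
    using arg_cong[OF FL(2), of "\<lambda>x. ?g \<rhd> x"] by (simp add: ty)
  have G2: "((?g \<rhd> Mul (Dom G)) \<lhd> T1 T (T1 T ?f)) \<bullet> (?gg \<lhd> T1 T ?\<beta> \<cdot> T1 T (T1 T ?f)) \<bullet>
        ((?\<gamma> \<rhd> T2 T ?gg) \<lhd> T1 T (T1 T ?f)) =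
      (?gg \<lhd> (T1 T ?f \<cdot> mult T ?A)) \<bullet> (Mul (Cod G) \<lhd> (T1 T (T1 T ?g) \<cdot> T1 T (T1 T ?f)))"
    using arg_cong[OF GL(2), of "\<lambda>x. x \<lhd> T1 T (T1 T ?f)"] by (simp add: ty)
  have "(?g \<rhd> (?f \<rhd> Mul (Dom F))) \<bullet> ((?g \<rhd> ?ff) \<lhd> T1 T ?\<alpha>) \<bullet> (?gg \<lhd> T1 T ?f \<cdot> T1 T ?\<alpha>) \<bullet>
       (?\<gamma> \<rhd> (T1 T ?g \<rhd> T2 T ?ff)) \<bullet> ((?\<gamma> \<rhd> T2 T ?gg) \<lhd> T1 T (T1 T ?f)) =
     (?g \<rhd> (?f \<rhd> Mul (Dom F))) \<bullet> ((?g \<rhd> ?ff) \<lhd> T1 T ?\<alpha>) \<bullet> 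
       ((?gg \<lhd> T1 T ?f \<cdot> T1 T ?\<alpha>) \<bullet> (?\<gamma> \<rhd> (T1 T ?g \<rhd> T2 T ?ff))) \<bullet> ((?\<gamma> \<rhd> T2 T ?gg) \<lhd> T1 T (T1 T ?f))"
    by (simp add: ty)
  also have "\<dots> = ((?g \<rhd> (?f \<rhd> Mul (Dom F))) \<bullet> ((?g \<rhd> ?ff) \<lhd> T1 T ?\<alpha>) \<bullet> (?g \<rhd> (?\<beta> \<rhd> T2 T ?ff))) \<bullet>
      (?gg \<lhd> T1 T ?\<beta> \<cdot> T1 T (T1 T ?f)) \<bullet> ((?\<gamma> \<rhd> T2 T ?gg) \<lhd> T1 T (T1 T ?f))"
    unfolding ex by (simp add: ty)
  also have "\<dots> = ((?g \<rhd> ?ff) \<lhd> mult T ?A) \<bullet> (((?g \<rhd> Mul (Dom G)) \<lhd> T1 T (T1 T ?f)) \<bullet>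
      (?gg \<lhd> T1 T ?\<beta> \<cdot> T1 T (T1 T ?f)) \<bullet> ((?\<gamma> \<rhd> T2 T ?gg) \<lhd> T1 T (T1 T ?f)))"
    unfolding F2 by (simp add: ty)
  also have "\<dots> = ((?g \<rhd> ?ff) \<lhd> mult T ?A) \<bullet> 
      (?gg \<lhd> (T1 T ?f \<cdot> mult T ?A)) \<bullet> (Mul (Cod G) \<lhd> (T1 T (T1 T ?g) \<cdot> T1 T (T1 T ?f)))"
    unfolding G2 ..
  finally show "(Und (alg_comp K T G F) \<rhd> Mul (Dom (alg_comp K T G F))) \<bullet>
    (Str (alg_comp K T G F) \<lhd> T1 T (Act (Dom (alg_comp K T G F)))) \<bullet>
    (Act (Cod (alg_comp K T G F)) \<rhd> T2 T (Str (alg_comp K T G F))) =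
    (Str (alg_comp K T G F) \<lhd> mult T (Car (Dom (alg_comp K T G F)))) \<bullet>
    (Mul (Cod (alg_comp K T G F)) \<lhd> T1 T (T1 T (Und (alg_comp K T G F))))"
    by (simp add: alg_comp_def ty)
qed (use F G FG in \<open>simp_all add: alg_comp_def alg_typing cat\<close>)

end

text \<open>
  From here on algebras, morphisms and cells are accessed by their selectors only, so that the
  normal form of pasting diagrams is not disturbed by splitting into components.
\<close>

declare alg_two_morphism.simps [simp del] lax_morphism.simps [simp del] lax_algebra.simps [simp del]

context enhanced_2_monad
begin

lemma PsAlg_simps:
  "Ob (PsAlg K T) = {A. pseudo_algebra K T A}"
  "Loose (PsAlg K T) = {F. lax_morphism K T F \<and> pseudo_algebra K T (Dom F) \<and> pseudo_algebra K T (Cod F)}"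
  "Tight (PsAlg K T) = {F \<in> Loose (PsAlg K T). Und F \<in> Tight K \<and> invertible_two_cell K (Str F)}"
  "Two (PsAlg K T) = {\<Phi>. alg_two_morphism K T \<Phi> \<and> From \<Phi> \<in> Loose (PsAlg K T) \<and> To \<Phi> \<in> Loose (PsAlg K T)}"
  "src (PsAlg K T) = Dom" "tgt (PsAlg K T) = Cod"
  "Src (PsAlg K T) = From" "Tgt (PsAlg K T) = To"
  "Id1 (PsAlg K T) = alg_id K"
  "Id2 (PsAlg K T) = (\<lambda>F. Cell F F (Id2 K (Und F)))"
  "comp (PsAlg K T) = alg_comp K T"
  "vcomp (PsAlg K T) = (\<lambda>\<Psi> \<Phi>. Cell (From \<Phi>) (To \<Psi>) (Und2 \<Psi> \<bullet> Und2 \<Phi>))"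
  "hcomp (PsAlg K T) = (\<lambda>\<Psi> \<Phi>. Cell (alg_comp K T (From \<Psi>) (From \<Phi>)) (alg_comp K T (To \<Psi>) (To \<Phi>))
                 (Und2 \<Psi> \<star> Und2 \<Phi>))"
  by (simp_all add: PsAlg_def Let_def)

lemma PsAlg_one_cell:
  "\<guillemotleft>F : X \<leadsto>\<^bsub>PsAlg K T\<^esub> Y\<guillemotright> \<longleftrightarrow>
    lax_morphism K T F \<and> pseudo_algebra K T X \<and> pseudo_algebra K T Y \<and> Dom F = X \<and> Cod F = Y"
  by (auto simp: one_cell_def PsAlg_simps)

lemma PsAlg_two_cell:
  "\<guillemotleft>\<Phi> : F \<Rightarrow>\<^bsub>PsAlg K T\<^esub> G\<guillemotright> \<longleftrightarrow>
    alg_two_morphism K T \<Phi> \<and> pseudo_algebra K T (Dom F) \<and> pseudo_algebra K T (Cod F) \<and>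
    From \<Phi> = F \<and> To \<Phi> = G"
  by (auto simp: two_cell_def PsAlg_simps alg_two_morphism_iff)

lemma pseudo_algebraD: "pseudo_algebra K T X \<Longrightarrow> lax_algebra K T X"
  by (simp add: pseudo_algebra_def)

lemma alg_two_morphismD:
  assumes "alg_two_morphism K T \<Phi>"
  shows "lax_morphism K T (From \<Phi>)" "lax_morphism K T (To \<Phi>)"
    "Dom (To \<Phi>) = Dom (From \<Phi>)" "Cod (To \<Phi>) = Cod (From \<Phi>)"
    "Und2 \<Phi> \<in> Two K" "Src K (Und2 \<Phi>) = Und (From \<Phi>)" "Tgt K (Und2 \<Phi>) = Und (To \<Phi>)"
    "(Und2 \<Phi> \<lhd> Act (Dom (From \<Phi>))) \<bullet> Str (From \<Phi>) =
     Str (To \<Phi>) \<bullet> (Act (Cod (From \<Phi>)) \<rhd> T2 T (Und2 \<Phi>))"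
  using assms by (simp_all add: alg_two_morphism_iff)

lemma alg_comp_sel: "Dom (alg_comp K T G F) = Dom F" "Cod (alg_comp K T G F) = Cod G"
  "Und (alg_comp K T G F) = Und G \<cdot> Und F"
  "Str (alg_comp K T G F) = (Und G \<rhd> Str F) \<bullet> (Str G \<lhd> T1 T (Und F))"
  by (simp_all add: alg_comp_def)

lemma alg_id_sel: "Dom (alg_id K X) = X" "Cod (alg_id K X) = X" "Und (alg_id K X) = Id1 K (Car X)"
  "Str (alg_id K X) = Id2 K (Act X)"
  by (simp_all add: alg_id_def)

lemma alg_morI: "\<lbrakk>Dom F = Dom G; Cod F = Cod G; Und F = Und G; Str F = Str G\<rbrakk> \<Longrightarrow> F = G"
  by (rule alg_mor.expand) simp

lemma alg_cellI: "\<lbrakk>From F = From G; To F = To G; Und2 F = Und2 G\<rbrakk> \<Longrightarrow> F = G"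
  by (rule alg_cell.expand) simp

lemma alg_two_morphism_Id2: "lax_morphism K T F \<Longrightarrow> alg_two_morphism K T (Cell F F (Id2 K (Und F)))"
  by (simp add: alg_two_morphism_iff alg_typing cat)

lemma alg_two_morphism_vcomp:
  assumes "alg_two_morphism K T \<Phi>" "alg_two_morphism K T \<Psi>" "To \<Phi> = From \<Psi>"
  shows "alg_two_morphism K T (Cell (From \<Phi>) (To \<Psi>) (Und2 \<Psi> \<bullet> Und2 \<Phi>))"
proof -
  note ty = alg_two_morphismD(1-7)[OF assms(1)] alg_two_morphismD(1-7)[OF assms(2)] assms(3)
    lax_morphismD lax_algebraD cat
  note e = alg_two_morphismD(8)[OF assms(1)] alg_two_morphismD(8)[OF assms(2)]
  let ?\<alpha> = "Act (Dom (From \<Phi>))" and ?\<beta> = "Act (Cod (From \<Phi>))"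
  have tw: "Dom (From \<Psi>) = Dom (From \<Phi>)" "Cod (From \<Psi>) = Cod (From \<Phi>)"
    using alg_two_morphismD(3,4)[OF assms(1)] assms(3) by simp_all
  have "((Und2 \<Psi> \<bullet> Und2 \<Phi>) \<lhd> ?\<alpha>) \<bullet> Str (From \<Phi>) =
     (Und2 \<Psi> \<lhd> ?\<alpha>) \<bullet> ((Und2 \<Phi> \<lhd> ?\<alpha>) \<bullet> Str (From \<Phi>))"
    by (simp add: ty tw)
  also have "\<dots> = ((Und2 \<Psi> \<lhd> ?\<alpha>) \<bullet> Str (From \<Psi>)) \<bullet> (?\<beta> \<rhd> T2 T (Und2 \<Phi>))"
    unfolding e(1) by (simp add: ty tw)
  also have "\<dots> = Str (To \<Psi>) \<bullet> (?\<beta> \<rhd> T2 T (Und2 \<Psi> \<bullet> Und2 \<Phi>))"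
    using e(2) by (simp add: ty tw)
  finally show ?thesis by (simp add: alg_two_morphism_iff ty tw)
qed

lemma alg_two_morphism_hcomp:
  assumes "alg_two_morphism K T \<Phi>" "alg_two_morphism K T \<Psi>" "Cod (From \<Phi>) = Dom (From \<Psi>)"
  shows "alg_two_morphism K T (Cell (alg_comp K T (From \<Psi>) (From \<Phi>)) (alg_comp K T (To \<Psi>) (To \<Phi>))
                 (Und2 \<Psi> \<star> Und2 \<Phi>))"
proof -
  note ty = alg_two_morphismD(1-7)[OF assms(1)] alg_two_morphismD(1-7)[OF assms(2)] assms(3)
    lax_morphismD lax_algebraD cat
  note e = alg_two_morphismD(8)[OF assms(1)] alg_two_morphismD(8)[OF assms(2)]
  let ?f = "Und (From \<Phi>)" and ?f' = "Und (To \<Phi>)" and ?g = "Und (From \<Psi>)" and ?g' = "Und (To \<Psi>)"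
  let ?\<alpha> = "Act (Dom (From \<Phi>))" and ?\<beta> = "Act (Dom (From \<Psi>))" and ?\<gamma> = "Act (Cod (From \<Psi>))"
  let ?p = "Und2 \<Phi>" and ?q = "Und2 \<Psi>"
  have h: "?q \<star> ?p = (?g' \<rhd> ?p) \<bullet> (?q \<lhd> ?f)"
    using hcomp_whisker(1)[of ?p ?q] by (simp add: ty)
  have e1: "((?g' \<rhd> ?p) \<lhd> ?\<alpha>) \<bullet> (?g' \<rhd> Str (From \<Phi>)) = (?g' \<rhd> Str (To \<Phi>)) \<bullet> (?g' \<rhd> (?\<beta> \<rhd> T2 T ?p))"
    using arg_cong[OF e(1), of "\<lambda>x. ?g' \<rhd> x"] by (simp add: ty)
  have e2: "(?q \<lhd> ?\<beta> \<cdot> T1 T ?f) \<bullet> (Str (From \<Psi>) \<lhd> T1 T ?f) =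
      (Str (To \<Psi>) \<lhd> T1 T ?f) \<bullet> ((?\<gamma> \<rhd> T2 T ?q) \<lhd> T1 T ?f)"
    using arg_cong[OF e(2), of "\<lambda>x. x \<lhd> T1 T ?f"] by (simp add: ty)
  have x1: "(?q \<lhd> ?f \<cdot> ?\<alpha>) \<bullet> (?g \<rhd> Str (From \<Phi>)) = (?g' \<rhd> Str (From \<Phi>)) \<bullet> (?q \<lhd> ?\<beta> \<cdot> T1 T ?f)"
    using whisker_exchange[of "Str (From \<Phi>)" ?q] by (simp add: ty)
  have x2: "(?g' \<rhd> (?\<beta> \<rhd> T2 T ?p)) \<bullet> (Str (To \<Psi>) \<lhd> T1 T ?f) =
      (Str (To \<Psi>) \<lhd> T1 T ?f') \<bullet> (?\<gamma> \<rhd> (T1 T ?g' \<rhd> T2 T ?p))"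
    using whisker_exchange[of "T2 T ?p" "Str (To \<Psi>)"] by (simp add: ty)
  have "((?g' \<rhd> ?p) \<lhd> ?\<alpha>) \<bullet> ((?q \<lhd> ?f \<cdot> ?\<alpha>) \<bullet> (?g \<rhd> Str (From \<Phi>))) \<bullet> (Str (From \<Psi>) \<lhd> T1 T ?f)
    = (((?g' \<rhd> ?p) \<lhd> ?\<alpha>) \<bullet> (?g' \<rhd> Str (From \<Phi>))) \<bullet> ((?q \<lhd> ?\<beta> \<cdot> T1 T ?f) \<bullet> (Str (From \<Psi>) \<lhd> T1 T ?f))"
    unfolding x1 by (simp add: ty)
  also have "\<dots> = (?g' \<rhd> Str (To \<Phi>)) \<bullet> ((?g' \<rhd> (?\<beta> \<rhd> T2 T ?p)) \<bullet> (Str (To \<Psi>) \<lhd> T1 T ?f)) \<bullet>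
      ((?\<gamma> \<rhd> T2 T ?q) \<lhd> T1 T ?f)"
    unfolding e1 e2 by (simp add: ty)
  also have "\<dots> = (?g' \<rhd> Str (To \<Phi>)) \<bullet> (Str (To \<Psi>) \<lhd> T1 T ?f') \<bullet> (?\<gamma> \<rhd> (T1 T ?g' \<rhd> T2 T ?p)) \<bullet>
      ((?\<gamma> \<rhd> T2 T ?q) \<lhd> T1 T ?f)"
    unfolding x2 by (simp add: ty)
  finally show ?thesis
    by (simp add: alg_two_morphism_iff lax_morphism_comp alg_comp_sel h ty)
qed

lemma alg_comp_assoc:
  assumes "lax_morphism K T F" "lax_morphism K T G" "lax_morphism K T H" "Cod F = Dom G" "Cod G = Dom H"
  shows "alg_comp K T (alg_comp K T H G) F = alg_comp K T H (alg_comp K T G F)"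
  using assms(4,5) lax_morphismD[OF assms(1)] lax_morphismD[OF assms(2)] lax_morphismD[OF assms(3)]
  by (intro alg_morI) (simp_all add: alg_comp_sel lax_algebraD cat)

lemma alg_comp_id:
  assumes "lax_morphism K T F"
  shows "Cod F = X \<Longrightarrow> alg_comp K T (alg_id K X) F = F" "Dom F = X \<Longrightarrow> alg_comp K T F (alg_id K X) = F"
  using lax_morphismD[OF assms]
  by (intro alg_morI; simp add: alg_comp_sel alg_id_sel lax_algebraD cat)+

lemma PsAlg_two_category: "two_category (PsAlg K T)"
proof
  fix \<phi> f f' \<psi> g g' assume "\<guillemotleft>\<phi> : f \<Rightarrow>\<^bsub>PsAlg K T\<^esub> f'\<guillemotright>" "\<guillemotleft>\<psi> : g \<Rightarrow>\<^bsub>PsAlg K T\<^esub> g'\<guillemotright>"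
    "tgt (PsAlg K T) f = src (PsAlg K T) g"
  then show "\<guillemotleft>\<psi> \<star>\<^bsub>PsAlg K T\<^esub> \<phi> : g \<cdot>\<^bsub>PsAlg K T\<^esub> f \<Rightarrow>\<^bsub>PsAlg K T\<^esub> g' \<cdot>\<^bsub>PsAlg K T\<^esub> f'\<guillemotright>"
    using alg_two_morphism_hcomp[of \<phi> \<psi>] by (auto simp: PsAlg_two_cell PsAlg_simps alg_comp_sel)
next
  fix \<phi> f f' f'' \<phi>' \<psi> g g' \<psi>' g''
  assume "\<guillemotleft>\<phi> : f \<Rightarrow>\<^bsub>PsAlg K T\<^esub> f'\<guillemotright>" "\<guillemotleft>\<phi>' : f' \<Rightarrow>\<^bsub>PsAlg K T\<^esub> f''\<guillemotright>"
    "\<guillemotleft>\<psi> : g \<Rightarrow>\<^bsub>PsAlg K T\<^esub> g'\<guillemotright>" "\<guillemotleft>\<psi>' : g' \<Rightarrow>\<^bsub>PsAlg K T\<^esub> g''\<guillemotright>"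
    "tgt (PsAlg K T) f = src (PsAlg K T) g"
  then show "(\<psi>' \<bullet>\<^bsub>PsAlg K T\<^esub> \<psi>) \<star>\<^bsub>PsAlg K T\<^esub> (\<phi>' \<bullet>\<^bsub>PsAlg K T\<^esub> \<phi>) =
    (\<psi>' \<star>\<^bsub>PsAlg K T\<^esub> \<phi>') \<bullet>\<^bsub>PsAlg K T\<^esub> (\<psi> \<star>\<^bsub>PsAlg K T\<^esub> \<phi>)"
    by (auto simp: PsAlg_two_cell PsAlg_simps alg_two_morphism_iff lax_morphismD intro!: hcomp_vcomp)
qed (auto simp: PsAlg_two_cell PsAlg_one_cell PsAlg_simps alg_comp_sel alg_id_sel pseudo_algebraD
    lax_morphism_id lax_morphism_comp alg_comp_assoc alg_comp_id alg_two_morphism_Id2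
    alg_two_morphism_vcomp alg_two_morphismD lax_morphismD lax_algebraD cat hcomp_right hcomp_Id2_Id2
    hcomp_Id2_left hcomp_Id2_right
    intro: alg_cellI)

lemma PsAlg_enhanced: "enhanced_2_category (PsAlg K T)"
proof -
  interpret P: two_category "PsAlg K T" by (rule PsAlg_two_category)
  show ?thesis
  proof
    fix F G assume a: "F \<in> Tight (PsAlg K T)" "G \<in> Tight (PsAlg K T)" "tgt (PsAlg K T) F = src (PsAlg K T) G"
    then have F: "lax_morphism K T F" and G: "lax_morphism K T G" and FG: "Cod F = Dom G"
      by (auto simp: PsAlg_simps)
    have "invertible_two_cell K (Str (alg_comp K T G F))"
      unfolding alg_comp_sel
      by (intro invertible_vcomp invertible_lwhisker invertible_rwhisker)
        (use a lax_morphismD[OF F] lax_morphismD[OF G] FG in \<open>auto simp: PsAlg_simps lax_algebraD cat\<close>)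
    then show "G \<cdot>\<^bsub>PsAlg K T\<^esub> F \<in> Tight (PsAlg K T)"
      using a lax_morphism_comp[OF F G FG] lax_morphismD[OF F] lax_morphismD[OF G]
      by (auto simp: PsAlg_simps alg_comp_sel comp_Tight)
  qed (auto simp: PsAlg_simps lax_morphism_id pseudo_algebraD alg_id_sel lax_algebraD Id1_Tight
      intro: invertible_Id2)
qed

end

sublocale enhanced_2_monad \<subseteq> Alg: enhanced_2_category "PsAlg K T"
  by (rule PsAlg_enhanced)

context enhanced_2_monad
begin

text \<open>
  Multiplying the compatibility equation of a 2-cell from both sides with whiskered inverses gives
  the compatibility equation of its inverse.
\<close>

lemma PsAlg_invertible:
  assumes "\<Phi> \<in> Two (PsAlg K T)"
  shows "invertible_two_cell (PsAlg K T) \<Phi> \<longleftrightarrow> invertible_two_cell K (Und2 \<Phi>)"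
proof
  assume "invertible_two_cell (PsAlg K T) \<Phi>"
  then obtain \<Psi> where "\<Phi> \<in> Two (PsAlg K T)" "\<Psi> \<in> Two (PsAlg K T)" "From \<Psi> = To \<Phi>" "To \<Psi> = From \<Phi>"
    "\<Psi> \<bullet>\<^bsub>PsAlg K T\<^esub> \<Phi> = Id2 (PsAlg K T) (From \<Phi>)" "\<Phi> \<bullet>\<^bsub>PsAlg K T\<^esub> \<Psi> = Id2 (PsAlg K T) (To \<Phi>)"
    by (rule Alg.invertibleE) (simp add: PsAlg_simps)
  then show "invertible_two_cell K (Und2 \<Phi>)"
    by (intro invertibleI[of _ "Und2 \<Psi>"]) (auto simp: PsAlg_simps alg_two_morphism_iff)
next
  assume "invertible_two_cell K (Und2 \<Phi>)"
  then obtain \<psi> where \<psi>: "Und2 \<Phi> \<in> Two K" "\<psi> \<in> Two K" "Src K \<psi> = Tgt K (Und2 \<Phi>)" "Tgt K \<psi> = Src K (Und2 \<Phi>)"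
    "\<psi> \<bullet> Und2 \<Phi> = Id2 K (Src K (Und2 \<Phi>))" "Und2 \<Phi> \<bullet> \<psi> = Id2 K (Tgt K (Und2 \<Phi>))"
    by (rule invertibleE)
  have A: "alg_two_morphism K T \<Phi>" using assms by (simp add: PsAlg_simps)
  let ?F = "From \<Phi>" and ?G = "To \<Phi>" and ?p = "Und2 \<Phi>"
  let ?\<alpha> = "Act (Dom ?F)" and ?\<beta> = "Act (Cod ?F)"
  note ty = alg_two_morphismD(1-7)[OF A] \<psi> lax_morphismD lax_algebraD cat
  have c: "(\<psi> \<lhd> ?\<alpha>) \<bullet> (?p \<lhd> ?\<alpha>) = Id2 K (Und ?F \<cdot> ?\<alpha>)"
    "(?\<beta> \<rhd> T2 T ?p) \<bullet> (?\<beta> \<rhd> T2 T \<psi>) = Id2 K (?\<beta> \<cdot> T1 T (Und ?G))"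
    using arg_cong[OF \<psi>(5), of "\<lambda>x. x \<lhd> ?\<alpha>"] arg_cong[OF \<psi>(6), of "\<lambda>x. ?\<beta> \<rhd> T2 T x"]
    by (simp_all add: ty del: \<psi>(5,6))
  have "(\<psi> \<lhd> ?\<alpha>) \<bullet> Str ?G = (\<psi> \<lhd> ?\<alpha>) \<bullet> (Str ?G \<bullet> ((?\<beta> \<rhd> T2 T ?p) \<bullet> (?\<beta> \<rhd> T2 T \<psi>)))"
    unfolding c by (simp add: ty)
  also have "\<dots> = (\<psi> \<lhd> ?\<alpha>) \<bullet> (Str ?G \<bullet> (?\<beta> \<rhd> T2 T ?p)) \<bullet> (?\<beta> \<rhd> T2 T \<psi>)"
    by (simp add: ty)
  also have "\<dots> = ((\<psi> \<lhd> ?\<alpha>) \<bullet> (?p \<lhd> ?\<alpha>)) \<bullet> (Str ?F \<bullet> (?\<beta> \<rhd> T2 T \<psi>))"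
    unfolding alg_two_morphismD(8)[OF A, symmetric] by (simp add: ty)
  also have "\<dots> = Str ?F \<bullet> (?\<beta> \<rhd> T2 T \<psi>)"
    unfolding c by (simp add: ty)
  finally have "alg_two_morphism K T (Cell ?G ?F \<psi>)"
    by (simp add: alg_two_morphism_iff ty)
  then show "invertible_two_cell (PsAlg K T) \<Phi>"
    by (intro Alg.invertibleI[of _ "Cell ?G ?F \<psi>"])
      (use assms in \<open>auto simp: PsAlg_simps ty intro: alg_cellI\<close>)
qed

text \<open>
  Compatibility of an invertible 2-cell \<open>F \<Rightarrow> G\<close> with the structure expresses the structure cell of
  \<open>G\<close>, up to invertible cells, by that of \<open>F\<close>.
\<close>

lemma PsAlg_replete:
  assumes "repletely_enhanced_2_category K"
  shows "repletely_enhanced_2_category (PsAlg K T)"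
proof
  interpret R: repletely_enhanced_2_category K by fact
  fix F \<Phi> G assume a: "F \<in> Tight (PsAlg K T)" "\<guillemotleft>\<Phi> : F \<Rightarrow>\<^bsub>PsAlg K T\<^esub> G\<guillemotright>" "invertible_two_cell (PsAlg K T) \<Phi>"
  then have Two: "\<Phi> \<in> Two (PsAlg K T)" and FT: "From \<Phi> = F" "To \<Phi> = G"
    by (auto simp: two_cell_def PsAlg_simps)
  then have inv: "invertible_two_cell K (Und2 \<Phi>)" and A: "alg_two_morphism K T \<Phi>"
    using a(3) PsAlg_invertible by (auto simp: PsAlg_simps)
  let ?p = "Und2 \<Phi>" and ?\<alpha> = "Act (Dom F)" and ?\<beta> = "Act (Cod F)"
  note ty = alg_two_morphismD(1-7)[OF A, unfolded FT] lax_morphismD lax_algebraD cat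
  have t: "Und G \<in> Tight K"
    using R.replete[of "Und F" ?p "Und G"] a(1) inv
    by (auto simp: PsAlg_simps two_cell_def ty)
  have i2: "invertible_two_cell K (?\<beta> \<rhd> T2 T ?p)"
    by (intro invertible_lwhisker invertible_T2 inv) (simp_all add: ty)
  have "invertible_two_cell K ((?p \<lhd> ?\<alpha>) \<bullet> Str F)"
    by (intro invertible_vcomp invertible_rwhisker inv) (use a(1) in \<open>auto simp: ty PsAlg_simps\<close>)
  then have i: "invertible_two_cell K (Str G \<bullet> (?\<beta> \<rhd> T2 T ?p))"
    using alg_two_morphismD(8)[OF A] FT by simp
  obtain \<psi> where \<psi>: "(?\<beta> \<rhd> T2 T ?p) \<in> Two K" "\<psi> \<in> Two K" "Src K \<psi> = Tgt K (?\<beta> \<rhd> T2 T ?p)"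
    "Tgt K \<psi> = Src K (?\<beta> \<rhd> T2 T ?p)"
    "(?\<beta> \<rhd> T2 T ?p) \<bullet> \<psi> = Id2 K (Tgt K (?\<beta> \<rhd> T2 T ?p))" "invertible_two_cell K \<psi>"
    using i2 by (rule invertibleE)
  have "invertible_two_cell K ((Str G \<bullet> (?\<beta> \<rhd> T2 T ?p)) \<bullet> \<psi>)"
    by (intro invertible_vcomp i \<psi>) (use \<psi> in \<open>simp add: ty\<close>)
  then have "invertible_two_cell K (Str G)"
    using \<psi> by (simp add: ty)
  with t Two FT show "G \<in> Tight (PsAlg K T)"
    by (auto simp: PsAlg_simps)
qed

text \<open>
  Parallel 1-cells into a terminal object are equal and there is exactly one 2-cell between them, so
  structure cells exist and are invertible, and all equations between them hold.
\<close>

lemma PsAlg_terminal: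
  assumes "tight_terminal K t"
  shows "\<exists>t'. Car t' = t \<and> tight_terminal (PsAlg K T) t'"
proof -
  have t: "t \<in> Ob K" "\<And>X. X \<in> Ob K \<Longrightarrow> \<exists>!f. \<guillemotleft>f : X \<leadsto> t\<guillemotright>"
    "\<And>X f g. \<guillemotleft>f : X \<leadsto> t\<guillemotright> \<Longrightarrow> \<guillemotleft>g : X \<leadsto> t\<guillemotright> \<Longrightarrow> \<exists>!\<phi>. \<guillemotleft>\<phi> : f \<Rightarrow> g\<guillemotright>"
    "\<And>X f. \<guillemotleft>f : X \<leadsto> t\<guillemotright> \<Longrightarrow> f \<in> Tight K"
    using assms by (simp_all add: tight_terminal_def)
  have one: "t \<in> Ob K" "\<And>X. X \<in> Ob K \<Longrightarrow> \<exists>f. f \<in> Loose K \<and> src K f = X \<and> tgt K f = t"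
    using t(1) t(2) ex1_implies_ex unfolding one_cell_def by fast+
  have one_eq: "f = g" if "f \<in> Loose K" "tgt K f = t" "g \<in> Loose K" "tgt K g = t" "src K f = src K g" for f g
    using t(2)[of "src K f"] that by (auto simp: one_cell_def src_Ob)
  have cell: "\<exists>\<phi>. \<phi> \<in> Two K \<and> Src K \<phi> = f \<and> Tgt K \<phi> = g"
    if "f \<in> Loose K" "tgt K f = t" "g \<in> Loose K" "tgt K g = t" "src K f = src K g" for f g
    using t(3)[of f "src K f" g] that by (auto simp: one_cell_def two_cell_def)
  have tight: "f \<in> Tight K" if "f \<in> Loose K" "tgt K f = t" for f
    using t(4)[of f "src K f"] that by (simp add: one_cell_def)
  have cell_eq: "\<phi> = \<psi>" if "\<phi> \<in> Two K" "\<psi> \<in> Two K" "tgt K (Src K \<phi>) = t" "Src K \<phi> = Src K \<psi>"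
    "Tgt K \<phi> = Tgt K \<psi>" for \<phi> \<psi>
  proof -
    have "\<exists>!\<theta>. \<guillemotleft>\<theta> : Src K \<phi> \<Rightarrow> Tgt K \<phi>\<guillemotright>"
      using that by (intro t(3)[of _ "src K (Src K \<phi>)"]) (simp_all add: one_cell_def two_cat_typing)
    then show ?thesis using that by (auto simp: two_cell_def)
  qed
  obtain a where a: "a \<in> Loose K" "src K a = T0 T t" "tgt K a = t" using one T0_Ob by blast
  obtain \<upsilon> where u: "\<upsilon> \<in> Two K" "Src K \<upsilon> = Id1 K t" "Tgt K \<upsilon> = a \<cdot> unit T t"
    using cell[of "Id1 K t" "a \<cdot> unit T t"] by (auto simp: one a cat)
  obtain \<mu> where m: "\<mu> \<in> Two K" "Src K \<mu> = a \<cdot> T1 T a" "Tgt K \<mu> = a \<cdot> mult T t"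
    using cell[of "a \<cdot> T1 T a" "a \<cdot> mult T t"] by (auto simp: one a cat)
  have inv: "invertible_two_cell K \<phi>" if \<phi>: "\<phi> \<in> Two K" "tgt K (Src K \<phi>) = t" for \<phi>
  proof -
    obtain \<psi> where \<psi>: "\<psi> \<in> Two K" "Src K \<psi> = Tgt K \<phi>" "Tgt K \<psi> = Src K \<phi>"
      using cell[of "Tgt K \<phi>" "Src K \<phi>"] \<phi> by (auto simp: two_cat_typing)
    show ?thesis
      by (rule invertibleI[of _ \<psi>]; (rule cell_eq)?) (use \<phi> \<psi> in \<open>simp_all add: cat\<close>)
  qed
  let ?t = "Alg t a \<upsilon> \<mu>"
  note ty = one(1) a u m cat
  have un1: "a \<cdot> (unit T t \<cdot> a) = a" "a \<cdot> (T1 T a \<cdot> unit T (T0 T t)) = a"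
    "a \<cdot> (T1 T a \<cdot> T1 T (unit T t)) = a"
    by (rule one_eq; simp add: ty)+
  have "lax_algebra K T ?t"
    by (rule lax_algebraI; (rule cell_eq)?) (simp_all add: ty tight un1)
  then have ps: "pseudo_algebra K T ?t"
    by (simp add: pseudo_algebra_def inv u m ty)
  note ty = one(1) a u m cat lax_morphismD lax_algebraD
  have to_t: "F \<in> Tight (PsAlg K T)" if "\<guillemotleft>F : X \<leadsto>\<^bsub>PsAlg K T\<^esub> ?t\<guillemotright>" for F X
    using that by (auto simp: PsAlg_simps PsAlg_one_cell ty intro!: tight inv)
  have eq: "F = G" if "\<guillemotleft>F : X \<leadsto>\<^bsub>PsAlg K T\<^esub> ?t\<guillemotright>" "\<guillemotleft>G : X \<leadsto>\<^bsub>PsAlg K T\<^esub> ?t\<guillemotright>" for F G X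
  proof -
    have un: "Und F = Und G"
      by (rule one_eq) (use that in \<open>auto simp: PsAlg_one_cell ty\<close>)
    have "Str F = Str G"
      by (rule cell_eq) (use that un in \<open>auto simp: PsAlg_one_cell ty\<close>)
    with un that show ?thesis by (auto simp: PsAlg_one_cell intro: alg_morI)
  qed
  have ex: "\<exists>F. \<guillemotleft>F : X \<leadsto>\<^bsub>PsAlg K T\<^esub> ?t\<guillemotright>" if X: "pseudo_algebra K T X" for X
  proof -
    note XL = pseudo_algebraD[OF X]
    obtain f where f: "f \<in> Loose K" "src K f = Car X" "tgt K f = t" using one lax_algebraD(1)[OF XL] by blast
    obtain ff where ff: "ff \<in> Two K" "Src K ff = a \<cdot> T1 T f" "Tgt K ff = f \<cdot> Act X"
      using cell[of "a \<cdot> T1 T f" "f \<cdot> Act X"] f by (auto simp: ty XL)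
    have un: "f \<cdot> (Act X \<cdot> unit T (Car X)) = f" "a \<cdot> (T1 T f \<cdot> unit T (Car X)) = f"
      by (rule one_eq; simp add: ty XL f)+
    have "lax_morphism K T (Mor X ?t f ff)"
      by (rule lax_morphismI; (rule cell_eq)?)
        (simp_all add: ty XL f ff un \<open>lax_algebra K T ?t\<close>)
    then show ?thesis using X ps by (auto simp: PsAlg_one_cell)
  qed
  have ex2: "\<exists>!\<Phi>. \<guillemotleft>\<Phi> : F \<Rightarrow>\<^bsub>PsAlg K T\<^esub> F\<guillemotright>" if F: "\<guillemotleft>F : X \<leadsto>\<^bsub>PsAlg K T\<^esub> ?t\<guillemotright>" for F X
  proof
    show "\<guillemotleft>Id2 (PsAlg K T) F : F \<Rightarrow>\<^bsub>PsAlg K T\<^esub> F\<guillemotright>"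
      using F by (intro Alg.Id2_cell) (simp add: one_cell_def)
    fix \<Phi> assume "\<guillemotleft>\<Phi> : F \<Rightarrow>\<^bsub>PsAlg K T\<^esub> F\<guillemotright>"
    with F show "\<Phi> = Id2 (PsAlg K T) F"
      by (intro alg_cellI cell_eq) (auto simp: PsAlg_two_cell PsAlg_one_cell alg_two_morphism_iff PsAlg_simps ty)
  qed
  have "tight_terminal (PsAlg K T) ?t"
    unfolding tight_terminal_def
  proof (intro conjI ballI allI impI)
    show "?t \<in> Ob (PsAlg K T)" using ps by (simp add: PsAlg_simps)
    show "\<exists>!f. \<guillemotleft>f : X \<leadsto>\<^bsub>PsAlg K T\<^esub> ?t\<guillemotright>" if "X \<in> Ob (PsAlg K T)" for X
      using that ex[of X] eq by (auto simp: PsAlg_simps)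
    show "\<exists>!\<phi>. \<guillemotleft>\<phi> : F \<Rightarrow>\<^bsub>PsAlg K T\<^esub> G\<guillemotright>"
      if "\<guillemotleft>F : X \<leadsto>\<^bsub>PsAlg K T\<^esub> ?t\<guillemotright> \<and> \<guillemotleft>G : X \<leadsto>\<^bsub>PsAlg K T\<^esub> ?t\<guillemotright>" for X F G
      using that eq[of F X G] ex2 by auto
  qed (rule to_t)
  then show ?thesis by (intro exI[of _ ?t]) simp
qed

end

section \<open>Discrete opfibrations and pullbacks\<close>

context two_category
begin

lemma dopf_lift:
  assumes "tight_discrete_opfibration K p" "p \<in> Loose K" "e \<in> Loose K" "tgt K e = src K p"
    "\<phi> \<in> Two K" "Src K \<phi> = p \<cdot> e"
  obtains l where "l \<in> Two K" "Src K l = e" "p \<rhd> l = \<phi>" "p \<cdot> Tgt K l = Tgt K \<phi>"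
proof -
  have "\<guillemotleft>e : src K e \<leadsto> src K p\<guillemotright> \<and> \<guillemotleft>Tgt K \<phi> : src K e \<leadsto> tgt K p\<guillemotright> \<and> \<guillemotleft>\<phi> : p \<cdot> e \<Rightarrow> Tgt K \<phi>\<guillemotright>"
    using assms by (simp add: one_cell_def two_cell_def two_cat_typing)
  then have "\<exists>!l. l \<in> Two K \<and> Src K l = e \<and> p \<rhd> l = \<phi>"
    using assms(1) unfolding tight_discrete_opfibration_def by blast
  then obtain l where "l \<in> Two K" "Src K l = e" "p \<rhd> l = \<phi>" by blast
  then show ?thesis using that[of l] lwhisker_facts(3)[of p l] assms by simp
qed

text \<open>
  The uniqueness half of the lifting property, and the main tool for verifying coherence.  Since only
  the domains are assumed to agree, it also yields that the codomains agree, which is how equations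
  between 1-cells will be obtained.
\<close>

lemma dopf_cancel:
  assumes "tight_discrete_opfibration K p" "p \<in> Loose K" "a \<in> Two K" "b \<in> Two K" "Src K a = Src K b"
    "tgt K (Src K b) = src K p" "p \<rhd> a = p \<rhd> b"
  shows "a = b"
proof -
  have "\<guillemotleft>Src K b : src K (Src K b) \<leadsto> src K p\<guillemotright> \<and> \<guillemotleft>p \<cdot> Tgt K b : src K (Src K b) \<leadsto> tgt K p\<guillemotright> \<and>
      \<guillemotleft>p \<rhd> b : p \<cdot> Src K b \<Rightarrow> p \<cdot> Tgt K b\<guillemotright>"
    using assms(2,4,6) by (simp add: one_cell_def two_cell_def two_cat_typing)
  then have "\<exists>!l. l \<in> Two K \<and> Src K l = Src K b \<and> p \<rhd> l = p \<rhd> b"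
    using assms(1) unfolding tight_discrete_opfibration_def by blast
  then show ?thesis using assms by blast
qed

text \<open>
  A lift of the inverse, started at the codomain, is an inverse of the lift, because both
  composites lift identities.
\<close>

lemma dopf_invertible:
  assumes p: "tight_discrete_opfibration K p" "p \<in> Loose K" and l: "l \<in> Two K" "tgt K (Src K l) = src K p"
    and i: "invertible_two_cell K (p \<rhd> l)"
  shows "invertible_two_cell K l"
proof -
  obtain \<psi> where \<psi>: "\<psi> \<in> Two K" "Src K \<psi> = p \<cdot> Tgt K l" "Tgt K \<psi> = p \<cdot> Src K l"
    "\<psi> \<bullet> (p \<rhd> l) = Id2 K (p \<cdot> Src K l)" "(p \<rhd> l) \<bullet> \<psi> = Id2 K (p \<cdot> Tgt K l)"
    using i by (rule invertibleE) (use p l in \<open>simp add: two_cat\<close>)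
  obtain m where m: "m \<in> Two K" "Src K m = Tgt K l" "p \<rhd> m = \<psi>"
    using dopf_lift[OF p _ _ \<psi>(1,2)] l by (auto simp: two_cat_typing)
  have e: "m \<bullet> l = Id2 K (Src K l)"
    by (rule dopf_cancel[OF p]) (use p l m \<psi> in \<open>simp_all add: two_cat\<close>)
  have t: "Tgt K m = Src K l"
    using arg_cong[OF e, of "Tgt K"] l m by (simp add: two_cat_typing)
  have "l \<bullet> m = Id2 K (Tgt K l)"
    by (rule dopf_cancel[OF p]) (use p l m t \<psi> in \<open>simp_all add: two_cat\<close>)
  with e t m l show ?thesis by (intro invertibleI[of _ m]) auto
qed

lemma squareD:
  assumes "square K p p' g f"
  shows "p \<in> Loose K" "p' \<in> Loose K" "g \<in> Loose K" "f \<in> Loose K" "src K g = src K p"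
    "tgt K g = src K p'" "src K f = tgt K p" "tgt K f = tgt K p'" "p' \<cdot> g = f \<cdot> p"
  using assms by (auto simp: square_def one_cell_def)

lemma squareI:
  assumes "p \<in> Loose K" "p' \<in> Loose K" "g \<in> Loose K" "f \<in> Loose K" "src K g = src K p"
    "tgt K g = src K p'" "src K f = tgt K p" "tgt K f = tgt K p'" "p' \<cdot> g = f \<cdot> p"
  shows "square K p p' g f"
  using assms by (auto simp: square_def one_cell_def)

lemma pullback_squareD: "pullback_square K p p' g f \<Longrightarrow> square K p p' g f"
  by (simp add: pullback_square_def)

lemma pullback_lift:
  assumes "pullback_square K p p' g f" "x \<in> Loose K" "y \<in> Loose K" "tgt K x = tgt K p"
    "tgt K y = src K p'" "src K x = src K y" "f \<cdot> x = p' \<cdot> y"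
  obtains h where "h \<in> Loose K" "src K h = src K y" "tgt K h = src K p" "p \<cdot> h = x" "g \<cdot> h = y"
proof -
  have "\<guillemotleft>x : src K y \<leadsto> tgt K p\<guillemotright> \<and> \<guillemotleft>y : src K y \<leadsto> src K p'\<guillemotright> \<and> f \<cdot> x = p' \<cdot> y"
    using assms by (simp add: one_cell_def)
  then have "\<exists>!h. \<guillemotleft>h : src K y \<leadsto> src K p\<guillemotright> \<and> p \<cdot> h = x \<and> g \<cdot> h = y"
    using assms(1) unfolding pullback_square_def by blast
  then show ?thesis using that by (auto simp: one_cell_def)
qed

lemma pullback_cancel:
  assumes pb: "pullback_square K p p' g f" and "h \<in> Loose K" "k \<in> Loose K" "tgt K h = src K p"
    "tgt K k = src K p" "src K h = src K k" "p \<cdot> h = p \<cdot> k" "g \<cdot> h = g \<cdot> k"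
  shows "h = k"
proof -
  note q = squareD[OF pullback_squareD[OF pb]]
  have "f \<cdot> (p \<cdot> k) = p' \<cdot> (g \<cdot> k)"
    by (rule comp_extend[OF q(9), symmetric]) (use q(1-8) assms(3,5) in simp_all)
  then have "\<guillemotleft>p \<cdot> k : src K k \<leadsto> tgt K p\<guillemotright> \<and> \<guillemotleft>g \<cdot> k : src K k \<leadsto> src K p'\<guillemotright> \<and> f \<cdot> (p \<cdot> k) = p' \<cdot> (g \<cdot> k)"
    using q(1-8) assms(3,5) by (simp add: one_cell_def two_cat_typing)
  then have "\<exists>!h. \<guillemotleft>h : src K k \<leadsto> src K p\<guillemotright> \<and> p \<cdot> h = p \<cdot> k \<and> g \<cdot> h = g \<cdot> k"
    using pb unfolding pullback_square_def by blast
  moreover have "\<guillemotleft>h : src K k \<leadsto> src K p\<guillemotright>" "\<guillemotleft>k : src K k \<leadsto> src K p\<guillemotright>"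
    using assms(2-6) by (simp_all add: one_cell_def)
  ultimately show ?thesis using assms(7,8) by blast
qed

lemma pullback_lift2:
  assumes "pullback_square K p p' g f" "h \<in> Loose K" "k \<in> Loose K" "tgt K h = src K p"
    "tgt K k = src K p" "src K h = src K k" "\<xi> \<in> Two K" "Src K \<xi> = p \<cdot> h" "Tgt K \<xi> = p \<cdot> k"
    "\<eta> \<in> Two K" "Src K \<eta> = g \<cdot> h" "Tgt K \<eta> = g \<cdot> k" "f \<rhd> \<xi> = p' \<rhd> \<eta>"
  shows "\<exists>!\<theta>. \<guillemotleft>\<theta> : h \<Rightarrow> k\<guillemotright> \<and> p \<rhd> \<theta> = \<xi> \<and> g \<rhd> \<theta> = \<eta>"
proof -
  have "\<guillemotleft>h : src K k \<leadsto> src K p\<guillemotright> \<and> \<guillemotleft>k : src K k \<leadsto> src K p\<guillemotright> \<and>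
        \<guillemotleft>\<xi> : p \<cdot> h \<Rightarrow> p \<cdot> k\<guillemotright> \<and> \<guillemotleft>\<eta> : g \<cdot> h \<Rightarrow> g \<cdot> k\<guillemotright> \<and> f \<rhd> \<xi> = p' \<rhd> \<eta>"
    using assms by (simp add: one_cell_def two_cell_def)
  then show ?thesis
    using assms(1) unfolding pullback_square_def by blast
qed

end

section \<open>Strict morphisms over discrete opfibrations\<close>

context enhanced_2_monad
begin

lemma strict_morphismD:
  assumes "strict_morphism K T P"
  shows "lax_morphism K T P" "Str P = Id2 K (Und P \<cdot> Act (Dom P))"
    "Und P \<cdot> Act (Dom P) = Act (Cod P) \<cdot> T1 T (Und P)"
    "\<And>x. \<lbrakk>x \<in> Loose K; tgt K x = T0 T (Car (Dom P))\<rbrakk>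
        \<Longrightarrow> Und P \<cdot> (Act (Dom P) \<cdot> x) = Act (Cod P) \<cdot> (T1 T (Und P) \<cdot> x)"
    "\<And>x. \<lbrakk>x \<in> Two K; tgt K (Src K x) = T0 T (Car (Dom P))\<rbrakk>
        \<Longrightarrow> Und P \<rhd> (Act (Dom P) \<rhd> x) = Act (Cod P) \<rhd> (T1 T (Und P) \<rhd> x)"
    "Und P \<rhd> Unt (Dom P) = Unt (Cod P) \<lhd> Und P"
    "Und P \<rhd> Mul (Dom P) = Mul (Cod P) \<lhd> T1 T (T1 T (Und P))"
proof -
  show P: "lax_morphism K T P" and Str: "Str P = Id2 K (Und P \<cdot> Act (Dom P))"
    using assms by (simp_all add: strict_morphism_def)
  note ty = lax_morphismD[OF P] lax_algebraD cat
  show c: "Und P \<cdot> Act (Dom P) = Act (Cod P) \<cdot> T1 T (Und P)"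
    using lax_morphismD(7)[OF P] unfolding Str by (simp add: ty)
  show "Und P \<cdot> (Act (Dom P) \<cdot> x) = Act (Cod P) \<cdot> (T1 T (Und P) \<cdot> x)"
    if "x \<in> Loose K" "tgt K x = T0 T (Car (Dom P))" for x
    by (rule comp_extend[OF c]) (use that in \<open>simp_all add: ty\<close>)
  show "Und P \<rhd> (Act (Dom P) \<rhd> x) = Act (Cod P) \<rhd> (T1 T (Und P) \<rhd> x)"
    if "x \<in> Two K" "tgt K (Src K x) = T0 T (Car (Dom P))" for x
    by (rule lwhisker_extend[OF c]) (use that in \<open>simp_all add: ty\<close>)
  show "Und P \<rhd> Unt (Dom P) = Unt (Cod P) \<lhd> Und P"
    using lax_morphism_laws(1)[OF P] unfolding Str c by (simp add: ty)
  have t: "T1 T (Und P) \<cdot> T1 T (Act (Dom P)) = T1 T (Act (Cod P)) \<cdot> T1 T (T1 T (Und P))"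
    using arg_cong[OF c, of "T1 T"] by (simp add: ty)
  have "Act (Cod P) \<cdot> (T1 T (Und P) \<cdot> T1 T (Act (Dom P))) = Und P \<cdot> (Act (Dom P) \<cdot> T1 T (Act (Dom P)))"
    by (rule comp_extend[OF c[symmetric]]) (simp_all add: ty)
  then show "Und P \<rhd> Mul (Dom P) = Mul (Cod P) \<lhd> T1 T (T1 T (Und P))"
    using lax_morphism_laws(2)[OF P] unfolding Str c by (simp add: ty t)
qed

lemma strict_comp_Str:
  assumes "strict_morphism K T P" "lax_morphism K T G" "Cod G = Dom P"
  shows "Str (alg_comp K T P G) = Und P \<rhd> Str G"
  using strict_morphismD[OF assms(1)] lax_morphismD[OF assms(2)] lax_morphismD[OF strict_morphismD(1)[OF assms(1)]] assms(3)
  by (simp add: alg_comp_sel lax_algebraD cat)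

lemma comp_strict_Str:
  assumes "strict_morphism K T P" "lax_morphism K T G" "Cod P = Dom G"
  shows "Str (alg_comp K T G P) = Str G \<lhd> T1 T (Und P)"
  using strict_morphismD[OF assms(1)] lax_morphismD[OF assms(2)] lax_morphismD[OF strict_morphismD(1)[OF assms(1)]] assms(3)
  by (simp add: alg_comp_sel lax_algebraD cat)

text \<open>
  Both laws for \<open>(g, gg)\<close> are equations of 2-cells into the source of the discrete opfibration
  \<open>P\<close>, and whiskering by \<open>P\<close> turns them into the laws for \<open>F\<close>.
\<close>

lemma lax_morphism_reflect:
  assumes P: "strict_morphism K T P" "tight_discrete_opfibration K (Und P)"
    and F: "lax_morphism K T F" "Cod F = Cod P" "Dom F = X"
    and g: "g \<in> Loose K" "src K g = Car X" "tgt K g = Car (Dom P)" "Und P \<cdot> g = Und F"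
    and gg: "gg \<in> Two K" "Src K gg = Act (Dom P) \<cdot> T1 T g" "Tgt K gg = g \<cdot> Act X" "Und P \<rhd> gg = Str F"
  shows "lax_morphism K T (Mor X (Dom P) g gg)"
proof (rule lax_morphismI)
  note PL = lax_morphismD[OF strict_morphismD(1)[OF P(1)]]
  note ty = PL lax_morphismD[OF F(1)] F(2,3) g(1-3) gg(1-3) lax_algebraD cat strict_morphismD(3-7)[OF P(1)]
  note cancel = dopf_cancel[OF P(2) PL(3)]
  have c: "Und P \<rhd> (g \<rhd> x) = Und F \<rhd> x" if "x \<in> Two K" "tgt K (Src K x) = Car X" for x
    using that lwhisker_lwhisker[of g "Und P" x] g(4) by (simp add: ty)
  have c1: "T1 T (Und P) \<cdot> T1 T g = T1 T (Und F)"
    using arg_cong[OF g(4), of "T1 T"] by (simp add: ty)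
  have c2: "T1 T (T1 T (Und P)) \<cdot> T1 T (T1 T g) = T1 T (T1 T (Und F))"
    using arg_cong[OF c1, of "T1 T"] by (simp add: ty)
  have c3: "T1 T (Und P) \<rhd> T2 T gg = T2 T (Str F)"
    using arg_cong[OF gg(4), of "T2 T"] by (simp add: ty)
  note cc = c c1 c2 c3 g(4) gg(4)
  have XL: "lax_algebra K T X" using lax_morphismD(1)[OF F(1)] F by simp
  note ty = ty XL
  have L1: "Und F \<rhd> Unt X = (Str F \<lhd> unit T (Car X)) \<bullet> (Unt (Cod P) \<lhd> Und F)"
    and L2: "(Und F \<rhd> Mul X) \<bullet> (Str F \<lhd> T1 T (Act X)) \<bullet> (Act (Cod P) \<rhd> T2 T (Str F)) =
     (Str F \<lhd> mult T (Car X)) \<bullet> (Mul (Cod P) \<lhd> T1 T (T1 T (Und F)))"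
    using lax_morphism_laws[OF F(1)] by (simp_all only: F(2,3))
  show "Und (Mor X (Dom P) g gg) \<rhd> Unt (Dom (Mor X (Dom P) g gg)) =
    (Str (Mor X (Dom P) g gg) \<lhd> unit T (Car (Dom (Mor X (Dom P) g gg)))) \<bullet>
    (Unt (Cod (Mor X (Dom P) g gg)) \<lhd> Und (Mor X (Dom P) g gg))"
    by (rule cancel) (simp_all add: ty cc L1)
  show "(Und (Mor X (Dom P) g gg) \<rhd> Mul (Dom (Mor X (Dom P) g gg))) \<bullet>
    (Str (Mor X (Dom P) g gg) \<lhd> T1 T (Act (Dom (Mor X (Dom P) g gg)))) \<bullet>
    (Act (Cod (Mor X (Dom P) g gg)) \<rhd> T2 T (Str (Mor X (Dom P) g gg))) =
    (Str (Mor X (Dom P) g gg) \<lhd> mult T (Car (Dom (Mor X (Dom P) g gg)))) \<bullet>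
    (Mul (Cod (Mor X (Dom P) g gg)) \<lhd> T1 T (T1 T (Und (Mor X (Dom P) g gg))))"
    by (rule cancel) (simp_all add: ty cc L2)
qed (use g gg F lax_morphismD[OF F(1)] lax_morphismD[OF strict_morphismD(1)[OF P(1)]] in simp_all)

lemma alg_two_morphism_reflect:
  assumes P: "strict_morphism K T P" "tight_discrete_opfibration K (Und P)"
    and G: "lax_morphism K T G" "Cod G = Dom P" and H: "lax_morphism K T H" "Cod H = Dom P" "Dom H = Dom G"
    and \<theta>: "\<theta> \<in> Two K" "Src K \<theta> = Und G" "Tgt K \<theta> = Und H"
    and A: "alg_two_morphism K T (Cell (alg_comp K T P G) (alg_comp K T P H) (Und P \<rhd> \<theta>))"
  shows "alg_two_morphism K T (Cell G H \<theta>)"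
proof -
  note PL = lax_morphismD[OF strict_morphismD(1)[OF P(1)]]
  note ty = PL lax_morphismD[OF G(1)] lax_morphismD[OF H(1)] G(2) H(2,3) \<theta> lax_algebraD cat strict_morphismD(3-7)[OF P(1)]
  have "((Und P \<rhd> \<theta>) \<lhd> Act (Dom G)) \<bullet> (Und P \<rhd> Str G) =
      (Und P \<rhd> Str H) \<bullet> (Act (Cod P) \<rhd> T2 T (Und P \<rhd> \<theta>))"
    using alg_two_morphismD(8)[OF A] by (simp add: strict_comp_Str[OF P(1)] G H alg_comp_sel(1,2))
  then have *: "((Und P \<rhd> \<theta>) \<lhd> Act (Dom G)) \<bullet> (Und P \<rhd> Str G) =
      (Und P \<rhd> Str H) \<bullet> (Act (Cod P) \<rhd> (T1 T (Und P) \<rhd> T2 T \<theta>))"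
    by (simp add: ty)
  have "(\<theta> \<lhd> Act (Dom G)) \<bullet> Str G = Str H \<bullet> (Act (Cod G) \<rhd> T2 T \<theta>)"
    by (rule dopf_cancel[OF P(2) PL(3)]) (simp_all add: ty *)
  then show ?thesis by (simp add: alg_two_morphism_iff ty G H)
qed

text \<open>
  The underlying 2-cell lifts to some \<open>l : G \<Rightarrow> h\<close>.  The structure cell of \<open>h\<close> has to lift that of
  \<open>B\<close>, which determines it; that this lift ends at the correct 1-cell is read off from
  compatibility with \<open>l\<close>, both sides of which lift the same 2-cell.
\<close>

lemma PsAlg_dopf:
  assumes P: "strict_morphism K T P" "tight_discrete_opfibration K (Und P)" and "P \<in> Loose (PsAlg K T)"
  shows "tight_discrete_opfibration (PsAlg K T) P"
  unfolding tight_discrete_opfibration_def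
proof (intro conjI allI impI)
  note PL = lax_morphismD[OF strict_morphismD(1)[OF P(1)]]
  show "P \<in> Tight (PsAlg K T)"
    using assms(3) P(2) PL strict_morphismD(2)[OF P(1)]
    by (simp add: PsAlg_simps tight_discrete_opfibration_def invertible_Id2 lax_algebraD cat)
  fix X G B \<Phi>
  assume "\<guillemotleft>G : X \<leadsto>\<^bsub>PsAlg K T\<^esub> src (PsAlg K T) P\<guillemotright> \<and> \<guillemotleft>B : X \<leadsto>\<^bsub>PsAlg K T\<^esub> tgt (PsAlg K T) P\<guillemotright> \<and>
    \<guillemotleft>\<Phi> : P \<cdot>\<^bsub>PsAlg K T\<^esub> G \<Rightarrow>\<^bsub>PsAlg K T\<^esub> B\<guillemotright>"
  then have G: "lax_morphism K T G" "Cod G = Dom P" and GX: "Dom G = X"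
    and B: "lax_morphism K T B" "Cod B = Cod P" "Dom B = X" and XE: "pseudo_algebra K T X" "pseudo_algebra K T (Dom P)"
     "pseudo_algebra K T (Cod P)"
    and \<Phi>: "alg_two_morphism K T \<Phi>" "From \<Phi> = alg_comp K T P G" "To \<Phi> = B"
    using assms(3) by (simp_all add: PsAlg_one_cell PsAlg_two_cell PsAlg_simps)
  note \<Phi>D = alg_two_morphismD[OF \<Phi>(1), unfolded \<Phi>(2,3) alg_comp_sel(1-3) strict_comp_Str[OF P(1) G]]
  note XL = pseudo_algebraD[OF XE(1)]
  note ty = PL lax_morphismD[OF G(1)] lax_morphismD[OF B(1)] G(2) GX B(2,3) \<Phi>D(5,6,7) XL
    lax_algebraD cat strict_morphismD(3-7)[OF P(1)]
  let ?p = "Und P" and ?\<phi> = "Und2 \<Phi>"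
  obtain l where l: "l \<in> Two K" "Src K l = Und G" "?p \<rhd> l = ?\<phi>" "?p \<cdot> Tgt K l = Und B"
    by (rule dopf_lift[OF P(2), of "Und G" ?\<phi>]) (simp_all add: ty)
  let ?h = "Tgt K l"
  have h: "?h \<in> Loose K" "src K ?h = Car X" "tgt K ?h = Car (Dom P)"
    using l by (simp_all add: ty)
  have Th: "T1 T ?p \<cdot> T1 T ?h = T1 T (Und B)" "T1 T ?p \<rhd> T2 T l = T2 T ?\<phi>"
    using arg_cong[OF l(4), of "T1 T"] arg_cong[OF l(3), of "T2 T"] h l(1,2) by (simp_all add: ty)
  obtain hh where hh: "hh \<in> Two K" "Src K hh = Act (Dom P) \<cdot> T1 T ?h" "?p \<rhd> hh = Str B"
    by (rule dopf_lift[OF P(2), of "Act (Dom P) \<cdot> T1 T ?h" "Str B"]) (simp_all add: ty h Th)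
  have *: "(?\<phi> \<lhd> Act X) \<bullet> (?p \<rhd> Str G) = Str B \<bullet> (Act (Cod P) \<rhd> T2 T ?\<phi>)"
    using \<Phi>D(8) GX by simp
  have eq: "(l \<lhd> Act X) \<bullet> Str G = hh \<bullet> (Act (Dom P) \<rhd> T2 T l)"
    by (rule dopf_cancel[OF P(2) PL(3)]) (simp_all add: ty h l hh Th *)
  have Thh: "Tgt K hh = ?h \<cdot> Act X"
    using arg_cong[OF eq, of "Tgt K"] by (simp add: ty h l hh)
  let ?H = "Mor X (Dom P) ?h hh"
  have H: "lax_morphism K T ?H"
    by (rule lax_morphism_reflect[OF P B h l(4) hh(1,2) Thh hh(3)])
  have PH: "alg_comp K T P ?H = B"
    by (rule alg_morI) (simp_all add: strict_comp_Str[OF P(1) H] alg_comp_sel(1-3) B l(4) hh(3))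
  have L: "alg_two_morphism K T (Cell G ?H l)"
    using eq G H h l(1,2) by (simp add: alg_two_morphism_iff GX)
  show "\<exists>!L. L \<in> Two (PsAlg K T) \<and> Src (PsAlg K T) L = G \<and> P \<rhd>\<^bsub>PsAlg K T\<^esub> L = \<Phi>"
  proof (rule ex1I[of _ "Cell G ?H l"])
    have w: "?p \<rhd> l = Id2 K ?p \<star> l" by (simp add: lwhisker_def)
    show "Cell G ?H l \<in> Two (PsAlg K T) \<and> Src (PsAlg K T) (Cell G ?H l) = G \<and> P \<rhd>\<^bsub>PsAlg K T\<^esub> Cell G ?H l = \<Phi>"
      using L G H XE GX PH l(3) \<Phi>(2,3) by (simp add: PsAlg_simps lwhisker_def[of "PsAlg K T"] alg_cell.expand flip: w)
    fix M assume M: "M \<in> Two (PsAlg K T) \<and> Src (PsAlg K T) M = G \<and> P \<rhd>\<^bsub>PsAlg K T\<^esub> M = \<Phi>"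
    then have MA: "alg_two_morphism K T M" and MF: "From M = G" and PM: "alg_comp K T P (To M) = B"
      and Mp: "?p \<rhd> Und2 M = ?\<phi>" using \<Phi>(2,3)
      by (auto simp: PsAlg_simps lwhisker_def[of "PsAlg K T"] lwhisker_def[of K])
    note MD = alg_two_morphismD[OF MA, unfolded MF]
    have u: "Und2 M = l"
      by (rule dopf_cancel[OF P(2) PL(3)]) (use MD l Mp in \<open>simp_all add: ty\<close>)
    have "Str (To M) = hh"
    proof (rule dopf_cancel[OF P(2) PL(3)])
      show "?p \<rhd> Str (To M) = ?p \<rhd> hh"
        using arg_cong[OF PM, of Str] strict_comp_Str[OF P(1) MD(2)] MD(4) G hh by simp
      show "Src K (Str (To M)) = Src K hh" using MD(7) u lax_morphismD[OF MD(2)] MD(4) G hh by simp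
    qed (use hh MD lax_morphismD[OF MD(2)] in \<open>simp_all add: ty h\<close>)
    then have "To M = ?H"
      by (intro alg_morI) (use MD u in \<open>simp_all add: G GX\<close>)
    then show "M = Cell G ?H l" using u MF by (intro alg_cellI) simp_all
  qed
qed

end

section \<open>Pullbacks of strict morphisms\<close>

context enhanced_2_monad
begin

lemma PsAlg_lwhisker: "P \<rhd>\<^bsub>PsAlg K T\<^esub> L =
    Cell (alg_comp K T P (From L)) (alg_comp K T P (To L)) (Und P \<rhd> Und2 L)"
  by (simp add: lwhisker_def PsAlg_simps)

lemma PsAlg_rwhisker: "L \<lhd>\<^bsub>PsAlg K T\<^esub> P =
    Cell (alg_comp K T (From L) P) (alg_comp K T (To L) P) (Und2 L \<lhd> Und P)"
  by (simp add: rwhisker_def PsAlg_simps)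

lemma PsAlg_square_iff: "square (PsAlg K T) P P' G F \<longleftrightarrow>
    P \<in> Loose (PsAlg K T) \<and> P' \<in> Loose (PsAlg K T) \<and> lax_morphism K T G \<and> lax_morphism K T F \<and>
    Dom G = Dom P \<and> Cod G = Dom P' \<and> Dom F = Cod P \<and> Cod F = Cod P' \<and> alg_comp K T P' G = alg_comp K T F P"
  by (auto simp: square_def PsAlg_one_cell PsAlg_simps)

lemma strict_square_Str:
  assumes P: "strict_morphism K T P" and P': "strict_morphism K T P'"
    and sq: "square (PsAlg K T) P P' G F"
  shows "Und P' \<rhd> Str G = Str F \<lhd> T1 T (Und P)" "Und P' \<cdot> Und G = Und F \<cdot> Und P"
proof -
  have e: "alg_comp K T P' G = alg_comp K T F P"
    and G: "lax_morphism K T G" "Cod G = Dom P'" and F: "lax_morphism K T F" "Cod P = Dom F"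
    using sq by (simp_all add: PsAlg_square_iff)
  show "Und P' \<rhd> Str G = Str F \<lhd> T1 T (Und P)"
    using arg_cong[OF e, of Str] by (simp add: strict_comp_Str[OF P' G] comp_strict_Str[OF P F])
  show "Und P' \<cdot> Und G = Und F \<cdot> Und P"
    using arg_cong[OF e, of Und] by (simp add: alg_comp_sel)
qed

text \<open>
  The induced 1-cell \<open>h\<close> receives as structure cell the lift of that of \<open>x\<close> along \<open>P\<close>.  Its codomain
  is tested against the two projections: against \<open>G\<close> this uses that the composite structure cell and
  that of \<open>y\<close> are lifts along \<open>P'\<close> of the same 2-cell.
\<close>

lemma PsAlg_pullback_lift:
  assumes P: "strict_morphism K T P" "tight_discrete_opfibration K (Und P)"
    and P': "strict_morphism K T P'" "tight_discrete_opfibration K (Und P')"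
    and sq: "square (PsAlg K T) P P' G F"
    and pb: "pullback_square K (Und P) (Und P') (Und G) (Und F)"
    and x: "lax_morphism K T x" "Dom x = X" "Cod x = Cod P"
    and y: "lax_morphism K T y" "Dom y = X" "Cod y = Dom P'"
    and xy: "alg_comp K T F x = alg_comp K T P' y"
  shows "\<exists>H. lax_morphism K T H \<and> Dom H = X \<and> Cod H = Dom P \<and> alg_comp K T P H = x \<and> alg_comp K T G H = y"
proof -
  have G: "lax_morphism K T G" "Dom G = Dom P" "Cod G = Dom P'"
    and F: "lax_morphism K T F" "Dom F = Cod P" "Cod F = Cod P'"
    using sq by (simp_all add: PsAlg_square_iff)
  note S = strict_square_Str[OF P(1) P'(1) sq]
  let ?p = "Und P" and ?p' = "Und P'" and ?g = "Und G" and ?f = "Und F"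
  note PL = lax_morphismD[OF strict_morphismD(1)[OF P(1)]]
  note PL' = lax_morphismD[OF strict_morphismD(1)[OF P'(1)]]
  note ty = PL PL' lax_morphismD[OF G(1)] lax_morphismD[OF F(1)] G(2,3) F(2,3)
    lax_morphismD[OF x(1)] lax_morphismD[OF y(1)] x(2,3) y(2,3)
    lax_algebraD cat strict_morphismD(3-7)[OF P(1)] strict_morphismD(3-7)[OF P'(1)]
  have xy_Und: "?f \<cdot> Und x = ?p' \<cdot> Und y"
    using arg_cong[OF xy, of Und] by (simp add: alg_comp_sel)
  have xy_Str: "(?f \<rhd> Str x) \<bullet> (Str F \<lhd> T1 T (Und x)) = ?p' \<rhd> Str y"
    using arg_cong[OF xy, of Str] strict_comp_Str[OF P'(1) y(1,3)] by (simp add: alg_comp_sel)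
  obtain h where h: "h \<in> Loose K" "src K h = Car X" "tgt K h = Car (Dom P)" "?p \<cdot> h = Und x" "?g \<cdot> h = Und y"
    by (rule pullback_lift[OF pb, of "Und x" "Und y"]) (simp_all add: ty xy_Und)
  have Th: "T1 T ?p \<cdot> T1 T h = T1 T (Und x)" "T1 T ?g \<cdot> T1 T h = T1 T (Und y)"
    using arg_cong[OF h(4), of "T1 T"] arg_cong[OF h(5), of "T1 T"] by (simp_all add: ty h(1-3))
  obtain hh where hh: "hh \<in> Two K" "Src K hh = Act (Dom P) \<cdot> T1 T h" "?p \<rhd> hh = Str x"
    "?p \<cdot> Tgt K hh = Und x \<cdot> Act X"
    by (rule dopf_lift[OF P(2), of "Act (Dom P) \<cdot> T1 T h" "Str x"]) (simp_all add: ty h Th)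
  have ex: "?p' \<rhd> (?g \<rhd> hh) = ?f \<rhd> (?p \<rhd> hh)"
    by (rule lwhisker_extend[OF S(2)]) (simp_all add: ty h hh)
  have Geq: "(?g \<rhd> hh) \<bullet> (Str G \<lhd> T1 T h) = Str y"
    by (rule dopf_cancel[OF P'(2) PL'(3)]) (simp_all add: ty h hh(1,2) Th S(1) xy_Str[symmetric] ex hh(3))
  have tgt: "?g \<cdot> Tgt K hh = Und y \<cdot> Act X"
    using arg_cong[OF Geq, of "Tgt K"] by (simp add: ty h hh)
  have ext: "?p \<cdot> (h \<cdot> Act X) = Und x \<cdot> Act X" "?g \<cdot> (h \<cdot> Act X) = Und y \<cdot> Act X"
    unfolding h(4,5)[symmetric] using h(1-3) lax_morphismD(1)[OF x(1)] x(2) by (simp_all add: ty)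
  have Xalg: "lax_algebra K T X" using lax_morphismD(1)[OF x(1)] x(2) by simp
  have Thh: "Tgt K hh = h \<cdot> Act X"
    by (rule pullback_cancel[OF pb]) (simp_all add: ty h(1-3) hh(1,2) Xalg ext tgt hh(4))
  let ?H = "Mor X (Dom P) h hh"
  have H: "lax_morphism K T ?H"
    by (rule lax_morphism_reflect[OF P x(1,3,2) h(1-4) hh(1,2) Thh hh(3)])
  have "alg_comp K T P ?H = x"
    by (rule alg_morI) (simp_all add: strict_comp_Str[OF P(1) H] alg_comp_sel(1-3) h hh x)
  moreover have "alg_comp K T G ?H = y"
    by (rule alg_morI) (simp_all add: alg_comp_sel h Geq y G)
  ultimately show ?thesis using H by (intro exI[of _ ?H]) simp
qed

text \<open>
  Both the 1-dimensional and the 2-dimensional universal property are those of the underlying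
  pullback; the structure is supplied by \<open>PsAlg_pullback_lift\<close> and \<open>alg_two_morphism_reflect\<close>.
\<close>

lemma PsAlg_pullback:
  assumes P: "strict_morphism K T P" "tight_discrete_opfibration K (Und P)"
    and P': "strict_morphism K T P'" "tight_discrete_opfibration K (Und P')"
    and sq: "square (PsAlg K T) P P' G F"
    and pb: "pullback_square K (Und P) (Und P') (Und G) (Und F)"
  shows "pullback_square (PsAlg K T) P P' G F"
  unfolding pullback_square_def
proof (intro conjI allI impI)
  show "square (PsAlg K T) P P' G F" by fact
  have G: "lax_morphism K T G" "Dom G = Dom P" "Cod G = Dom P'"
    and F: "lax_morphism K T F" "Dom F = Cod P" "Cod F = Cod P'"
    and PL: "P \<in> Loose (PsAlg K T)" "P' \<in> Loose (PsAlg K T)"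
    using sq by (simp_all add: PsAlg_square_iff)
  note PD = lax_morphismD[OF strict_morphismD(1)[OF P(1)]]
  have psP: "pseudo_algebra K T (Dom P)" using PL by (simp add: PsAlg_simps)
  fix X x y
  assume a: "\<guillemotleft>x : X \<leadsto>\<^bsub>PsAlg K T\<^esub> tgt (PsAlg K T) P\<guillemotright> \<and> \<guillemotleft>y : X \<leadsto>\<^bsub>PsAlg K T\<^esub> src (PsAlg K T) P'\<guillemotright> \<and>
    F \<cdot>\<^bsub>PsAlg K T\<^esub> x = P' \<cdot>\<^bsub>PsAlg K T\<^esub> y"
  then have x: "lax_morphism K T x" "Dom x = X" "Cod x = Cod P"
    and y: "lax_morphism K T y" "Dom y = X" "Cod y = Dom P'"
    and xy: "alg_comp K T F x = alg_comp K T P' y" and ps: "pseudo_algebra K T X"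
    by (simp_all add: PsAlg_simps PsAlg_one_cell)
  obtain H where H: "lax_morphism K T H" "Dom H = X" "Cod H = Dom P" "alg_comp K T P H = x" "alg_comp K T G H = y"
    using PsAlg_pullback_lift[OF P P' sq pb x y xy] by blast
  show "\<exists>!h. \<guillemotleft>h : X \<leadsto>\<^bsub>PsAlg K T\<^esub> src (PsAlg K T) P\<guillemotright> \<and> P \<cdot>\<^bsub>PsAlg K T\<^esub> h = x \<and> G \<cdot>\<^bsub>PsAlg K T\<^esub> h = y"
  proof (rule ex1I)
    show "\<guillemotleft>H : X \<leadsto>\<^bsub>PsAlg K T\<^esub> src (PsAlg K T) P\<guillemotright> \<and> P \<cdot>\<^bsub>PsAlg K T\<^esub> H = x \<and> G \<cdot>\<^bsub>PsAlg K T\<^esub> H = y"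
      using H ps psP by (simp add: PsAlg_simps PsAlg_one_cell)
    fix H' assume "\<guillemotleft>H' : X \<leadsto>\<^bsub>PsAlg K T\<^esub> src (PsAlg K T) P\<guillemotright> \<and> P \<cdot>\<^bsub>PsAlg K T\<^esub> H' = x \<and> G \<cdot>\<^bsub>PsAlg K T\<^esub> H' = y"
    then have H': "lax_morphism K T H'" "Dom H' = X" "Cod H' = Dom P" "alg_comp K T P H' = x" "alg_comp K T G H' = y"
      by (simp_all add: PsAlg_simps PsAlg_one_cell)
    note D = lax_morphismD[OF H(1)] lax_morphismD[OF H'(1)]
    have e: "Und P \<cdot> Und H = Und P \<cdot> Und H'" "Und G \<cdot> Und H = Und G \<cdot> Und H'"
      using arg_cong[OF H(4), of Und] arg_cong[OF H(5), of Und] arg_cong[OF H'(4), of Und] arg_cong[OF H'(5), of Und]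
      by (simp_all add: alg_comp_sel)
    have u: "Und H = Und H'"
      by (rule pullback_cancel[OF pb]) (simp_all add: D PD H(2,3) H'(2,3) e)
    have "Und P \<rhd> Str H = Und P \<rhd> Str H'"
      using strict_comp_Str[OF P(1) H(1,3)] strict_comp_Str[OF P(1) H'(1,3)] H(4) H'(4) by simp
    then have "Str H = Str H'"
      by (rule dopf_cancel[OF P(2) PD(3), rotated -1]) (simp_all add: D PD H(2,3) H'(2,3) u lax_algebraD cat)
    with u show "H' = H" using H H' by (intro alg_morI) simp_all
  qed
next
  have G: "lax_morphism K T G" "Dom G = Dom P" "Cod G = Dom P'"
    and F: "lax_morphism K T F" "Dom F = Cod P" "Cod F = Cod P'"
    and PL: "P \<in> Loose (PsAlg K T)" "P' \<in> Loose (PsAlg K T)"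
    using sq by (simp_all add: PsAlg_square_iff)
  note PD = lax_morphismD[OF strict_morphismD(1)[OF P(1)]]
  have psP: "pseudo_algebra K T (Dom P)" using PL by (simp add: PsAlg_simps)
  fix X H H' \<Xi> \<Psi>
  assume a: "\<guillemotleft>H : X \<leadsto>\<^bsub>PsAlg K T\<^esub> src (PsAlg K T) P\<guillemotright> \<and> \<guillemotleft>H' : X \<leadsto>\<^bsub>PsAlg K T\<^esub> src (PsAlg K T) P\<guillemotright> \<and>
    \<guillemotleft>\<Xi> : P \<cdot>\<^bsub>PsAlg K T\<^esub> H \<Rightarrow>\<^bsub>PsAlg K T\<^esub> P \<cdot>\<^bsub>PsAlg K T\<^esub> H'\<guillemotright> \<and>
    \<guillemotleft>\<Psi> : G \<cdot>\<^bsub>PsAlg K T\<^esub> H \<Rightarrow>\<^bsub>PsAlg K T\<^esub> G \<cdot>\<^bsub>PsAlg K T\<^esub> H'\<guillemotright> \<and> F \<rhd>\<^bsub>PsAlg K T\<^esub> \<Xi> = P' \<rhd>\<^bsub>PsAlg K T\<^esub> \<Psi>"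
  then have H: "lax_morphism K T H" "Dom H = X" "Cod H = Dom P" and H': "lax_morphism K T H'" "Dom H' = X" "Cod H' = Dom P"
    and \<Xi>: "alg_two_morphism K T \<Xi>" "From \<Xi> = alg_comp K T P H" "To \<Xi> = alg_comp K T P H'"
    and \<Psi>: "alg_two_morphism K T \<Psi>" "From \<Psi> = alg_comp K T G H" "To \<Psi> = alg_comp K T G H'"
    and e: "Und F \<rhd> Und2 \<Xi> = Und P' \<rhd> Und2 \<Psi>" and ps: "pseudo_algebra K T X"
    by (auto simp: PsAlg_simps PsAlg_one_cell PsAlg_two_cell PsAlg_lwhisker)
  have "\<exists>!\<theta>. \<guillemotleft>\<theta> : Und H \<Rightarrow> Und H'\<guillemotright> \<and> Und P \<rhd> \<theta> = Und2 \<Xi> \<and> Und G \<rhd> \<theta> = Und2 \<Psi>"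
    by (rule pullback_lift2[OF pb])
      (use alg_two_morphismD[OF \<Xi>(1)] alg_two_morphismD[OF \<Psi>(1)] lax_morphismD[OF H(1)] lax_morphismD[OF H'(1)] e
        in \<open>simp_all add: H(2,3) H'(2,3) \<Xi>(2,3) \<Psi>(2,3) alg_comp_sel(1-3) PD\<close>)
  then obtain \<theta> where \<theta>: "\<guillemotleft>\<theta> : Und H \<Rightarrow> Und H'\<guillemotright>" "Und P \<rhd> \<theta> = Und2 \<Xi>" "Und G \<rhd> \<theta> = Und2 \<Psi>"
    and \<theta>u: "\<And>\<theta>'. \<guillemotleft>\<theta>' : Und H \<Rightarrow> Und H'\<guillemotright> \<Longrightarrow> Und P \<rhd> \<theta>' = Und2 \<Xi> \<Longrightarrow> Und G \<rhd> \<theta>' = Und2 \<Psi> \<Longrightarrow> \<theta>' = \<theta>"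
    by blast
  have c: "Cell (alg_comp K T P H) (alg_comp K T P H') (Und P \<rhd> \<theta>) = \<Xi>"
    using \<Xi> \<theta> by (intro alg_cellI) simp_all
  have A: "alg_two_morphism K T (Cell H H' \<theta>)"
    by (rule alg_two_morphism_reflect[OF P]) (use c H H' \<theta>(1) \<Xi>(1) in \<open>simp_all add: two_cell_def\<close>)
  show "\<exists>!\<Theta>. \<guillemotleft>\<Theta> : H \<Rightarrow>\<^bsub>PsAlg K T\<^esub> H'\<guillemotright> \<and> P \<rhd>\<^bsub>PsAlg K T\<^esub> \<Theta> = \<Xi> \<and> G \<rhd>\<^bsub>PsAlg K T\<^esub> \<Theta> = \<Psi>"
  proof (rule ex1I)
    show "\<guillemotleft>Cell H H' \<theta> : H \<Rightarrow>\<^bsub>PsAlg K T\<^esub> H'\<guillemotright> \<and> P \<rhd>\<^bsub>PsAlg K T\<^esub> Cell H H' \<theta> = \<Xi> \<and> G \<rhd>\<^bsub>PsAlg K T\<^esub> Cell H H' \<theta> = \<Psi>"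
      using A H ps psP \<theta> \<Xi> \<Psi> by (simp add: PsAlg_two_cell PsAlg_lwhisker alg_cell.expand)
    fix \<Theta> assume "\<guillemotleft>\<Theta> : H \<Rightarrow>\<^bsub>PsAlg K T\<^esub> H'\<guillemotright> \<and> P \<rhd>\<^bsub>PsAlg K T\<^esub> \<Theta> = \<Xi> \<and> G \<rhd>\<^bsub>PsAlg K T\<^esub> \<Theta> = \<Psi>"
    then have t: "alg_two_morphism K T \<Theta>" "From \<Theta> = H" "To \<Theta> = H'" "Und P \<rhd> Und2 \<Theta> = Und2 \<Xi>" "Und G \<rhd> Und2 \<Theta> = Und2 \<Psi>"
      by (auto simp: PsAlg_two_cell PsAlg_lwhisker)
    then have "Und2 \<Theta> = \<theta>"
      by (intro \<theta>u) (use alg_two_morphismD[OF t(1)] in \<open>simp_all add: two_cell_def\<close>)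
    with t show "\<Theta> = Cell H H' \<theta>" by (intro alg_cellI) simp_all
  qed
qed

text \<open>
  The structure cell of the top side is a lift of that of \<open>F\<close>, hence unique; its codomain together
  with strictness of the projection determines the action, and the unit and multiplication are
  lifts of those of the base.
\<close>

lemma strict_pullback_unique:
  assumes P: "strict_morphism K T P" and q: "tight_discrete_opfibration K q" "q \<in> Loose K"
    and dP: "tight_discrete_opfibration K (Und P)"
    and pb: "pullback_square K q (Und P) g (Und F)"
    and s1: "square (PsAlg K T) Q1 P G1 F" "strict_morphism K T Q1" "Und Q1 = q" "Und G1 = g"
    and s2: "square (PsAlg K T) Q2 P G2 F" "strict_morphism K T Q2" "Und Q2 = q" "Und G2 = g"
  shows "Q1 = Q2 \<and> G1 = G2"
proof -
  note S1 = strict_square_Str[OF s1(2) P s1(1), unfolded s1(3,4)]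
  note S2 = strict_square_Str[OF s2(2) P s2(1), unfolded s2(3,4)]
  note e1 = s1(1)[unfolded PsAlg_square_iff] and e2 = s2(1)[unfolded PsAlg_square_iff]
  have F: "lax_morphism K T F" and G1: "lax_morphism K T G1" and G2: "lax_morphism K T G2" using e1 e2 by auto
  have QL: "lax_morphism K T Q1" "lax_morphism K T Q2" using s1 s2 by (auto simp: strict_morphism_def)
  note ty = lax_morphismD[OF strict_morphismD(1)[OF P]] lax_morphismD[OF F] lax_morphismD[OF G1, unfolded s1(4)]
    lax_morphismD[OF G2, unfolded s2(4)] lax_morphismD[OF QL(1), unfolded s1(3)] lax_morphismD[OF QL(2), unfolded s2(3)]
    e1 e2 s1(3,4) s2(3,4) lax_algebraD cat
  have car: "Car (Dom Q1) = Car (Dom Q2)"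
    using lax_morphismD(4)[OF QL(1)] lax_morphismD(4)[OF QL(2)] s1 s2 by simp
  have cod: "Cod Q1 = Cod Q2" using e1 e2 by simp
  have SG: "Str G1 = Str G2"
  proof (rule dopf_cancel[OF dP])
    show "Und P \<rhd> Str G1 = Und P \<rhd> Str G2" using S1 S2 by simp
  qed (use car in \<open>simp_all add: ty\<close>)
  have act: "Act (Dom Q1) = Act (Dom Q2)"
  proof (rule pullback_cancel[OF pb])
    show "q \<cdot> Act (Dom Q1) = q \<cdot> Act (Dom Q2)"
      using strict_morphismD(3)[OF s1(2)] strict_morphismD(3)[OF s2(2)] s1 s2 cod by simp
    show "g \<cdot> Act (Dom Q1) = g \<cdot> Act (Dom Q2)"
      using arg_cong[OF SG, of "Tgt K"] by (simp add: ty)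
  qed (use q lax_morphismD[OF QL(1)] lax_morphismD[OF QL(2)] s1 s2 car in \<open>simp_all add: lax_algebraD\<close>)
  have "Unt (Dom Q1) = Unt (Dom Q2)"
  proof (rule dopf_cancel[OF q])
    show "q \<rhd> Unt (Dom Q1) = q \<rhd> Unt (Dom Q2)"
      using strict_morphismD(6)[OF s1(2)] strict_morphismD(6)[OF s2(2)] s1 s2 cod by simp
    show "tgt K (Src K (Unt (Dom Q2))) = src K q" using lax_morphismD[OF QL(2)] s2 by (simp add: lax_algebraD cat)
  qed (use lax_morphismD[OF QL(1)] lax_morphismD[OF QL(2)] car in \<open>simp_all add: lax_algebraD\<close>)
  moreover have "Mul (Dom Q1) = Mul (Dom Q2)"
  proof (rule dopf_cancel[OF q])
    show "q \<rhd> Mul (Dom Q1) = q \<rhd> Mul (Dom Q2)"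
      using strict_morphismD(7)[OF s1(2)] strict_morphismD(7)[OF s2(2)] s1 s2 cod by simp
    show "tgt K (Src K (Mul (Dom Q2))) = src K q" using lax_morphismD[OF QL(2)] s2 by (simp add: lax_algebraD cat)
  qed (use lax_morphismD[OF QL(1)] lax_morphismD[OF QL(2)] car act in \<open>simp_all add: lax_algebraD\<close>)
  ultimately have dom: "Dom Q1 = Dom Q2" using car act by (intro alg.expand) simp
  then have "Q1 = Q2"
    using cod s1 s2 act by (intro alg_morI) (simp_all add: strict_morphism_def)
  moreover have "G1 = G2"
    using dom SG e1 e2 s1 s2 by (intro alg_morI) simp_all
  ultimately show ?thesis ..
qed

text \<open>
  The structure cell of the top side is defined by lifting that of \<open>F\<close>; the action on the pullback is
  the 1-cell induced by its codomain and by the action below.  Unit and multiplication are lifted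
  along the projection.  The lax morphism laws for the top side then hold by uniqueness of lifts along
  \<open>P\<close>, and comparing codomains in them shows that the lifted unit and multiplication end where they should.
\<close>

lemma strict_pullback_exists:
  assumes P: "strict_morphism K T P" "tight_discrete_opfibration K (Und P)" "P \<in> Loose (PsAlg K T)"
    and F: "lax_morphism K T F" "Cod F = Cod P" "pseudo_algebra K T (Dom F)"
    and q: "tight_discrete_opfibration K q"
    and ltp: "left_tight_pullback K q (Und P) g (Und F)"
  shows "\<exists>Q G. square (PsAlg K T) Q P G F \<and> strict_morphism K T Q \<and> Und Q = q \<and> Und G = g"
proof -
  have pb: "pullback_square K q (Und P) g (Und F)" and qT: "q \<in> Tight K"
    and det: "\<And>h. h \<in> Loose K \<Longrightarrow> tgt K h = src K q \<Longrightarrow> q \<cdot> h \<in> Tight K \<Longrightarrow> h \<in> Tight K"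
    using ltp by (auto simp: left_tight_pullback_def one_cell_def)
  note qL = Tight_LooseD[OF qT]
  note sq = squareD[OF pullback_squareD[OF pb]]
  let ?p = "Und P" and ?f = "Und F" and ?E = "Dom P" and ?B = "Cod P" and ?A = "Dom F"
  let ?\<alpha> = "Act ?A" and ?\<beta> = "Act ?B" and ?\<epsilon> = "Act ?E"
  note PL = lax_morphismD[OF strict_morphismD(1)[OF P(1)]]
  note FL = lax_morphismD[OF F(1)]
  define D where "D = src K q"
  note sq1 = sq(3-8)[unfolded FL(4,5) PL(4,5) F(2)]
  have qs: "src K q = D" "tgt K q = Car ?A" "src K g = D" "tgt K g = Car ?E" "g \<in> Loose K" "D \<in> Ob K"
    using sq1 sq src_Ob[OF qL] PL FL by (simp_all add: D_def)
  have sqe: "?p \<cdot> g = ?f \<cdot> q" using sq by simp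
  note ty = PL FL F(2) qL qs lax_algebraD cat strict_morphismD(3-7)[OF P(1)]
  have Tsq: "T1 T ?p \<cdot> T1 T g = T1 T ?f \<cdot> T1 T q"
    using arg_cong[OF sqe, of "T1 T"] by (simp add: ty)
  have TTsq: "T1 T (T1 T ?p) \<cdot> T1 T (T1 T g) = T1 T (T1 T ?f) \<cdot> T1 T (T1 T q)"
    using arg_cong[OF Tsq, of "T1 T"] by (simp add: ty)
  \<comment> \<open>the codomain of \<open>gg\<close> will be the composite of \<open>g\<close> with the action \<open>\<delta>\<close> to be found\<close>
  obtain gg where gg: "gg \<in> Two K" "Src K gg = ?\<epsilon> \<cdot> T1 T g" "?p \<rhd> gg = Str F \<lhd> T1 T q"
      "?p \<cdot> Tgt K gg = ?f \<cdot> (?\<alpha> \<cdot> T1 T q)"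
    by (rule dopf_lift[OF P(2), of "?\<epsilon> \<cdot> T1 T g" "Str F \<lhd> T1 T q"]) (simp_all add: ty Tsq)
  have Tgg: "Tgt K gg \<in> Loose K" "src K (Tgt K gg) = T0 T D" "tgt K (Tgt K gg) = Car ?E"
    using gg(1,2) by (simp_all add: ty)
  have \<alpha>q: "?\<alpha> \<cdot> T1 T q \<in> Loose K" "tgt K (?\<alpha> \<cdot> T1 T q) = tgt K q" "src K (?\<alpha> \<cdot> T1 T q) = T0 T D"
    by (simp_all add: ty)
  have side: "tgt K (Tgt K gg) = src K ?p" "src K (?\<alpha> \<cdot> T1 T q) = src K (Tgt K gg)"
    using Tgg \<alpha>q PL(4) by simp_all
  obtain \<delta> where \<delta>0: "\<delta> \<in> Loose K" "src K \<delta> = src K (Tgt K gg)" "tgt K \<delta> = src K q"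
      "q \<cdot> \<delta> = ?\<alpha> \<cdot> T1 T q" "g \<cdot> \<delta> = Tgt K gg"
    by (rule pullback_lift[OF pb \<alpha>q(1) Tgg(1) \<alpha>q(2) side gg(4)[symmetric]])
  have \<delta>: "\<delta> \<in> Loose K" "src K \<delta> = T0 T D" "tgt K \<delta> = D" "q \<cdot> \<delta> = ?\<alpha> \<cdot> T1 T q"
    using \<delta>0 Tgg(2) qs(1) by simp_all
  have Tgg: "Tgt K gg = g \<cdot> \<delta>" using \<delta>0(5) by simp
  have \<delta>T: "\<delta> \<in> Tight K"
    by (rule det) (simp_all add: \<delta> qs comp_Tight T1_Tight lax_algebraD T1_facts qL qT FL PL)
  note ty = ty \<delta>(1-3) gg(1,2) Tgg
  have d1: "q \<cdot> (\<delta> \<cdot> x) = ?\<alpha> \<cdot> (T1 T q \<cdot> x)" if "x \<in> Loose K" "tgt K x = T0 T D" for x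
    by (rule comp_extend[OF \<delta>(4)]) (use that in \<open>simp_all add: ty\<close>)
  have d2: "q \<rhd> (\<delta> \<rhd> x) = ?\<alpha> \<rhd> (T1 T q \<rhd> x)" if "x \<in> Two K" "tgt K (Src K x) = T0 T D" for x
    by (rule lwhisker_extend[OF \<delta>(4)]) (use that in \<open>simp_all add: ty\<close>)
  have d3: "T1 T q \<cdot> T1 T \<delta> = T1 T ?\<alpha> \<cdot> T1 T (T1 T q)"
    using arg_cong[OF \<delta>(4), of "T1 T"] by (simp add: ty)
  have d4: "T1 T q \<cdot> (T1 T \<delta> \<cdot> x) = T1 T ?\<alpha> \<cdot> (T1 T (T1 T q) \<cdot> x)" if "x \<in> Loose K" "tgt K x = T0 T (T0 T D)" for x
    by (rule comp_extend[OF d3]) (use that in \<open>simp_all add: ty\<close>)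
  have d5: "T1 T (T1 T q) \<cdot> T1 T (T1 T \<delta>) = T1 T (T1 T ?\<alpha>) \<cdot> T1 T (T1 T (T1 T q))"
    using arg_cong[OF d3, of "T1 T"] by (simp add: ty)
  note dd = \<delta>(4) d1 d2 d3 d4 d5
  have g1: "?p \<rhd> (g \<rhd> x) = ?f \<rhd> (q \<rhd> x)" if "x \<in> Two K" "tgt K (Src K x) = D" for x
    by (rule lwhisker_extend[OF sqe]) (use that in \<open>simp_all add: ty\<close>)
  have Tg: "T1 T ?p \<rhd> T2 T gg = T2 T (Str F) \<lhd> T1 T (T1 T q)"
    using arg_cong[OF gg(3), of "T2 T"] by (simp add: ty)
  obtain \<upsilon> where u: "\<upsilon> \<in> Two K" "Src K \<upsilon> = Id1 K D" "q \<rhd> \<upsilon> = Unt ?A \<lhd> q" "q \<cdot> Tgt K \<upsilon> = ?\<alpha> \<cdot> (unit T (Car ?A) \<cdot> q)"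
    by (rule dopf_lift[OF q qL, of "Id1 K D" "Unt ?A \<lhd> q"]) (simp_all add: ty)
  obtain \<mu> where m: "\<mu> \<in> Two K" "Src K \<mu> = \<delta> \<cdot> T1 T \<delta>" "q \<rhd> \<mu> = Mul ?A \<lhd> T1 T (T1 T q)"
      "q \<cdot> Tgt K \<mu> = ?\<alpha> \<cdot> (mult T (Car ?A) \<cdot> T1 T (T1 T q))"
    by (rule dopf_lift[OF q qL, of "\<delta> \<cdot> T1 T \<delta>" "Mul ?A \<lhd> T1 T (T1 T q)"]) (simp_all add: ty dd)
  have L: "(?f \<rhd> Unt ?A) = (Str F \<lhd> unit T (Car ?A)) \<bullet> (Unt ?B \<lhd> ?f)"
    "(?f \<rhd> Mul ?A) \<bullet> (Str F \<lhd> T1 T ?\<alpha>) \<bullet> (?\<beta> \<rhd> T2 T (Str F)) = (Str F \<lhd> mult T (Car ?A)) \<bullet> (Mul ?B \<lhd> T1 T (T1 T ?f))"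
    using lax_morphism_laws[OF F(1)] F(2) by simp_all
  have gu: "g \<rhd> \<upsilon> = (gg \<lhd> unit T D) \<bullet> (Unt ?E \<lhd> g)"
    by (rule dopf_cancel[OF P(2)]) (simp_all add: ty u g1 sqe gg L)
  have L2q: "((?f \<rhd> Mul ?A) \<lhd> T1 T (T1 T q)) \<bullet> (Str F \<lhd> (T1 T ?\<alpha> \<cdot> T1 T (T1 T q))) \<bullet> ((?\<beta> \<rhd> T2 T (Str F)) \<lhd> T1 T (T1 T q)) =
      (Str F \<lhd> (T1 T q \<cdot> mult T D)) \<bullet> (Mul ?B \<lhd> (T1 T (T1 T ?f) \<cdot> T1 T (T1 T q)))"
    using arg_cong[OF L(2), of "\<lambda>x. x \<lhd> T1 T (T1 T q)"] by (simp add: ty)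
  have gm: "(g \<rhd> \<mu>) \<bullet> (gg \<lhd> T1 T \<delta>) \<bullet> (?\<epsilon> \<rhd> T2 T gg) = (gg \<lhd> mult T D) \<bullet> (Mul ?E \<lhd> T1 T (T1 T g))"
    by (rule dopf_cancel[OF P(2)]) (simp_all add: ty m g1 sqe dd gg(3) Tg TTsq L2q)
  have ut: "Tgt K \<upsilon> = \<delta> \<cdot> unit T D"
  proof (rule pullback_cancel[OF pb])
    show "g \<cdot> Tgt K \<upsilon> = g \<cdot> (\<delta> \<cdot> unit T D)" using arg_cong[OF gu, of "Tgt K"] by (simp add: ty u)
  qed (simp_all add: ty u dd)
  have mt: "Tgt K \<mu> = \<delta> \<cdot> mult T D"
  proof (rule pullback_cancel[OF pb])
    show "g \<cdot> Tgt K \<mu> = g \<cdot> (\<delta> \<cdot> mult T D)" using arg_cong[OF gm, of "Tgt K"] by (simp add: ty m)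
  qed (simp_all add: ty m dd)
  note ty = ty u(1,2) ut m(1,2) mt
  have Tu: "T1 T q \<rhd> T2 T \<upsilon> = T2 T (Unt ?A) \<lhd> T1 T q" and Tm: "T1 T q \<rhd> T2 T \<mu> = T2 T (Mul ?A) \<lhd> T1 T (T1 T (T1 T q))"
    using arg_cong[OF u(3), of "T2 T"] arg_cong[OF m(3), of "T2 T"] by (simp_all add: ty)
  let ?D = "Alg D \<delta> \<upsilon> \<mu>"
  note AL = lax_algebra_laws[OF FL(1)]
  have A1: "(Mul ?A \<lhd> (unit T (T0 T (Car ?A)) \<cdot> T1 T q)) \<bullet> (Unt ?A \<lhd> (?\<alpha> \<cdot> T1 T q)) = Id2 K (?\<alpha> \<cdot> T1 T q)"
    using arg_cong[OF AL(1), of "\<lambda>x. x \<lhd> T1 T q"] by (simp add: ty)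
  have A2: "(Mul ?A \<lhd> (T1 T (unit T (Car ?A)) \<cdot> T1 T q)) \<bullet> ((?\<alpha> \<rhd> T2 T (Unt ?A)) \<lhd> T1 T q) = Id2 K (?\<alpha> \<cdot> T1 T q)"
    using arg_cong[OF AL(2), of "\<lambda>x. x \<lhd> T1 T q"] by (simp add: ty)
  have A3: "(Mul ?A \<lhd> (mult T (T0 T (Car ?A)) \<cdot> T1 T (T1 T (T1 T q)))) \<bullet> (Mul ?A \<lhd> (T1 T (T1 T ?\<alpha>) \<cdot> T1 T (T1 T (T1 T q)))) =
     (Mul ?A \<lhd> (T1 T (mult T (Car ?A)) \<cdot> T1 T (T1 T (T1 T q)))) \<bullet> ((?\<alpha> \<rhd> T2 T (Mul ?A)) \<lhd> T1 T (T1 T (T1 T q)))"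
    using arg_cong[OF AL(3), of "\<lambda>x. x \<lhd> T1 T (T1 T (T1 T q))"] by (simp add: ty)
  have D: "lax_algebra K T ?D"
  proof (rule lax_algebraI)
    show "(Mul ?D \<lhd> unit T (T0 T (Car ?D))) \<bullet> (Unt ?D \<lhd> Act ?D) = Id2 K (Act ?D)"
      by (rule dopf_cancel[OF q qL]) (use A1 in \<open>simp_all add: ty u(3) m(3) dd\<close>)
    show "(Mul ?D \<lhd> T1 T (unit T (Car ?D))) \<bullet> (Act ?D \<rhd> T2 T (Unt ?D)) = Id2 K (Act ?D)"
      by (rule dopf_cancel[OF q qL]) (use A2 in \<open>simp_all add: ty m(3) dd Tu\<close>)
    show "(Mul ?D \<lhd> mult T (T0 T (Car ?D))) \<bullet> (Mul ?D \<lhd> T1 T (T1 T (Act ?D))) =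
      (Mul ?D \<lhd> T1 T (mult T (Car ?D))) \<bullet> (Act ?D \<rhd> T2 T (Mul ?D))"
      by (rule dopf_cancel[OF q qL]) (use A3 in \<open>simp_all add: ty m(3) dd Tm\<close>)
  qed (simp_all add: ty \<delta>T)
  have ps: "pseudo_algebra K T ?D"
  proof -
    have "invertible_two_cell K (Unt ?A \<lhd> q)" "invertible_two_cell K (Mul ?A \<lhd> T1 T (T1 T q))"
      by (rule invertible_rwhisker; use F(3) in \<open>simp add: ty pseudo_algebra_def\<close>)+
    then have "invertible_two_cell K \<upsilon>" "invertible_two_cell K \<mu>"
      using dopf_invertible[OF q qL, of \<upsilon>] dopf_invertible[OF q qL, of \<mu>] by (simp_all add: ty u(3) m(3))
    with D show ?thesis by (simp add: pseudo_algebra_def)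
  qed
  let ?Q = "Mor ?D ?A q (Id2 K (q \<cdot> \<delta>))" and ?G = "Mor ?D ?E g gg"
  have Q: "strict_morphism K T ?Q"
    unfolding strict_morphism_def
  proof
    show "lax_morphism K T ?Q"
      by (rule lax_morphismI) (use D in \<open>simp_all add: ty u(3) m(3) dd\<close>)
  qed simp
  have G: "lax_morphism K T ?G"
    by (rule lax_morphismI) (use D gu gm in \<open>simp_all add: ty\<close>)
  have "alg_comp K T P ?G = alg_comp K T F ?Q"
    by (rule alg_morI) (use F(2) in \<open>simp_all add: strict_comp_Str[OF P(1) G] comp_strict_Str[OF Q F(1)] alg_comp_sel(1-3) sqe gg(3)\<close>)
  then have "square (PsAlg K T) ?Q P ?G F"
    using Q G P(3) F ps by (auto simp: PsAlg_square_iff PsAlg_simps strict_morphism_def)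
  with Q show ?thesis by (intro exI[of _ ?Q] exI[of _ ?G]) simp
qed

end

section \<open>Pasting of pullbacks and cells between squares\<close>

context two_category
begin

lemma square_paste:
  assumes "square K p p' g f" "square K p' p'' k l"
  shows "square K p p'' (k \<cdot> g) (l \<cdot> f)"
proof -
  note s = squareD[OF assms(1)] squareD[OF assms(2)]
  have "p'' \<cdot> (k \<cdot> g) = l \<cdot> (p' \<cdot> g)"
    by (rule comp_extend[OF s(18)]) (simp_all add: s(1-8,10-17))
  then show ?thesis
    using s by (intro squareI) (simp_all add: two_cat)
qed

lemma square_Id1: "p \<in> Loose K \<Longrightarrow> square K p p (Id1 K (src K p)) (Id1 K (tgt K p))"
  by (intro squareI) (simp_all add: two_cat)

lemma pullback_paste:
  assumes pb1: "pullback_square K p p' g f" and pb2: "pullback_square K p' p'' k l"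
  shows "pullback_square K p p'' (k \<cdot> g) (l \<cdot> f)"
  unfolding pullback_square_def
proof (intro conjI allI impI)
  note sq = square_paste[OF pullback_squareD[OF pb1] pullback_squareD[OF pb2]]
  show "square K p p'' (k \<cdot> g) (l \<cdot> f)" by (rule sq)
  note s1 = squareD[OF pullback_squareD[OF pb1]] and s2 = squareD[OF pullback_squareD[OF pb2]]
  fix X x y assume "\<guillemotleft>x : X \<leadsto> tgt K p\<guillemotright> \<and> \<guillemotleft>y : X \<leadsto> src K p''\<guillemotright> \<and> (l \<cdot> f) \<cdot> x = p'' \<cdot> y"
  then have xy: "x \<in> Loose K" "src K x = X" "tgt K x = tgt K p" "y \<in> Loose K" "src K y = X" "tgt K y = src K p''"
    and e: "l \<cdot> (f \<cdot> x) = p'' \<cdot> y"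
    using s1(1-8) s2(1-8) by (auto simp: one_cell_def two_cat)
  obtain z where z: "z \<in> Loose K" "src K z = src K y" "tgt K z = src K p'" "p' \<cdot> z = f \<cdot> x" "k \<cdot> z = y"
    by (rule pullback_lift[OF pb2 _ xy(4) _ xy(6) _ e]) (use xy s1(1-8) s2(1-8) in \<open>simp_all add: two_cat\<close>)
  obtain h where h: "h \<in> Loose K" "src K h = src K z" "tgt K h = src K p" "p \<cdot> h = x" "g \<cdot> h = z"
    by (rule pullback_lift[OF pb1 xy(1) z(1) xy(3) z(3) _ z(4)[symmetric]]) (use xy z in simp_all)
  have kg: "(k \<cdot> g) \<cdot> m = k \<cdot> (g \<cdot> m)" if "m \<in> Loose K" "tgt K m = src K p" for m
    using that s1(1-8) s2(1-8) by (simp add: two_cat)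
  show "\<exists>!h. \<guillemotleft>h : X \<leadsto> src K p\<guillemotright> \<and> p \<cdot> h = x \<and> (k \<cdot> g) \<cdot> h = y"
  proof (rule ex1I[of _ h])
    show "\<guillemotleft>h : X \<leadsto> src K p\<guillemotright> \<and> p \<cdot> h = x \<and> (k \<cdot> g) \<cdot> h = y"
      using h z xy kg by (simp add: one_cell_def)
    fix m assume "\<guillemotleft>m : X \<leadsto> src K p\<guillemotright> \<and> p \<cdot> m = x \<and> (k \<cdot> g) \<cdot> m = y"
    then have m: "m \<in> Loose K" "src K m = X" "tgt K m = src K p" "p \<cdot> m = x" "k \<cdot> (g \<cdot> m) = y"
      using kg by (auto simp: one_cell_def)
    have "p' \<cdot> (g \<cdot> m) = f \<cdot> (p \<cdot> m)"
      by (rule comp_extend[OF s1(9)]) (use s1(1-8) m(1-3) in simp_all)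
    then have pgm: "p' \<cdot> (g \<cdot> m) = p' \<cdot> z" using z m by simp
    have gm: "g \<cdot> m = z"
      by (rule pullback_cancel[OF pb2]) (use z(1-3,5) m xy s1(1-8) pgm in \<open>simp_all add: two_cat\<close>)
    show "m = h"
      by (rule pullback_cancel[OF pb1]) (use m h xy z(2) gm in simp_all)
  qed
next
  note s1 = squareD[OF pullback_squareD[OF pb1]] and s2 = squareD[OF pullback_squareD[OF pb2]]
  fix X h m \<xi> \<eta> assume a: "\<guillemotleft>h : X \<leadsto> src K p\<guillemotright> \<and> \<guillemotleft>m : X \<leadsto> src K p\<guillemotright> \<and> \<guillemotleft>\<xi> : p \<cdot> h \<Rightarrow> p \<cdot> m\<guillemotright> \<and>
    \<guillemotleft>\<eta> : (k \<cdot> g) \<cdot> h \<Rightarrow> (k \<cdot> g) \<cdot> m\<guillemotright> \<and> (l \<cdot> f) \<rhd> \<xi> = p'' \<rhd> \<eta>"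
  have hm: "h \<in> Loose K" "src K h = X" "tgt K h = src K p" "m \<in> Loose K" "src K m = X" "tgt K m = src K p"
    using a by (auto simp: one_cell_def)
  have kg: "(k \<cdot> g) \<cdot> h = k \<cdot> (g \<cdot> h)" "(k \<cdot> g) \<cdot> m = k \<cdot> (g \<cdot> m)"
    using hm s1(1-8) s2(1-8) by (simp_all add: two_cat)
  have \<xi>: "\<xi> \<in> Two K" "Src K \<xi> = p \<cdot> h" "Tgt K \<xi> = p \<cdot> m"
    and \<eta>: "\<eta> \<in> Two K" "Src K \<eta> = k \<cdot> (g \<cdot> h)" "Tgt K \<eta> = k \<cdot> (g \<cdot> m)"
    and e: "(l \<cdot> f) \<rhd> \<xi> = p'' \<rhd> \<eta>"
    using a kg by (auto simp: two_cell_def)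
  have e: "l \<rhd> (f \<rhd> \<xi>) = p'' \<rhd> \<eta>"
    using e \<xi>(1,2) hm s1(1-8) s2(1-8) by (simp add: two_cat)
  have c: "p' \<cdot> (g \<cdot> h) = f \<cdot> (p \<cdot> h)" "p' \<cdot> (g \<cdot> m) = f \<cdot> (p \<cdot> m)"
    by (rule comp_extend[OF s1(9)]; use s1(1-8) hm in simp)+
  have ty: "g \<cdot> h \<in> Loose K" "g \<cdot> m \<in> Loose K" "tgt K (g \<cdot> h) = src K p'" "tgt K (g \<cdot> m) = src K p'"
    "src K (g \<cdot> h) = src K (g \<cdot> m)"
    "f \<rhd> \<xi> \<in> Two K" "Src K (f \<rhd> \<xi>) = p' \<cdot> (g \<cdot> h)" "Tgt K (f \<rhd> \<xi>) = p' \<cdot> (g \<cdot> m)"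
    using s1(1-8) hm \<xi> c by (simp_all add: two_cat)
  have "\<exists>!\<zeta>. \<guillemotleft>\<zeta> : g \<cdot> h \<Rightarrow> g \<cdot> m\<guillemotright> \<and> p' \<rhd> \<zeta> = f \<rhd> \<xi> \<and> k \<rhd> \<zeta> = \<eta>"
    by (rule pullback_lift2[OF pb2 ty \<eta> e])
  then obtain \<zeta> where \<zeta>': "\<guillemotleft>\<zeta> : g \<cdot> h \<Rightarrow> g \<cdot> m\<guillemotright>" "p' \<rhd> \<zeta> = f \<rhd> \<xi>" "k \<rhd> \<zeta> = \<eta>"
    and \<zeta>u: "\<And>\<zeta>'. \<guillemotleft>\<zeta>' : g \<cdot> h \<Rightarrow> g \<cdot> m\<guillemotright> \<Longrightarrow> p' \<rhd> \<zeta>' = f \<rhd> \<xi> \<Longrightarrow> k \<rhd> \<zeta>' = \<eta> \<Longrightarrow> \<zeta>' = \<zeta>"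
    by blast
  note \<zeta> = twoD[OF \<zeta>'(1)] \<zeta>'(2,3)
  have hms: "src K h = src K m" using hm by simp
  have "\<exists>!\<theta>. \<guillemotleft>\<theta> : h \<Rightarrow> m\<guillemotright> \<and> p \<rhd> \<theta> = \<xi> \<and> g \<rhd> \<theta> = \<zeta>"
    by (rule pullback_lift2[OF pb1 hm(1,4,3,6) hms \<xi> \<zeta>(1-3) \<zeta>(4)[symmetric]])
  then obtain \<theta> where \<theta>: "\<guillemotleft>\<theta> : h \<Rightarrow> m\<guillemotright>" "p \<rhd> \<theta> = \<xi>" "g \<rhd> \<theta> = \<zeta>"
    and \<theta>u: "\<And>\<theta>'. \<guillemotleft>\<theta>' : h \<Rightarrow> m\<guillemotright> \<Longrightarrow> p \<rhd> \<theta>' = \<xi> \<Longrightarrow> g \<rhd> \<theta>' = \<zeta> \<Longrightarrow> \<theta>' = \<theta>"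
    by blast
  have w: "(k \<cdot> g) \<rhd> \<psi> = k \<rhd> (g \<rhd> \<psi>)" "p' \<rhd> (g \<rhd> \<psi>) = f \<rhd> (p \<rhd> \<psi>)"
     "\<guillemotleft>g \<rhd> \<psi> : g \<cdot> h \<Rightarrow> g \<cdot> m\<guillemotright>" if "\<guillemotleft>\<psi> : h \<Rightarrow> m\<guillemotright>" for \<psi>
    using that s1(1-8) s2(1-8) hm
    by (simp_all add: two_cell_def two_cat lwhisker_extend[OF s1(9)])
  show "\<exists>!\<theta>. \<guillemotleft>\<theta> : h \<Rightarrow> m\<guillemotright> \<and> p \<rhd> \<theta> = \<xi> \<and> (k \<cdot> g) \<rhd> \<theta> = \<eta>"
  proof (rule ex1I[of _ \<theta>])
    show "\<guillemotleft>\<theta> : h \<Rightarrow> m\<guillemotright> \<and> p \<rhd> \<theta> = \<xi> \<and> (k \<cdot> g) \<rhd> \<theta> = \<eta>" using \<theta> w(1)[OF \<theta>(1)] \<zeta> by simp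
    fix \<psi> assume p: "\<guillemotleft>\<psi> : h \<Rightarrow> m\<guillemotright> \<and> p \<rhd> \<psi> = \<xi> \<and> (k \<cdot> g) \<rhd> \<psi> = \<eta>"
    then have "g \<rhd> \<psi> = \<zeta>" using w by (intro \<zeta>u) auto
    with p show "\<psi> = \<theta>" using \<theta>u by blast
  qed
qed

text \<open>
  Together with pasting, this transports pullback squares along isomorphisms of their corner.
\<close>

lemma iso_pullback:
  assumes "h \<in> Loose K" "k \<in> Loose K" "src K h = tgt K k" "src K k = tgt K h"
    "k \<cdot> h = Id1 K (src K h)" "h \<cdot> k = Id1 K (tgt K h)" "q \<in> Loose K" "tgt K h = src K q"
  shows "pullback_square K (q \<cdot> h) q h (Id1 K (tgt K q))"
  unfolding pullback_square_def
proof (intro conjI allI impI)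
  show "square K (q \<cdot> h) q h (Id1 K (tgt K q))"
    using assms by (intro squareI) (simp_all add: two_cat)
  note ty = assms(1-4,7,8)
  have i: "h \<cdot> (k \<cdot> y) = y" if "y \<in> Loose K" "tgt K y = src K q" for y
    using that ty assms(6) comp_right[of y k h] by (simp add: two_cat)
  have j: "k \<cdot> (h \<cdot> y) = y" if "y \<in> Loose K" "tgt K y = src K h" for y
    using that ty assms(5) comp_right[of y h k] by (simp add: two_cat)
  fix X x y assume "\<guillemotleft>x : X \<leadsto> tgt K (q \<cdot> h)\<guillemotright> \<and> \<guillemotleft>y : X \<leadsto> src K q\<guillemotright> \<and> Id1 K (tgt K q) \<cdot> x = q \<cdot> y"
  then have xy: "x \<in> Loose K" "tgt K x = tgt K (q \<cdot> h)" "y \<in> Loose K" "src K y = X" "tgt K y = src K q"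
    and xy': "Id1 K (tgt K q) \<cdot> x = q \<cdot> y"
    by (simp_all add: one_cell_def)
  have x: "x = q \<cdot> y"
    using xy' Id1_comp(1)[OF xy(1), of "tgt K q"] xy(2) ty by (simp add: two_cat_typing)
  show "\<exists>!m. \<guillemotleft>m : X \<leadsto> src K (q \<cdot> h)\<guillemotright> \<and> (q \<cdot> h) \<cdot> m = x \<and> h \<cdot> m = y"
  proof (rule ex1I[of _ "k \<cdot> y"])
    show "\<guillemotleft>k \<cdot> y : X \<leadsto> src K (q \<cdot> h)\<guillemotright> \<and> (q \<cdot> h) \<cdot> (k \<cdot> y) = x \<and> h \<cdot> (k \<cdot> y) = y"
      using xy(3-5) by (simp add: one_cell_def two_cat ty i x)
    fix m assume m: "\<guillemotleft>m : X \<leadsto> src K (q \<cdot> h)\<guillemotright> \<and> (q \<cdot> h) \<cdot> m = x \<and> h \<cdot> m = y"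
    then have "m \<in> Loose K" "tgt K m = src K h" using ty by (simp_all add: one_cell_def two_cat_typing)
    then show "m = k \<cdot> y" using j[of m] m by simp
  qed
next
  note ty = assms(1-4,7,8)
  have i: "h \<rhd> (k \<rhd> y) = y" if "y \<in> Two K" "tgt K (Src K y) = src K q" for y
    using that ty assms(6) lwhisker_lwhisker[of k h y] by (simp add: two_cat)
  have j: "k \<rhd> (h \<rhd> y) = y" if "y \<in> Two K" "tgt K (Src K y) = src K h" for y
    using that ty assms(5) lwhisker_lwhisker[of h k y] by (simp add: two_cat)
  have j1: "k \<cdot> (h \<cdot> y) = y" if "y \<in> Loose K" "tgt K y = src K h" for y
    using that ty assms(5) comp_right[of y h k] by (simp add: two_cat)
  fix X m n \<xi> \<eta> assume a: "\<guillemotleft>m : X \<leadsto> src K (q \<cdot> h)\<guillemotright> \<and> \<guillemotleft>n : X \<leadsto> src K (q \<cdot> h)\<guillemotright> \<and>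
       \<guillemotleft>\<xi> : (q \<cdot> h) \<cdot> m \<Rightarrow> (q \<cdot> h) \<cdot> n\<guillemotright> \<and> \<guillemotleft>\<eta> : h \<cdot> m \<Rightarrow> h \<cdot> n\<guillemotright> \<and> Id1 K (tgt K q) \<rhd> \<xi> = q \<rhd> \<eta>"
  have mn: "m \<in> Loose K" "tgt K m = src K h" "n \<in> Loose K" "tgt K n = src K h"
    "\<xi> \<in> Two K" "Src K \<xi> = q \<cdot> (h \<cdot> m)" "\<eta> \<in> Two K" "Src K \<eta> = h \<cdot> m" "Tgt K \<eta> = h \<cdot> n"
    using a by (auto simp: one_cell_def two_cell_def two_cat ty)
  then have \<xi>: "\<xi> = q \<rhd> \<eta>" using a by (simp add: two_cat ty)
  show "\<exists>!\<theta>. \<guillemotleft>\<theta> : m \<Rightarrow> n\<guillemotright> \<and> (q \<cdot> h) \<rhd> \<theta> = \<xi> \<and> h \<rhd> \<theta> = \<eta>"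
  proof (rule ex1I[of _ "k \<rhd> \<eta>"])
    show "\<guillemotleft>k \<rhd> \<eta> : m \<Rightarrow> n\<guillemotright> \<and> (q \<cdot> h) \<rhd> (k \<rhd> \<eta>) = \<xi> \<and> h \<rhd> (k \<rhd> \<eta>) = \<eta>"
      using mn by (simp add: two_cell_def two_cat ty i j1 \<xi>)
    fix \<theta> assume t: "\<guillemotleft>\<theta> : m \<Rightarrow> n\<guillemotright> \<and> (q \<cdot> h) \<rhd> \<theta> = \<xi> \<and> h \<rhd> \<theta> = \<eta>"
    then have "\<theta> \<in> Two K" "tgt K (Src K \<theta>) = src K h" using mn by (auto simp: two_cell_def)
    then show "\<theta> = k \<rhd> \<eta>" using j[of \<theta>] t by simp
  qed
qed

lemma pullback_iso:
  assumes pb: "pullback_square K p p' g f" and pb': "pullback_square K q p' g' f"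
  obtains h k where "h \<in> Loose K" "k \<in> Loose K" "src K h = src K p" "tgt K h = src K q"
    "src K k = src K q" "tgt K k = src K p" "q \<cdot> h = p" "g' \<cdot> h = g" "p \<cdot> k = q" "g \<cdot> k = g'"
    "k \<cdot> h = Id1 K (src K p)" "h \<cdot> k = Id1 K (src K q)"
proof -
  note s = squareD[OF pullback_squareD[OF pb]] and s' = squareD[OF pullback_squareD[OF pb']]
  have t: "tgt K p = tgt K q" using s(7) s'(7) by simp
  obtain h where h: "h \<in> Loose K" "src K h = src K g" "tgt K h = src K q" "q \<cdot> h = p" "g' \<cdot> h = g"
    by (rule pullback_lift[OF pb' s(1) s(3) t s(6) s(5)[symmetric] s(9)[symmetric]])
  obtain k where k: "k \<in> Loose K" "src K k = src K g'" "tgt K k = src K p" "p \<cdot> k = q" "g \<cdot> k = g'"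
    by (rule pullback_lift[OF pb s'(1) s'(3) t[symmetric] s'(6) s'(5)[symmetric] s'(9)[symmetric]])
  note hk = h(1-3)[unfolded s(5)] k(1-3)[unfolded s'(5)]
  have r: "p \<cdot> (k \<cdot> h) = p" "g \<cdot> (k \<cdot> h) = g" "q \<cdot> (h \<cdot> k) = q" "g' \<cdot> (h \<cdot> k) = g'"
    using comp_right[of h k p] comp_right[of h k g] comp_right[of k h q] comp_right[of k h g'] hk h(4,5) k(4,5)
      s(1-6) s'(1-6) by simp_all
  have "k \<cdot> h = Id1 K (src K p)"
    by (rule pullback_cancel[OF pb]) (use hk r s(1-6) in \<open>simp_all add: two_cat\<close>)
  moreover have "h \<cdot> k = Id1 K (src K q)"
    by (rule pullback_cancel[OF pb']) (use hk r s'(1-6) in \<open>simp_all add: two_cat\<close>)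
  ultimately show ?thesis using that[OF hk(1,4,2,3,5,6) h(4,5) k(4,5)] by simp
qed

lemma square_cellD:
  assumes "square_cell K p p' (g,f) (g',f') (\<alpha>,\<beta>)"
  shows "\<alpha> \<in> Two K" "Src K \<alpha> = g" "Tgt K \<alpha> = g'" "\<beta> \<in> Two K" "Src K \<beta> = f" "Tgt K \<beta> = f'"
    "p' \<rhd> \<alpha> = \<beta> \<lhd> p"
  using assms by (auto simp: square_cell_def two_cell_def)

lemma square_cellI:
  assumes "\<alpha> \<in> Two K" "Src K \<alpha> = g" "Tgt K \<alpha> = g'" "\<beta> \<in> Two K" "Src K \<beta> = f" "Tgt K \<beta> = f'"
    "p' \<rhd> \<alpha> = \<beta> \<lhd> p"
  shows "square_cell K p p' (g,f) (g',f') (\<alpha>,\<beta>)"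
  using assms by (auto simp: square_cell_def two_cell_def)

lemma square_cell_target:
  assumes "square K p p' g f" "square_cell K p p' (g,f) (g',f') (\<alpha>,\<beta>)"
  shows "square K p p' g' f'"
proof -
  note s = squareD(1-8)[OF assms(1)] square_cellD[OF assms(2)]
  have "tgt K g' = src K p'" "src K f' = tgt K p" "src K g' = src K p" "tgt K f' = tgt K p'" "g' \<in> Loose K" "f' \<in> Loose K"
    using parallel[OF s(9)] parallel[OF s(12)] Tgt_Loose[OF s(9)] Tgt_Loose[OF s(12)] s by simp_all
  moreover have "p' \<cdot> g' = f' \<cdot> p"
    using arg_cong[OF s(15), of "Tgt K"] by (simp add: s(1-14) two_cat_typing)
  ultimately show ?thesis using s by (intro squareI) simp_all
qed

lemma square_cell_Id2:
  "square K p p' g f \<Longrightarrow> square_cell K p p' (g,f) (g,f) (Id2 K g, Id2 K f)"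
  using squareD[of p p' g f] by (intro square_cellI) (simp_all add: two_cat)

lemma square_cell_vcomp:
  assumes "square K p p' g f" "square_cell K p p' (g,f) (g',f') (\<alpha>,\<beta>)"
    "square_cell K p p' (g',f') (g'',f'') (\<alpha>',\<beta>')"
  shows "square_cell K p p' (g,f) (g'',f'') (\<alpha>' \<bullet> \<alpha>, \<beta>' \<bullet> \<beta>)"
proof -
  note s = squareD(1-8)[OF assms(1)] square_cellD[OF assms(2)] square_cellD[OF assms(3)]
  show ?thesis by (intro square_cellI) (simp_all add: s two_cat)
qed

lemma square_cell_lwhisker:
  assumes "square K p p' g f" "square K p' p'' k l" "square_cell K p p' (g,f) (g',f') (\<alpha>,\<beta>)"
  shows "square_cell K p p'' (k \<cdot> g, l \<cdot> f) (k \<cdot> g', l \<cdot> f') (k \<rhd> \<alpha>, l \<rhd> \<beta>)"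
proof -
  note s = squareD(1-8)[OF assms(1)] squareD(1-8)[OF assms(2)] square_cellD[OF assms(3)]
  have "p'' \<rhd> (k \<rhd> \<alpha>) = l \<rhd> (p' \<rhd> \<alpha>)"
    by (rule lwhisker_extend[OF squareD(9)[OF assms(2)]]) (simp_all add: s)
  then show ?thesis by (intro square_cellI) (simp_all add: s two_cat)
qed

lemma square_cell_rwhisker:
  assumes "square K p p' g f" "square K p0 p k l" "square_cell K p p' (g,f) (g',f') (\<alpha>,\<beta>)"
  shows "square_cell K p0 p' (g \<cdot> k, f \<cdot> l) (g' \<cdot> k, f' \<cdot> l) (\<alpha> \<lhd> k, \<beta> \<lhd> l)"
proof -
  note s = squareD(1-8)[OF assms(1)] squareD[OF assms(2)] square_cellD[OF assms(3)]
  show ?thesis by (intro square_cellI) (simp_all add: s two_cat)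
qed

text \<open>
  Compatibility of the inverses reduces, by cancelling the invertible 2-cell \<open>p' \<rhd> \<alpha>\<close>, to an equation
  between identities.
\<close>

lemma square_cell_inverse:
  assumes "square K p p' g f" "square_cell K p p' (g,f) (g',f') (\<alpha>,\<beta>)"
    "invertible_two_cell K \<alpha>" "invertible_two_cell K \<beta>"
  obtains \<alpha>' \<beta>' where "square_cell K p p' (g',f') (g,f) (\<alpha>',\<beta>')"
    "\<alpha>' \<bullet> \<alpha> = Id2 K g" "\<alpha> \<bullet> \<alpha>' = Id2 K g'" "\<beta>' \<bullet> \<beta> = Id2 K f" "\<beta> \<bullet> \<beta>' = Id2 K f'"
    "invertible_two_cell K \<alpha>'" "invertible_two_cell K \<beta>'"
proof -
  note s = squareD(1-8)[OF assms(1)] square_cellD[OF assms(2)]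
  obtain \<alpha>' where a: "\<alpha>' \<in> Two K" "Src K \<alpha>' = g'" "Tgt K \<alpha>' = g" "\<alpha>' \<bullet> \<alpha> = Id2 K g"
     "\<alpha> \<bullet> \<alpha>' = Id2 K g'" "invertible_two_cell K \<alpha>'"
    using assms(3) by (rule invertibleE) (simp add: s)
  obtain \<beta>' where b: "\<beta>' \<in> Two K" "Src K \<beta>' = f'" "Tgt K \<beta>' = f" "\<beta>' \<bullet> \<beta> = Id2 K f"
     "\<beta> \<bullet> \<beta>' = Id2 K f'" "invertible_two_cell K \<beta>'"
    using assms(4) by (rule invertibleE) (simp add: s)
  note s' = squareD[OF square_cell_target[OF assms(1,2)]]
  have "p' \<rhd> \<alpha>' = \<beta>' \<lhd> p"
  proof (rule invertible_cancel_right)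
    show "invertible_two_cell K (p' \<rhd> \<alpha>)" by (rule invertible_lwhisker) (use assms(3) s in simp_all)
    have "(p' \<rhd> \<alpha>') \<bullet> (p' \<rhd> \<alpha>) = p' \<rhd> Id2 K g"
      unfolding a(4)[symmetric] by (simp add: s s' a(1-3) two_cat)
    also have "\<dots> = Id2 K f \<lhd> p"
      using squareD(9)[OF assms(1)] by (simp add: s two_cat)
    also have "\<dots> = (\<beta>' \<lhd> p) \<bullet> (p' \<rhd> \<alpha>)"
      unfolding b(4)[symmetric] by (simp add: s s' b(1-3) two_cat)
    finally show "(p' \<rhd> \<alpha>') \<bullet> (p' \<rhd> \<alpha>) = (\<beta>' \<lhd> p) \<bullet> (p' \<rhd> \<alpha>)" .
    show "Src K (\<beta>' \<lhd> p) = Tgt K (p' \<rhd> \<alpha>)"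
      unfolding s(15) by (simp add: s s' a(1-3) b(1-3) two_cat_typing)
  qed (simp_all add: s s' a(1-3) b(1-3) two_cat)
  with a b that show ?thesis by (auto intro: square_cellI)
qed

end

section \<open>The smallness structure on pseudo-algebras\<close>

context smallness_structure
begin

lemma smallD:
  assumes "p \<in> Small S"
  shows "tight_discrete_opfibration K p" "p \<in> Tight K" "p \<in> Loose K"
  using small_opfibration[OF assms] Tight_Loose by (auto simp: tight_discrete_opfibration_def)

text \<open>
  A small 1-cell is its own chosen pullback along the identity, and such pullbacks detect tightness.
\<close>

lemma small_detects_tight:
  assumes p: "p \<in> Small S" and h: "h \<in> Loose K" "tgt K h = src K p" "p \<cdot> h \<in> Tight K"
  shows "h \<in> Tight K"
proof -
  note pL = smallD(3)[OF p]
  have "\<guillemotleft>Id1 K (tgt K p) : tgt K p \<leadsto> tgt K p\<guillemotright>" using pL by (intro Id1_cell tgt_Ob)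
  then have "left_tight_pullback K p p (PbT S p (Id1 K (tgt K p))) (Id1 K (tgt K p))"
    using chosen_pullback[OF p] PbL_Id1[OF p] by metis
  then show ?thesis using h by (auto simp: left_tight_pullback_def one_cell_def)
qed

end

locale monad_on_smallness = enhanced_2_monad K T + smallness_structure K S
  for K :: "('o, 'a, 'c) enh2cat" (structure) and T :: "('o, 'a, 'c) e2monad" and S :: "'a smallness"
begin

lemma small_strictD:
  assumes "P \<in> small_strict K T S"
  shows "strict_morphism K T P" "Und P \<in> Small S" "tight_discrete_opfibration K (Und P)"
    "P \<in> Loose (PsAlg K T)" "lax_morphism K T P"
  using assms smallD by (auto simp: small_strict_def strict_morphism_def)

text \<open>
  Specifies the algebra structure on a chosen pullback of underlying 1-cells only by what determines
  it uniquely.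
\<close>

definition is_alg_pullback where
  "is_alg_pullback P F Q G \<longleftrightarrow> square (PsAlg K T) Q P G F \<and> strict_morphism K T Q \<and>
     Und Q = PbL S (Und P) (Und F) \<and> Und G = PbT S (Und P) (Und F)"

lemma is_alg_pullbackD:
  assumes P: "P \<in> small_strict K T S" and F: "F \<in> Loose (PsAlg K T)" "Cod F = Cod P"
    and pbF: "is_alg_pullback P F Q G"
  shows "Q \<in> small_strict K T S" "square (PsAlg K T) Q P G F"
    "left_tight_pullback (PsAlg K T) Q P G F"
proof -
  have PF: "lax_morphism K T P" "lax_morphism K T F" using P F by (auto simp: small_strictD PsAlg_simps)
  have f: "\<guillemotleft>Und F : Car (Dom F) \<leadsto> tgt K (Und P)\<guillemotright>"
    using lax_morphismD[OF PF(1)] lax_morphismD[OF PF(2)] F(2) by (simp add: one_cell_def)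
  note p = small_strictD[OF P]
  show sq: "square (PsAlg K T) Q P G F" using pbF by (simp add: is_alg_pullback_def)
  show Q: "Q \<in> small_strict K T S"
    using pbF chosen_pullback_small[OF p(2) f] by (simp add: is_alg_pullback_def small_strict_def PsAlg_square_iff)
  note q = small_strictD[OF Q]
  have ltp: "left_tight_pullback K (Und Q) (Und P) (Und G) (Und F)"
    using chosen_pullback[OF p(2) f] pbF by (simp add: is_alg_pullback_def)
  have pb: "pullback_square (PsAlg K T) Q P G F"
    using PsAlg_pullback[OF q(1,3) p(1,3) sq] ltp by (simp add: left_tight_pullback_def)
  have tight: "Q \<in> Tight (PsAlg K T)" "P \<in> Tight (PsAlg K T)"
    using PsAlg_dopf[OF q(1,3,4)] PsAlg_dopf[OF p(1,3,4)] by (simp_all add: tight_discrete_opfibration_def)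
  have "H \<in> Tight (PsAlg K T)"
    if H: "\<guillemotleft>H : X \<leadsto>\<^bsub>PsAlg K T\<^esub> src (PsAlg K T) Q\<guillemotright>" and QH: "Q \<cdot>\<^bsub>PsAlg K T\<^esub> H \<in> Tight (PsAlg K T)" for X H
  proof -
    have HL: "lax_morphism K T H" "Cod H = Dom Q" "H \<in> Loose (PsAlg K T)"
      using H by (auto simp: PsAlg_one_cell PsAlg_simps)
    note D = lax_morphismD[OF HL(1)] lax_morphismD[OF q(5)] HL(2)
    have t: "Und Q \<cdot> Und H \<in> Tight K" and i: "invertible_two_cell K (Und Q \<rhd> Str H)"
      using QH strict_comp_Str[OF q(1) HL(1,2)] by (simp_all add: PsAlg_simps alg_comp_sel(3))
    have "Und H \<in> Tight K" by (rule small_detects_tight[OF q(2) _ _ t]) (simp_all add: D)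
    moreover have "invertible_two_cell K (Str H)"
      by (rule dopf_invertible[OF q(3) _ _ _ i]) (simp_all add: D lax_algebraD cat)
    ultimately show ?thesis using HL by (simp add: PsAlg_simps)
  qed
  with pb tight show "left_tight_pullback (PsAlg K T) Q P G F"
    by (auto simp: left_tight_pullback_def)
qed

lemma is_alg_pullback_unique:
  assumes P: "P \<in> small_strict K T S" and F: "F \<in> Loose (PsAlg K T)" "Cod F = Cod P"
    and "is_alg_pullback P F Q1 G1" "is_alg_pullback P F Q2 G2"
  shows "Q1 = Q2 \<and> G1 = G2"
proof -
  have PF: "lax_morphism K T P" "lax_morphism K T F" using P F by (auto simp: small_strictD PsAlg_simps)
  have f: "\<guillemotleft>Und F : Car (Dom F) \<leadsto> tgt K (Und P)\<guillemotright>"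
    using lax_morphismD[OF PF(1)] lax_morphismD[OF PF(2)] F(2) by (simp add: one_cell_def)
  note p = small_strictD[OF P]
  note q = smallD[OF chosen_pullback_small[OF p(2) f]]
  show ?thesis
    by (rule strict_pullback_unique[OF p(1) q(1,3) p(3), of "PbT S (Und P) (Und F)" F])
      (use chosen_pullback[OF p(2) f] assms(4,5) in \<open>simp_all add: is_alg_pullback_def left_tight_pullback_def\<close>)
qed

lemma is_alg_pullback_exists:
  assumes P: "P \<in> small_strict K T S" and F: "F \<in> Loose (PsAlg K T)" "Cod F = Cod P"
  shows "\<exists>Q G. is_alg_pullback P F Q G"
proof -
  have PF: "lax_morphism K T P" "lax_morphism K T F" "pseudo_algebra K T (Dom F)"
    using P F by (auto simp: small_strictD PsAlg_simps)
  have f: "\<guillemotleft>Und F : Car (Dom F) \<leadsto> tgt K (Und P)\<guillemotright>"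
    using lax_morphismD[OF PF(1)] lax_morphismD[OF PF(2)] F(2) by (simp add: one_cell_def)
  note p = small_strictD[OF P]
  note q = smallD[OF chosen_pullback_small[OF p(2) f]]
  show ?thesis
    using strict_pullback_exists[OF p(1,3,4) PF(2) F(2) PF(3) q(1) chosen_pullback[OF p(2) f]]
    by (auto simp: is_alg_pullback_def)
qed

definition alg_pullback where
  "alg_pullback P F = (SOME QG. is_alg_pullback P F (fst QG) (snd QG))"

definition alg_smallness where
  "alg_smallness = \<lparr>Small = small_strict K T S, PbL = \<lambda>P F. fst (alg_pullback P F),
     PbT = \<lambda>P F. snd (alg_pullback P F)\<rparr>"

lemma alg_smallness_simps:
  "Small alg_smallness = small_strict K T S"
  "PbL alg_smallness P F = fst (alg_pullback P F)"
  "PbT alg_smallness P F = snd (alg_pullback P F)"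
  by (simp_all add: alg_smallness_def)

lemma alg_pullback_is:
  assumes "P \<in> small_strict K T S" "F \<in> Loose (PsAlg K T)" "Cod F = Cod P"
  shows "is_alg_pullback P F (fst (alg_pullback P F)) (snd (alg_pullback P F))"
  unfolding alg_pullback_def
  using is_alg_pullback_exists[OF assms] by (intro someI_ex[of "\<lambda>QG. is_alg_pullback P F (fst QG) (snd QG)"]) auto

lemma alg_pullback_eq:
  assumes "P \<in> small_strict K T S" "F \<in> Loose (PsAlg K T)" "Cod F = Cod P" "is_alg_pullback P F Q G"
  shows "fst (alg_pullback P F) = Q" "snd (alg_pullback P F) = G"
  using is_alg_pullback_unique[OF assms(1-3) alg_pullback_is[OF assms(1-3)] assms(4)] by auto

text \<open>
  The functoriality equations hold because the right-hand sides satisfy the specification of the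
  left-hand sides.
\<close>

lemma PsAlg_smallness: "smallness_structure (PsAlg K T) alg_smallness"
proof
  show "tight_discrete_opfibration (PsAlg K T) P" if "P \<in> Small alg_smallness" for P
    using small_strictD[of P] that by (intro PsAlg_dopf) (simp_all add: alg_smallness_simps)
  show "left_tight_pullback (PsAlg K T) (PbL alg_smallness P F) P (PbT alg_smallness P F) F"
    "PbL alg_smallness P F \<in> Small alg_smallness"
    if P: "P \<in> Small alg_smallness" and F: "\<guillemotleft>F : A \<leadsto>\<^bsub>PsAlg K T\<^esub> tgt (PsAlg K T) P\<guillemotright>" for P F A
  proof -
    have a: "P \<in> small_strict K T S" "F \<in> Loose (PsAlg K T)" "Cod F = Cod P"
      using P F by (auto simp: alg_smallness_simps one_cell_def PsAlg_simps)
    show "left_tight_pullback (PsAlg K T) (PbL alg_smallness P F) P (PbT alg_smallness P F) F"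
      "PbL alg_smallness P F \<in> Small alg_smallness"
      using is_alg_pullbackD[OF a alg_pullback_is[OF a]] by (simp_all add: alg_smallness_simps)
  qed
  show "PbL alg_smallness P (Id1 (PsAlg K T) (tgt (PsAlg K T) P)) = P"
    "PbT alg_smallness P (Id1 (PsAlg K T) (tgt (PsAlg K T) P)) = Id1 (PsAlg K T) (src (PsAlg K T) P)"
    if "P \<in> Small alg_smallness" for P
  proof -
    have P: "P \<in> small_strict K T S" using that by (simp add: alg_smallness_simps)
    note p = small_strictD[OF P]
    let ?I = "Id1 (PsAlg K T) (tgt (PsAlg K T) P)" and ?J = "Id1 (PsAlg K T) (src (PsAlg K T) P)"
    have I: "?I \<in> Loose (PsAlg K T)" "Cod ?I = Cod P"
      using Alg.Id1_facts(1)[OF Alg.tgt_Ob[OF p(4)]] by (simp_all add: PsAlg_simps alg_id_sel)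
    have "is_alg_pullback P ?I P ?J"
      unfolding is_alg_pullback_def
      using Alg.square_Id1[OF p(4)] p PbL_Id1[OF p(2)] PbT_Id1[OF p(2)] lax_morphismD[OF p(5)]
      by (simp add: PsAlg_simps(5,6,9) alg_id_sel)
    then show "PbL alg_smallness P ?I = P" "PbT alg_smallness P ?I = ?J"
      using alg_pullback_eq[OF P I] by (simp_all add: alg_smallness_simps)
  qed
  show "PbL alg_smallness P (F \<cdot>\<^bsub>PsAlg K T\<^esub> G) = PbL alg_smallness (PbL alg_smallness P F) G"
    "PbT alg_smallness P (F \<cdot>\<^bsub>PsAlg K T\<^esub> G) =
     PbT alg_smallness P F \<cdot>\<^bsub>PsAlg K T\<^esub> PbT alg_smallness (PbL alg_smallness P F) G"
    if "P \<in> Small alg_smallness" and F: "\<guillemotleft>F : A \<leadsto>\<^bsub>PsAlg K T\<^esub> tgt (PsAlg K T) P\<guillemotright>"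
      and G: "\<guillemotleft>G : B \<leadsto>\<^bsub>PsAlg K T\<^esub> A\<guillemotright>" for P F A G B
  proof -
    have P: "P \<in> small_strict K T S" using that by (simp add: alg_smallness_simps)
    note p = small_strictD[OF P]
    have FL: "F \<in> Loose (PsAlg K T)" "Cod F = Cod P" and GL: "G \<in> Loose (PsAlg K T)" and GF: "Cod G = Dom F"
      using F G by (auto simp: one_cell_def PsAlg_simps)
    let ?Q = "PbL alg_smallness P F" and ?F = "PbT alg_smallness P F"
    have 1: "is_alg_pullback P F ?Q ?F" using alg_pullback_is[OF P FL] by (simp add: alg_smallness_simps)
    note QD = is_alg_pullbackD[OF P FL 1]
    have GQ: "Cod G = Cod ?Q" using QD(2) GF by (simp add: PsAlg_square_iff)
    let ?R = "PbL alg_smallness ?Q G" and ?G = "PbT alg_smallness ?Q G"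
    have 2: "is_alg_pullback ?Q G ?R ?G" using alg_pullback_is[OF QD(1) GL GQ] by (simp add: alg_smallness_simps)
    note RD = is_alg_pullbackD[OF QD(1) GL GQ 2]
    have FG: "F \<cdot>\<^bsub>PsAlg K T\<^esub> G \<in> Loose (PsAlg K T)" "Cod (F \<cdot>\<^bsub>PsAlg K T\<^esub> G) = Cod P"
      using Alg.comp_facts(1)[OF GL FL(1)] GF FL by (simp_all add: PsAlg_simps alg_comp_sel)
    have LL: "lax_morphism K T F" "lax_morphism K T G" using FL GL by (simp_all add: PsAlg_simps)
    have f: "\<guillemotleft>Und F : Car (Dom F) \<leadsto> tgt K (Und P)\<guillemotright>" and g: "\<guillemotleft>Und G : Car (Dom G) \<leadsto> Car (Dom F)\<guillemotright>"
      using lax_morphismD[OF LL(1)] lax_morphismD[OF LL(2)] lax_morphismD[OF p(5)] FL GF by (simp_all add: one_cell_def)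
    have "is_alg_pullback P (F \<cdot>\<^bsub>PsAlg K T\<^esub> G) ?R (?F \<cdot>\<^bsub>PsAlg K T\<^esub> ?G)"
      unfolding is_alg_pullback_def
      using Alg.square_paste[OF RD(2) QD(2)] 1 2 PbL_comp[OF p(2) f g] PbT_comp[OF p(2) f g]
      by (simp add: is_alg_pullback_def PsAlg_simps(11) alg_comp_sel(3))
    then show "PbL alg_smallness P (F \<cdot>\<^bsub>PsAlg K T\<^esub> G) = ?R"
      "PbT alg_smallness P (F \<cdot>\<^bsub>PsAlg K T\<^esub> G) = ?F \<cdot>\<^bsub>PsAlg K T\<^esub> ?G"
      using alg_pullback_eq[OF P FG] by (simp_all add: alg_smallness_simps)
  qed
qed

text \<open>
  The pullback is isomorphic, in the 2-category of algebras, to a chosen one, whose underlying square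
  is a pullback; the isomorphism has an underlying isomorphism, along which this is transported.
\<close>

lemma small_strict_pullback_Und:
  assumes P: "P \<in> small_strict K T S" and P': "P' \<in> small_strict K T S"
    and pb: "pullback_square (PsAlg K T) P P' G F"
  shows "pullback_square K (Und P) (Und P') (Und G) (Und F)"
proof -
  note sq = Alg.squareD[OF Alg.pullback_squareD[OF pb]]
  have F: "F \<in> Loose (PsAlg K T)" "Cod F = Cod P'" using sq by (simp_all add: PsAlg_simps(5,6))
  obtain Q G' where Q: "is_alg_pullback P' F Q G'" using is_alg_pullback_exists[OF P' F] by blast
  note QD = is_alg_pullbackD[OF P' F Q]
  have PF: "lax_morphism K T P'" "lax_morphism K T F" using P' F by (auto simp: small_strictD PsAlg_simps)
  have f: "\<guillemotleft>Und F : Car (Dom F) \<leadsto> tgt K (Und P')\<guillemotright>"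
    using lax_morphismD[OF PF(1)] lax_morphismD[OF PF(2)] F(2) by (simp add: one_cell_def)
  have pbK: "pullback_square K (Und Q) (Und P') (Und G') (Und F)"
    using chosen_pullback[OF small_strictD(2)[OF P'] f] Q by (simp add: is_alg_pullback_def left_tight_pullback_def)
  have pbQ: "pullback_square (PsAlg K T) Q P' G' F" using QD(3) by (simp add: left_tight_pullback_def)
  obtain H H' where H: "H \<in> Loose (PsAlg K T)" "H' \<in> Loose (PsAlg K T)" "Dom H = Dom P" "Cod H = Dom Q"
    "Dom H' = Dom Q" "Cod H' = Dom P" "alg_comp K T Q H = P" "alg_comp K T G' H = G"
    "alg_comp K T H' H = alg_id K (Dom P)" "alg_comp K T H H' = alg_id K (Dom Q)"
    by (rule Alg.pullback_iso[OF pb pbQ]) (simp add: PsAlg_simps(5,6,9,11))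
  have HL: "lax_morphism K T H" "lax_morphism K T H'" using H by (simp_all add: PsAlg_simps)
  note D = lax_morphismD[OF HL(1)] lax_morphismD[OF HL(2)] lax_morphismD[OF small_strictD(5)[OF QD(1)]] H(3-6)
  have e: "Und Q \<cdot> Und H = Und P" "Und G' \<cdot> Und H = Und G" "Und H' \<cdot> Und H = Id1 K (Car (Dom P))"
    "Und H \<cdot> Und H' = Id1 K (Car (Dom Q))"
    using arg_cong[OF H(7), of Und] arg_cong[OF H(8), of Und] arg_cong[OF H(9), of Und] arg_cong[OF H(10), of Und]
    by (simp_all add: alg_comp_sel(3) alg_id_sel(3))
  have "pullback_square K (Und Q \<cdot> Und H) (Und Q) (Und H) (Id1 K (tgt K (Und Q)))"
    by (rule iso_pullback[of "Und H" "Und H'"]) (simp_all add: D e)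
  from pullback_paste[OF this pbK] have "pullback_square K (Und P) (Und P') (Und G) (Und F \<cdot> Id1 K (tgt K (Und Q)))"
    by (simp add: e)
  moreover have "Und F \<cdot> Id1 K (tgt K (Und Q)) = Und F"
    using squareD(4,7)[OF pullback_squareD[OF pbK]] by (simp add: Id1_comp)
  ultimately show ?thesis by simp
qed

end

section \<open>The universal property of pullbacks of the classifier\<close>

context representable_plumbus
begin

abbreviation "u \<equiv> Univ C"

lemma u_facts: "u \<in> Loose K" "u \<in> Tight K" "tight_discrete_opfibration K u"
  using smallD[OF Univ_small] by auto

text \<open>
  A square \<open>(g, f)\<close> from \<open>p\<close> to \<open>u\<close> is isomorphic to its composite with the classifying square of
  \<open>u\<close>, since the latter is isomorphic to the identity.  So cells from the classifying square of \<open>p\<close>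
  to \<open>(g, f)\<close> correspond to the cells of the universal property.
\<close>

lemma classifying_cell_to_square:
  assumes p: "p \<in> Small S" and sq: "square K p u g f"
  shows "\<exists>!\<gamma>. square_cell K p u (ClT C p, ClB C p) (g, f) \<gamma>"
    and "pullback_square K p u g f \<Longrightarrow> square_cell K p u (ClT C p, ClB C p) (g, f) \<gamma> \<Longrightarrow>
      invertible_two_cell K (fst \<gamma>) \<and> invertible_two_cell K (snd \<gamma>)"
proof -
  note s = squareD[OF sq]
  have cp: "square K p u (ClT C p) (ClB C p)" and cu: "square K u u (ClT C u) (ClB C u)"
    using classifying_square[OF p] classifying_square[OF Univ_small] pullback_squareD by blast+
  obtain \<iota>0 where \<iota>0: "square_cell K u u (ClT C u, ClB C u) (Id1 K (src K u), Id1 K (tgt K u)) \<iota>0"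
    "invertible_two_cell K (fst \<iota>0)" "invertible_two_cell K (snd \<iota>0)"
    using classifying_Univ by blast
  obtain \<iota>\<^sub>t \<iota>\<^sub>b where "\<iota>0 = (\<iota>\<^sub>t, \<iota>\<^sub>b)" by (cases \<iota>0)
  with \<iota>0 have \<iota>: "square_cell K u u (ClT C u, ClB C u) (Id1 K (src K u), Id1 K (tgt K u)) (\<iota>\<^sub>t, \<iota>\<^sub>b)"
    and inv: "invertible_two_cell K \<iota>\<^sub>t" "invertible_two_cell K \<iota>\<^sub>b" by simp_all
  note \<iota>D = square_cellD[OF \<iota>] squareD[OF cu]
  have k: "square_cell K p u (ClT C u \<cdot> g, ClB C u \<cdot> f) (g, f) (\<iota>\<^sub>t \<lhd> g, \<iota>\<^sub>b \<lhd> f)"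
    using square_cell_rwhisker[OF cu sq \<iota>] s by (simp add: Id1_comp)
  have ki: "invertible_two_cell K (\<iota>\<^sub>t \<lhd> g)" "invertible_two_cell K (\<iota>\<^sub>b \<lhd> f)"
    by (rule invertible_rwhisker; use inv s \<iota>D in simp)+
  have sq': "square K p u (ClT C u \<cdot> g) (ClB C u \<cdot> f)" by (rule square_paste[OF sq cu])
  have ex: "\<exists>!\<gamma>. square_cell K p u (ClT C p, ClB C p) (ClT C u \<cdot> g, ClB C u \<cdot> f) \<gamma>"
    by (rule classifying_cell[OF p Univ_small sq])
  obtain \<delta>\<^sub>t \<delta>\<^sub>b where \<delta>: "square_cell K p u (ClT C p, ClB C p) (ClT C u \<cdot> g, ClB C u \<cdot> f) (\<delta>\<^sub>t, \<delta>\<^sub>b)"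
    using ex by auto
  have c: "square_cell K p u (ClT C p, ClB C p) (g, f) ((\<iota>\<^sub>t \<lhd> g) \<bullet> \<delta>\<^sub>t, (\<iota>\<^sub>b \<lhd> f) \<bullet> \<delta>\<^sub>b)"
    by (rule square_cell_vcomp[OF cp \<delta> k])
  obtain l m where lm: "square_cell K p u (g, f) (ClT C u \<cdot> g, ClB C u \<cdot> f) (l, m)"
    "(\<iota>\<^sub>t \<lhd> g) \<bullet> l = Id2 K g" "(\<iota>\<^sub>b \<lhd> f) \<bullet> m = Id2 K f"
    by (rule square_cell_inverse[OF sq' k ki])
  have uniq: "\<gamma> = ((\<iota>\<^sub>t \<lhd> g) \<bullet> \<delta>\<^sub>t, (\<iota>\<^sub>b \<lhd> f) \<bullet> \<delta>\<^sub>b)" if g0: "square_cell K p u (ClT C p, ClB C p) (g, f) \<gamma>" for \<gamma>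
  proof -
    obtain a b where ab: "\<gamma> = (a, b)" by (cases \<gamma>)
    note g1 = g0[unfolded ab]
    have e: "l \<bullet> a = \<delta>\<^sub>t" "m \<bullet> b = \<delta>\<^sub>b"
      using ex square_cell_vcomp[OF cp g1 lm(1)] \<delta> by auto
    note D = square_cellD[OF g1] square_cellD[OF lm(1)] square_cellD[OF k]
    have "(\<iota>\<^sub>t \<lhd> g) \<bullet> (l \<bullet> a) = a" "(\<iota>\<^sub>b \<lhd> f) \<bullet> (m \<bullet> b) = b"
      using vcomp_extend[OF lm(2), of a] vcomp_extend[OF lm(3), of b] D
      by (simp_all add: vcomp_Id2)
    with e ab show ?thesis by simp
  qed
  from c uniq show "\<exists>!\<gamma>. square_cell K p u (ClT C p, ClB C p) (g, f) \<gamma>" by blast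
  assume pb: "pullback_square K p u g f" and g0: "square_cell K p u (ClT C p, ClB C p) (g, f) \<gamma>"
  have "invertible_two_cell K \<delta>\<^sub>t" "invertible_two_cell K \<delta>\<^sub>b"
    using classifying_cell_invertible[OF p Univ_small pb \<delta>] by simp_all
  then have "invertible_two_cell K ((\<iota>\<^sub>t \<lhd> g) \<bullet> \<delta>\<^sub>t)" "invertible_two_cell K ((\<iota>\<^sub>b \<lhd> f) \<bullet> \<delta>\<^sub>b)"
    using ki square_cellD[OF \<delta>] square_cellD[OF k] by (auto intro: invertible_vcomp)
  then show "invertible_two_cell K (fst \<gamma>) \<and> invertible_two_cell K (snd \<gamma>)"
    using uniq[OF g0] by simp
qed

text \<open>
  A pullback square is isomorphic to the classifying square of \<open>p\<close>, so it has the same universal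
  property.
\<close>

lemma small_pullback_classifies:
  assumes p: "p \<in> Small S" and pb: "pullback_square K p u a' a" and sq: "square K p u b' b"
  shows "\<exists>!\<gamma>. square_cell K p u (a', a) (b', b) \<gamma>"
    and "pullback_square K p u b' b \<Longrightarrow> square_cell K p u (a', a) (b', b) \<gamma> \<Longrightarrow>
      invertible_two_cell K (fst \<gamma>) \<and> invertible_two_cell K (snd \<gamma>)"
proof -
  note sqa = pullback_squareD[OF pb]
  have cp: "square K p u (ClT C p) (ClB C p)"
    using classifying_square[OF p] pullback_squareD by blast
  obtain k l where kl: "square_cell K p u (ClT C p, ClB C p) (a', a) (k, l)"
    using classifying_cell_to_square(1)[OF p sqa] by auto
  have kli: "invertible_two_cell K k" "invertible_two_cell K l"
    using classifying_cell_to_square(2)[OF p sqa pb kl] by simp_all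
  obtain k' l' where kl': "square_cell K p u (a', a) (ClT C p, ClB C p) (k', l')"
    "k' \<bullet> k = Id2 K (ClT C p)" "k \<bullet> k' = Id2 K a'" "l' \<bullet> l = Id2 K (ClB C p)" "l \<bullet> l' = Id2 K a"
    "invertible_two_cell K k'" "invertible_two_cell K l'"
    by (rule square_cell_inverse[OF cp kl kli])
  have ex: "\<exists>!\<gamma>. square_cell K p u (ClT C p, ClB C p) (b', b) \<gamma>"
    by (rule classifying_cell_to_square(1)[OF p sq])
  obtain m n where mn: "square_cell K p u (ClT C p, ClB C p) (b', b) (m, n)" using ex by auto
  have c: "square_cell K p u (a', a) (b', b) (m \<bullet> k', n \<bullet> l')"
    by (rule square_cell_vcomp[OF sqa kl'(1) mn])
  have uniq: "\<gamma> = (m \<bullet> k', n \<bullet> l')" if g0: "square_cell K p u (a', a) (b', b) \<gamma>" for \<gamma>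
  proof -
    obtain x y where xy: "\<gamma> = (x, y)" by (cases \<gamma>)
    note g1 = g0[unfolded xy]
    have e: "x \<bullet> k = m" "y \<bullet> l = n"
      using ex square_cell_vcomp[OF cp kl g1] mn by auto
    note D = square_cellD[OF g1] square_cellD[OF kl] square_cellD[OF kl'(1)]
    have "m \<bullet> k' = x" "n \<bullet> l' = y"
      unfolding e[symmetric] using D kl' by (simp_all add: two_cat)
    with xy show ?thesis by simp
  qed
  from c uniq show "\<exists>!\<gamma>. square_cell K p u (a', a) (b', b) \<gamma>" by blast
  assume pb': "pullback_square K p u b' b" and g0: "square_cell K p u (a', a) (b', b) \<gamma>"
  have "invertible_two_cell K m" "invertible_two_cell K n"
    using classifying_cell_to_square(2)[OF p sq pb' mn] by simp_all
  then have "invertible_two_cell K (m \<bullet> k')" "invertible_two_cell K (n \<bullet> l')"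
    using kl'(6,7) square_cellD[OF mn] square_cellD[OF kl'(1)] by (auto intro: invertible_vcomp)
  then show "invertible_two_cell K (fst \<gamma>) \<and> invertible_two_cell K (snd \<gamma>)"
    using uniq[OF g0] by simp
qed

text \<open>
  An arbitrary pullback \<open>p\<close> of \<open>u\<close> is isomorphic, over its codomain, to the chosen one, which is
  small.  Whiskering with the isomorphism identifies cells between squares from \<open>p\<close> with cells between
  squares from the chosen pullback.
\<close>

lemma pullback_classifies:
  assumes pb: "pullback_square K p u a' a" and sq: "square K p u b' b"
  shows "\<exists>!\<gamma>. square_cell K p u (a', a) (b', b) \<gamma>"
    and "pullback_square K p u b' b \<Longrightarrow> square_cell K p u (a', a) (b', b) \<gamma> \<Longrightarrow>
      invertible_two_cell K (fst \<gamma>) \<and> invertible_two_cell K (snd \<gamma>)"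
proof -
  note sqa = pullback_squareD[OF pb]
  note sa = squareD[OF sqa] and sb = squareD[OF sq]
  have a: "\<guillemotleft>a : tgt K p \<leadsto> tgt K u\<guillemotright>" using sa by (simp add: one_cell_def)
  let ?q = "PbL S u a" and ?c = "PbT S u a"
  have q: "?q \<in> Small S" by (rule chosen_pullback_small[OF Univ_small a])
  have pbq: "pullback_square K ?q u ?c a"
    using chosen_pullback[OF Univ_small a] by (simp add: left_tight_pullback_def)
  obtain h k where hk: "h \<in> Loose K" "k \<in> Loose K" "src K h = src K p" "tgt K h = src K ?q"
    "src K k = src K ?q" "tgt K k = src K p" "?q \<cdot> h = p" "?c \<cdot> h = a'" "p \<cdot> k = ?q" "a' \<cdot> k = ?c"
    "k \<cdot> h = Id1 K (src K p)" "h \<cdot> k = Id1 K (src K ?q)"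
    by (rule pullback_iso[OF pb pbq])
  note sc = squareD[OF pullback_squareD[OF pbq]]
  have t: "tgt K ?q = tgt K p" using sc sa by simp
  have sk: "square K ?q p k (Id1 K (tgt K p))" and sh: "square K p ?q h (Id1 K (tgt K p))"
    by (rule squareI; simp add: hk(1-10) sc(1) sa(1) t two_cat)+
  have to_q: "square_cell K ?q u (x' \<cdot> k, x) (y' \<cdot> k, y) (\<alpha> \<lhd> k, \<beta>)"
    if "square K p u x' x" "square_cell K p u (x', x) (y', y) (\<alpha>, \<beta>)" for x' x y' y \<alpha> \<beta>
    using square_cell_rwhisker[OF that(1) sk that(2)] squareD[OF that(1)] square_cellD[OF that(2)]
      squareD[OF square_cell_target[OF that]]
    by (simp add: two_cat)
  have to_p: "square_cell K p u (x' \<cdot> h, x) (y' \<cdot> h, y) (\<alpha> \<lhd> h, \<beta>)"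
    if "square K ?q u x' x" "square_cell K ?q u (x', x) (y', y) (\<alpha>, \<beta>)" for x' x y' y \<alpha> \<beta>
    using square_cell_rwhisker[OF that(1) sh that(2)] squareD[OF that(1)] square_cellD[OF that(2)]
      squareD[OF square_cell_target[OF that]] t
    by (simp add: two_cat)
  have sqb: "square K ?q u (b' \<cdot> k) b"
    using square_paste[OF sk sq] sb by (simp add: two_cat)
  have ex: "\<exists>!\<gamma>. square_cell K ?q u (?c, a) (b' \<cdot> k, b) \<gamma>"
    by (rule small_pullback_classifies(1)[OF q pbq sqb])
  obtain m n where mn: "square_cell K ?q u (?c, a) (b' \<cdot> k, b) (m, n)" using ex by auto
  have bkh: "(b' \<cdot> k) \<cdot> h = b'" using hk sb by (simp add: two_cat)
  have c: "square_cell K p u (a', a) (b', b) (m \<lhd> h, n)"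
    using to_p[OF pullback_squareD[OF pbq] mn] by (simp add: hk(8) bkh)
  have uniq: "\<gamma> = (m \<lhd> h, n)" if g0: "square_cell K p u (a', a) (b', b) \<gamma>" for \<gamma>
  proof -
    obtain x y where xy: "\<gamma> = (x, y)" by (cases \<gamma>)
    note g1 = g0[unfolded xy]
    have "square_cell K ?q u (?c, a) (b' \<cdot> k, b) (x \<lhd> k, y)"
      using to_q[OF sqa g1] by (simp add: hk(10))
    then have e: "x \<lhd> k = m" "y = n"
      using ex mn by auto
    have "m \<lhd> h = x"
      unfolding e[symmetric] using square_cellD[OF g1] sa hk by (simp add: two_cat)
    with xy e show ?thesis by simp
  qed
  from c uniq show "\<exists>!\<gamma>. square_cell K p u (a', a) (b', b) \<gamma>" by blast
  assume pb': "pullback_square K p u b' b" and g0: "square_cell K p u (a', a) (b', b) \<gamma>"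
  have "pullback_square K (p \<cdot> k) p k (Id1 K (tgt K p))"
    by (rule iso_pullback[of k h]) (use hk sa in simp_all)
  from pullback_paste[OF this pb'] have pbb: "pullback_square K ?q u (b' \<cdot> k) b"
    using hk(9) sb by (simp add: Id1_comp)
  have "invertible_two_cell K m" "invertible_two_cell K n"
    using small_pullback_classifies(2)[OF q pbq sqb pbb mn] by simp_all
  then have "invertible_two_cell K (m \<lhd> h)" "invertible_two_cell K n"
    using hk sc square_cellD[OF mn] by (auto intro: invertible_rwhisker)
  then show "invertible_two_cell K (fst \<gamma>) \<and> invertible_two_cell K (snd \<gamma>)"
    using uniq[OF g0] by simp
qed

lemma pullback_classifies_unique:
  assumes pb: "pullback_square K p u a' a"
    and "square_cell K p u (a', a) (b', b) (\<alpha>, \<beta>)" "square_cell K p u (a', a) (b', b) (\<alpha>', \<beta>')"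
  shows "\<alpha> = \<alpha>'" "\<beta> = \<beta>'"
  using pullback_classifies(1)[OF pb square_cell_target[OF pullback_squareD[OF pb] assms(2)]] assms(2,3)
  by auto

end

section \<open>The classifier as a pseudo-algebra\<close>

locale cartesian_monad = representable_plumbus K S one C + enhanced_2_monad K T
  for K :: "('o, 'a, 'c) enh2cat" (structure) and S :: "'a smallness" and one :: 'o
    and C :: "'a classifier" and T :: "('o, 'a, 'c) e2monad" +
  assumes cartesian: "fully_opfibrantly_cartesian K S C T"

sublocale cartesian_monad \<subseteq> monad_on_smallness K T S ..

context enhanced_2_monad
begin

lemma T_square: "square K p p' g f \<Longrightarrow> square K (T1 T p) (T1 T p') (T1 T g) (T1 T f)"
  using squareD[of p p' g f] by (intro squareI) (simp_all add: monad_typing flip: T1_comp')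

lemma T_square_cell:
  assumes "square K p p' g f" "square_cell K p p' (g, f) (g', f') (\<alpha>, \<beta>)"
  shows "square_cell K (T1 T p) (T1 T p') (T1 T g, T1 T f) (T1 T g', T1 T f') (T2 T \<alpha>, T2 T \<beta>)"
  using squareD[OF assms(1)] square_cellD[OF assms(2)]
  by (intro square_cellI) (simp_all add: monad_typing flip: T2_lwhisker T2_rwhisker)

lemma unit_square: "p \<in> Loose K \<Longrightarrow> square K p (T1 T p) (unit T (src K p)) (unit T (tgt K p))"
  by (intro squareI) (simp_all add: two_cat_typing monad_typing unit_nat)

lemma mult_square:
  "p \<in> Loose K \<Longrightarrow> square K (T1 T (T1 T p)) (T1 T p) (mult T (src K p)) (mult T (tgt K p))"
  by (intro squareI) (simp_all add: two_cat_typing monad_typing mult_nat)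

end

context cartesian_monad
begin

abbreviation "\<omega>' \<equiv> ClT C (T1 T u)"
abbreviation "\<omega> \<equiv> ClB C (T1 T u)"
abbreviation "\<Omega>' \<equiv> src K u"
abbreviation "\<Omega> \<equiv> tgt K u"

lemma Tu_small: "T1 T u \<in> Small S"
  and T_pullback: "pullback_square K p u g f \<Longrightarrow> pullback_square K (T1 T p) (T1 T u) (T1 T g) (T1 T f)"
  and omega_Tight: "\<omega> \<in> Tight K"
  and unit_pullback: "pullback_square K u (T1 T u) (unit T \<Omega>') (unit T \<Omega>)"
  and mult_pullback: "pullback_square K (T1 T (T1 T u)) (T1 T u) (mult T \<Omega>') (mult T \<Omega>)"
  using cartesian by (simp_all add: fully_opfibrantly_cartesian_def Let_def perfect_def)

lemma omega_pullback: "pullback_square K (T1 T u) u \<omega>' \<omega>"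
  by (rule classifying_square[OF Tu_small])

lemmas omega_square = pullback_squareD[OF omega_pullback]

lemma u_typing: "u \<in> Loose K" "\<Omega>' \<in> Ob K" "\<Omega> \<in> Ob K"
  "\<omega>' \<in> Loose K" "src K \<omega>' = T0 T \<Omega>'" "tgt K \<omega>' = \<Omega>'"
  "\<omega> \<in> Loose K" "src K \<omega> = T0 T \<Omega>" "tgt K \<omega> = \<Omega>"
  using squareD[OF omega_square] u_facts by (simp_all add: monad_typing two_cat_typing)

lemma u_omega: "u \<cdot> \<omega>' = \<omega> \<cdot> T1 T u"
  using squareD[OF omega_square] by simp

text \<open>
  The 1-cell \<open>\<omega>'\<close> lies over the tight 1-cell \<open>\<omega> \<cdot> T u\<close>, and \<open>u\<close> detects tightness.
\<close>

lemma omega'_Tight: "\<omega>' \<in> Tight K"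
  by (rule small_detects_tight[OF Univ_small])
    (simp_all add: u_omega u_typing omega_Tight comp_Tight T1_Tight u_facts monad_typing)

lemma act_square: "square K p u a' a \<Longrightarrow> square K (T1 T p) u (\<omega>' \<cdot> T1 T a') (\<omega> \<cdot> T1 T a)"
  by (rule square_paste[OF T_square omega_square])

text \<open>
  All iterated actions on \<open>u\<close> are obtained by repeating this step, so they are sources of unique
  comparison cells.
\<close>

lemma act_pullback: "pullback_square K p u a' a \<Longrightarrow> pullback_square K (T1 T p) u (\<omega>' \<cdot> T1 T a') (\<omega> \<cdot> T1 T a)"
  by (rule pullback_paste[OF T_pullback omega_pullback])

lemma act_cell:
  assumes "square K p u g f" "square_cell K p u (g, f) (g', f') (\<alpha>, \<beta>)"
  shows "square_cell K (T1 T p) u (\<omega>' \<cdot> T1 T g, \<omega> \<cdot> T1 T f) (\<omega>' \<cdot> T1 T g', \<omega> \<cdot> T1 T f')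
    (\<omega>' \<rhd> T2 T \<alpha>, \<omega> \<rhd> T2 T \<beta>)"
  by (rule square_cell_lwhisker[OF T_square[OF assms(1)] omega_square T_square_cell[OF assms]])

lemma u_Id_pullback: "pullback_square K u u (Id1 K \<Omega>') (Id1 K \<Omega>)"
  using iso_pullback[of "Id1 K \<Omega>'" "Id1 K \<Omega>'" u] by (simp add: u_typing two_cat)

definition classify where
  "classify p g f g' f' = (THE \<gamma>. square_cell K p u (g, f) (g', f') \<gamma>)"

lemma classify:
  assumes "pullback_square K p u g f" "square K p u g' f'"
  shows "square_cell K p u (g, f) (g', f') (fst (classify p g f g' f'), snd (classify p g f g' f'))"
  using theI'[OF pullback_classifies(1)[OF assms]] by (simp add: classify_def)

lemma classify_invertible:
  assumes "pullback_square K p u g f" "pullback_square K p u g' f'"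
  shows "invertible_two_cell K (fst (classify p g f g' f'))" "invertible_two_cell K (snd (classify p g f g' f'))"
  using pullback_classifies(2)[OF assms(1) pullback_squareD[OF assms(2)] assms(2)
      classify[OF assms(1) pullback_squareD[OF assms(2)]]] by simp_all

text \<open>
  The coherence cells of the universal algebra come in pairs: the first component belongs to the
  source of \<open>u\<close>, the second to its target.
\<close>

definition "omega_unit = classify u (Id1 K \<Omega>') (Id1 K \<Omega>) (\<omega>' \<cdot> unit T \<Omega>') (\<omega> \<cdot> unit T \<Omega>)"

definition "omega_mult = classify (T1 T (T1 T u)) (\<omega>' \<cdot> T1 T \<omega>') (\<omega> \<cdot> T1 T \<omega>) (\<omega>' \<cdot> mult T \<Omega>') (\<omega> \<cdot> mult T \<Omega>)"

lemma omega_unit_cell: "square_cell K u u (Id1 K \<Omega>', Id1 K \<Omega>) (\<omega>' \<cdot> unit T \<Omega>', \<omega> \<cdot> unit T \<Omega>) (fst omega_unit, snd omega_unit)"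
  and omega_unit_invertible: "invertible_two_cell K (fst omega_unit)" "invertible_two_cell K (snd omega_unit)"
  using classify[OF u_Id_pullback pullback_squareD[OF pullback_paste[OF unit_pullback omega_pullback]]]
    classify_invertible[OF u_Id_pullback pullback_paste[OF unit_pullback omega_pullback]]
  by (simp_all add: omega_unit_def)

lemma omega_mult_cell: "square_cell K (T1 T (T1 T u)) u (\<omega>' \<cdot> T1 T \<omega>', \<omega> \<cdot> T1 T \<omega>)
    (\<omega>' \<cdot> mult T \<Omega>', \<omega> \<cdot> mult T \<Omega>) (fst omega_mult, snd omega_mult)"
  and omega_mult_invertible: "invertible_two_cell K (fst omega_mult)" "invertible_two_cell K (snd omega_mult)"
  using classify[OF act_pullback[OF omega_pullback] pullback_squareD[OF pullback_paste[OF mult_pullback omega_pullback]]]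
    classify_invertible[OF act_pullback[OF omega_pullback] pullback_paste[OF mult_pullback omega_pullback]]
  by (simp_all add: omega_mult_def)

lemmas omega_cells = square_cellD[OF omega_unit_cell] square_cellD[OF omega_mult_cell]

lemmas omega_cat = u_typing omega_cells(1-6) omega_cells(8-13) cat

lemma u_Id_square: "square K u u (Id1 K \<Omega>') (Id1 K \<Omega>)" by (rule pullback_squareD[OF u_Id_pullback])

lemma omega_omega_square: "square K (T1 T (T1 T u)) u (\<omega>' \<cdot> T1 T \<omega>') (\<omega> \<cdot> T1 T \<omega>)" by (rule act_square[OF omega_square])

text \<open>
  In this and the next two lemmas both sides are comparison cells out of a pullback square: out of
  \<open>(\<omega>', \<omega>)\<close> for the unit laws and out of the threefold iterated action for associativity.
\<close>

lemma unit_law1: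
  "(fst omega_mult \<lhd> unit T (T0 T \<Omega>')) \<bullet> (fst omega_unit \<lhd> \<omega>') = Id2 K \<omega>'"
  "(snd omega_mult \<lhd> unit T (T0 T \<Omega>)) \<bullet> (snd omega_unit \<lhd> \<omega>) = Id2 K \<omega>"
proof -
  have us: "square K (T1 T u) (T1 T (T1 T u)) (unit T (T0 T \<Omega>')) (unit T (T0 T \<Omega>))"
    using unit_square[of "T1 T u"] by (simp add: omega_cat)
  have 1: "square_cell K (T1 T u) u (\<omega>', \<omega>) (\<omega>' \<cdot> (T1 T \<omega>' \<cdot> unit T (T0 T \<Omega>')), \<omega> \<cdot> (T1 T \<omega> \<cdot> unit T (T0 T \<Omega>)))
      (fst omega_unit \<lhd> \<omega>', snd omega_unit \<lhd> \<omega>)"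
    using square_cell_rwhisker[OF u_Id_square omega_square omega_unit_cell] by (simp add: omega_cat)
  have 2: "square_cell K (T1 T u) u (\<omega>' \<cdot> (T1 T \<omega>' \<cdot> unit T (T0 T \<Omega>')), \<omega> \<cdot> (T1 T \<omega> \<cdot> unit T (T0 T \<Omega>))) (\<omega>', \<omega>)
      (fst omega_mult \<lhd> unit T (T0 T \<Omega>'), snd omega_mult \<lhd> unit T (T0 T \<Omega>))"
    using square_cell_rwhisker[OF omega_omega_square us omega_mult_cell] by (simp add: omega_cat)
  show "(fst omega_mult \<lhd> unit T (T0 T \<Omega>')) \<bullet> (fst omega_unit \<lhd> \<omega>') = Id2 K \<omega>'"
    "(snd omega_mult \<lhd> unit T (T0 T \<Omega>)) \<bullet> (snd omega_unit \<lhd> \<omega>) = Id2 K \<omega>"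
    using pullback_classifies_unique[OF omega_pullback square_cell_vcomp[OF omega_square 1 2] square_cell_Id2[OF omega_square]]
    by simp_all
qed

lemma unit_law2:
  "(fst omega_mult \<lhd> T1 T (unit T \<Omega>')) \<bullet> (\<omega>' \<rhd> T2 T (fst omega_unit)) = Id2 K \<omega>'"
  "(snd omega_mult \<lhd> T1 T (unit T \<Omega>)) \<bullet> (\<omega> \<rhd> T2 T (snd omega_unit)) = Id2 K \<omega>"
proof -
  have us: "square K (T1 T u) (T1 T (T1 T u)) (T1 T (unit T \<Omega>')) (T1 T (unit T \<Omega>))"
    using T_square[OF unit_square[of u]] by (simp add: omega_cat)
  have 1: "square_cell K (T1 T u) u (\<omega>', \<omega>) (\<omega>' \<cdot> (T1 T \<omega>' \<cdot> T1 T (unit T \<Omega>')), \<omega> \<cdot> (T1 T \<omega> \<cdot> T1 T (unit T \<Omega>)))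
      (\<omega>' \<rhd> T2 T (fst omega_unit), \<omega> \<rhd> T2 T (snd omega_unit))"
    using act_cell[OF u_Id_square omega_unit_cell] by (simp add: omega_cat)
  have 2: "square_cell K (T1 T u) u (\<omega>' \<cdot> (T1 T \<omega>' \<cdot> T1 T (unit T \<Omega>')), \<omega> \<cdot> (T1 T \<omega> \<cdot> T1 T (unit T \<Omega>))) (\<omega>', \<omega>)
      (fst omega_mult \<lhd> T1 T (unit T \<Omega>'), snd omega_mult \<lhd> T1 T (unit T \<Omega>))"
    using square_cell_rwhisker[OF omega_omega_square us omega_mult_cell] by (simp add: omega_cat)
  show "(fst omega_mult \<lhd> T1 T (unit T \<Omega>')) \<bullet> (\<omega>' \<rhd> T2 T (fst omega_unit)) = Id2 K \<omega>'"
    "(snd omega_mult \<lhd> T1 T (unit T \<Omega>)) \<bullet> (\<omega> \<rhd> T2 T (snd omega_unit)) = Id2 K \<omega>"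
    using pullback_classifies_unique[OF omega_pullback square_cell_vcomp[OF omega_square 1 2] square_cell_Id2[OF omega_square]]
    by simp_all
qed

lemma assoc_law:
  "(fst omega_mult \<lhd> mult T (T0 T \<Omega>')) \<bullet> (fst omega_mult \<lhd> T1 T (T1 T \<omega>')) =
     (fst omega_mult \<lhd> T1 T (mult T \<Omega>')) \<bullet> (\<omega>' \<rhd> T2 T (fst omega_mult))"
  "(snd omega_mult \<lhd> mult T (T0 T \<Omega>)) \<bullet> (snd omega_mult \<lhd> T1 T (T1 T \<omega>)) =
     (snd omega_mult \<lhd> T1 T (mult T \<Omega>)) \<bullet> (\<omega> \<rhd> T2 T (snd omega_mult))"
proof -
  let ?u3 = "T1 T (T1 T (T1 T u))"
  let ?s' = "\<omega>' \<cdot> (T1 T \<omega>' \<cdot> T1 T (T1 T \<omega>'))" and ?s = "\<omega> \<cdot> (T1 T \<omega> \<cdot> T1 T (T1 T \<omega>))"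
  let ?t' = "\<omega>' \<cdot> (mult T \<Omega>' \<cdot> mult T (T0 T \<Omega>'))" and ?t = "\<omega> \<cdot> (mult T \<Omega> \<cdot> mult T (T0 T \<Omega>))"
  have pb: "pullback_square K ?u3 u ?s' ?s"
    using act_pullback[OF act_pullback[OF omega_pullback]] by (simp add: omega_cat)
  have ms: "square K ?u3 (T1 T (T1 T u)) (mult T (T0 T \<Omega>')) (mult T (T0 T \<Omega>))"
    using mult_square[of "T1 T u"] by (simp add: omega_cat)
  have Tms: "square K ?u3 (T1 T (T1 T u)) (T1 T (mult T \<Omega>')) (T1 T (mult T \<Omega>))"
    using T_square[OF mult_square[of u]] by (simp add: omega_cat)
  have 1: "square_cell K ?u3 u (?s', ?s) (\<omega>' \<cdot> (T1 T \<omega>' \<cdot> mult T (T0 T \<Omega>')), \<omega> \<cdot> (T1 T \<omega> \<cdot> mult T (T0 T \<Omega>)))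
      (fst omega_mult \<lhd> T1 T (T1 T \<omega>'), snd omega_mult \<lhd> T1 T (T1 T \<omega>))"
    using square_cell_rwhisker[OF omega_omega_square T_square[OF T_square[OF omega_square]] omega_mult_cell] by (simp add: omega_cat)
  have 2: "square_cell K ?u3 u (\<omega>' \<cdot> (T1 T \<omega>' \<cdot> mult T (T0 T \<Omega>')), \<omega> \<cdot> (T1 T \<omega> \<cdot> mult T (T0 T \<Omega>))) (?t', ?t)
      (fst omega_mult \<lhd> mult T (T0 T \<Omega>'), snd omega_mult \<lhd> mult T (T0 T \<Omega>))"
    using square_cell_rwhisker[OF omega_omega_square ms omega_mult_cell] by (simp add: omega_cat)
  have 3: "square_cell K ?u3 u (?s', ?s) (\<omega>' \<cdot> (T1 T \<omega>' \<cdot> T1 T (mult T \<Omega>')), \<omega> \<cdot> (T1 T \<omega> \<cdot> T1 T (mult T \<Omega>)))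
      (\<omega>' \<rhd> T2 T (fst omega_mult), \<omega> \<rhd> T2 T (snd omega_mult))"
    using act_cell[OF omega_omega_square omega_mult_cell] by (simp add: omega_cat)
  have 4: "square_cell K ?u3 u (\<omega>' \<cdot> (T1 T \<omega>' \<cdot> T1 T (mult T \<Omega>')), \<omega> \<cdot> (T1 T \<omega> \<cdot> T1 T (mult T \<Omega>))) (?t', ?t)
      (fst omega_mult \<lhd> T1 T (mult T \<Omega>'), snd omega_mult \<lhd> T1 T (mult T \<Omega>))"
    using square_cell_rwhisker[OF omega_omega_square Tms omega_mult_cell] by (simp add: omega_cat)
  note sq = pullback_squareD[OF pb]
  show "(fst omega_mult \<lhd> mult T (T0 T \<Omega>')) \<bullet> (fst omega_mult \<lhd> T1 T (T1 T \<omega>')) =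
     (fst omega_mult \<lhd> T1 T (mult T \<Omega>')) \<bullet> (\<omega>' \<rhd> T2 T (fst omega_mult))"
    "(snd omega_mult \<lhd> mult T (T0 T \<Omega>)) \<bullet> (snd omega_mult \<lhd> T1 T (T1 T \<omega>)) =
     (snd omega_mult \<lhd> T1 T (mult T \<Omega>)) \<bullet> (\<omega> \<rhd> T2 T (snd omega_mult))"
    using pullback_classifies_unique[OF pb square_cell_vcomp[OF sq 1 2] square_cell_vcomp[OF sq 3 4]]
    by simp_all
qed

definition "Omega_alg' = Alg \<Omega>' \<omega>' (fst omega_unit) (fst omega_mult)"
definition "Omega_alg = Alg \<Omega> \<omega> (snd omega_unit) (snd omega_mult)"
definition "Univ_mor = Mor Omega_alg' Omega_alg u (Id2 K (u \<cdot> \<omega>'))"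

lemma Univ_mor_sel: "Car Omega_alg' = \<Omega>'" "Act Omega_alg' = \<omega>'" "Unt Omega_alg' = fst omega_unit" "Mul Omega_alg' = fst omega_mult"
  "Car Omega_alg = \<Omega>" "Act Omega_alg = \<omega>" "Unt Omega_alg = snd omega_unit" "Mul Omega_alg = snd omega_mult"
  "Dom Univ_mor = Omega_alg'" "Cod Univ_mor = Omega_alg" "Und Univ_mor = u" "Str Univ_mor = Id2 K (u \<cdot> \<omega>')"
  by (simp_all add: Omega_alg'_def Omega_alg_def Univ_mor_def)

lemma Omega_alg_pseudo: "pseudo_algebra K T Omega_alg'" "pseudo_algebra K T Omega_alg"
proof -
  have "lax_algebra K T Omega_alg'" "lax_algebra K T Omega_alg"
    by (rule lax_algebraI; simp add: Univ_mor_sel omega_cat omega_Tight omega'_Tight unit_law1 unit_law2 assoc_law flip: mult_mult)+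
  then show "pseudo_algebra K T Omega_alg'" "pseudo_algebra K T Omega_alg"
    by (simp_all add: pseudo_algebra_def Univ_mor_sel omega_unit_invertible omega_mult_invertible)
qed

lemma Univ_mor_small: "Univ_mor \<in> small_strict K T S"
proof -
  have T_u_omega: "T1 T u \<cdot> T1 T \<omega>' = T1 T \<omega> \<cdot> T1 T (T1 T u)"
    using arg_cong[OF u_omega, of "T1 T"] by (simp add: omega_cat)
  have u_omega_extend: "u \<cdot> (\<omega>' \<cdot> x) = \<omega> \<cdot> (T1 T u \<cdot> x)" if "x \<in> Loose K" "tgt K x = T0 T \<Omega>'" for x
    by (rule comp_extend[OF u_omega]) (use that in \<open>simp_all add: omega_cat\<close>)
  have "lax_morphism K T Univ_mor"
    by (rule lax_morphismI)
      (use Omega_alg_pseudo in \<open>simp_all add: Univ_mor_sel omega_cat u_omega u_omega_extend T_u_omega pseudo_algebra_def omega_cells(7,14)\<close>)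
  then show ?thesis
    using Omega_alg_pseudo by (simp add: small_strict_def strict_morphism_def PsAlg_simps Univ_mor_sel Univ_small)
qed

lemmas Univ_morD = small_strictD[OF Univ_mor_small]

section \<open>Classifying small strict morphisms\<close>

lemma strict_action_square:
  assumes "strict_morphism K T P"
  shows "square K (T1 T (Und P)) (Und P) (Act (Dom P)) (Act (Cod P))"
  using lax_morphismD[OF strict_morphismD(1)[OF assms]] strict_morphismD(3)[OF assms]
  by (intro squareI) (simp_all add: lax_algebraD monad_typing)

text \<open>
  The structure cells of both sides of the classifying square of \<open>P\<close>: the comparison from the action
  applied to the classifying square to the classifying square applied to the actions.
\<close>

definition "classifying_str P = classify (T1 T (Und P)) (\<omega>' \<cdot> T1 T (ClT C (Und P))) (\<omega> \<cdot> T1 T (ClB C (Und P)))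
   (ClT C (Und P) \<cdot> Act (Dom P)) (ClB C (Und P) \<cdot> Act (Cod P))"
definition "ClT_alg P = Mor (Dom P) Omega_alg' (ClT C (Und P)) (fst (classifying_str P))"
definition "ClB_alg P = Mor (Cod P) Omega_alg (ClB C (Und P)) (snd (classifying_str P))"

lemma Cl_alg_sel: "Dom (ClT_alg P) = Dom P" "Cod (ClT_alg P) = Omega_alg'" "Und (ClT_alg P) = ClT C (Und P)" "Str (ClT_alg P) = fst (classifying_str P)"
  "Dom (ClB_alg P) = Cod P" "Cod (ClB_alg P) = Omega_alg" "Und (ClB_alg P) = ClB C (Und P)" "Str (ClB_alg P) = snd (classifying_str P)"
  by (simp_all add: ClT_alg_def ClB_alg_def)

text \<open>
  The laws for the two sides of the classifying square are proved simultaneously.  Each law is an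
  equation between comparison cells, for the unit out of the classifying square itself and for the
  multiplication out of its twofold action.  That \<open>u\<close> sends the first component of the structure
  cells to the second one, restricted along \<open>T P\<close>, says precisely that the square commutes as a square
  of lax morphisms.
\<close>

lemma classifying_lax:
  assumes P: "P \<in> small_strict K T S"
  shows "square (PsAlg K T) P Univ_mor (ClT_alg P) (ClB_alg P)"
proof -
  let ?p = "Und P" and ?d' = "ClT C (Und P)" and ?d = "ClB C (Und P)"
    and ?\<epsilon> = "Act (Dom P)" and ?\<beta> = "Act (Cod P)" and ?s' = "fst (classifying_str P)" and ?s = "snd (classifying_str P)"
    and ?E = "Car (Dom P)" and ?B = "Car (Cod P)"
  note p = small_strictD[OF P]
  note PL = lax_morphismD[OF p(5)]
  have pb: "pullback_square K ?p u ?d' ?d" by (rule classifying_square[OF p(2)])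
  note sqd = pullback_squareD[OF pb]
  note ds = squareD(3-9)[OF sqd, unfolded PL(4,5)]
  note asq = strict_action_square[OF p(1)]
  have st: "square_cell K (T1 T ?p) u (\<omega>' \<cdot> T1 T ?d', \<omega> \<cdot> T1 T ?d) (?d' \<cdot> ?\<epsilon>, ?d \<cdot> ?\<beta>) (?s', ?s)"
    unfolding classifying_str_def by (rule classify[OF act_pullback[OF pb] square_paste[OF asq sqd]])
  note stq = act_square[OF sqd]
  note S = square_cellD[OF st]
  note ty = PL ds(1-6) S(1-6) lax_algebraD omega_cat
  note sP = strict_morphismD[OF p(1)]
  have idp: "square K ?p ?p (Id1 K ?E) (Id1 K ?B)" using square_Id1[OF PL(3)] by (simp add: PL)
  have vc: "square_cell K ?p ?p (Id1 K ?E, Id1 K ?B) (?\<epsilon> \<cdot> unit T ?E, ?\<beta> \<cdot> unit T ?B) (Unt (Dom P), Unt (Cod P))"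
    by (rule square_cellI) (simp_all add: ty sP(6))
  have aasq: "square K (T1 T (T1 T ?p)) ?p (?\<epsilon> \<cdot> T1 T ?\<epsilon>) (?\<beta> \<cdot> T1 T ?\<beta>)"
    by (rule square_paste[OF T_square[OF asq] asq])
  have mc: "square_cell K (T1 T (T1 T ?p)) ?p (?\<epsilon> \<cdot> T1 T ?\<epsilon>, ?\<beta> \<cdot> T1 T ?\<beta>)
      (?\<epsilon> \<cdot> mult T ?E, ?\<beta> \<cdot> mult T ?B) (Mul (Dom P), Mul (Cod P))"
    by (rule square_cellI) (simp_all add: ty sP(7))
  have us: "square K ?p (T1 T ?p) (unit T ?E) (unit T ?B)" using unit_square[OF PL(3)] by (simp add: PL)
  have ms: "square K (T1 T (T1 T ?p)) (T1 T ?p) (mult T ?E) (mult T ?B)" using mult_square[OF PL(3)] by (simp add: PL)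
  \<comment> \<open>the unit of \<open>P\<close> pushed into \<open>u\<close>, against the unit over \<open>u\<close> followed by the structure cell\<close>
  have a1: "square_cell K ?p u (?d', ?d) (?d' \<cdot> (?\<epsilon> \<cdot> unit T ?E), ?d \<cdot> (?\<beta> \<cdot> unit T ?B)) (?d' \<rhd> Unt (Dom P), ?d \<rhd> Unt (Cod P))"
    using square_cell_lwhisker[OF idp sqd vc] by (simp add: ty)
  have a2: "square_cell K ?p u (?d', ?d) (\<omega>' \<cdot> (T1 T ?d' \<cdot> unit T ?E), \<omega> \<cdot> (T1 T ?d \<cdot> unit T ?B)) (fst omega_unit \<lhd> ?d', snd omega_unit \<lhd> ?d)"
    using square_cell_rwhisker[OF u_Id_square sqd omega_unit_cell] by (simp add: ty)
  have a3: "square_cell K ?p u (\<omega>' \<cdot> (T1 T ?d' \<cdot> unit T ?E), \<omega> \<cdot> (T1 T ?d \<cdot> unit T ?B))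
      (?d' \<cdot> (?\<epsilon> \<cdot> unit T ?E), ?d \<cdot> (?\<beta> \<cdot> unit T ?B)) (?s' \<lhd> unit T ?E, ?s \<lhd> unit T ?B)"
    using square_cell_rwhisker[OF stq us st] by (simp add: ty)
  note A = pullback_classifies_unique[OF pb a1 square_cell_vcomp[OF sqd a2 a3]]
  \<comment> \<open>the two ways from the twofold action to the classifying square restricted along \<open>m\<close>\<close>
  let ?a' = "\<omega>' \<cdot> (T1 T \<omega>' \<cdot> T1 T (T1 T ?d'))" and ?a = "\<omega> \<cdot> (T1 T \<omega> \<cdot> T1 T (T1 T ?d))"
  have pbm: "pullback_square K (T1 T (T1 T ?p)) u ?a' ?a"
    using act_pullback[OF act_pullback[OF pb]] by (simp add: ty)
  note sqm = pullback_squareD[OF pbm]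
  have b1: "square_cell K (T1 T (T1 T ?p)) u (?a', ?a) (\<omega>' \<cdot> (T1 T ?d' \<cdot> T1 T ?\<epsilon>), \<omega> \<cdot> (T1 T ?d \<cdot> T1 T ?\<beta>))
      (\<omega>' \<rhd> T2 T ?s', \<omega> \<rhd> T2 T ?s)"
    using act_cell[OF stq st] by (simp add: ty)
  have b2: "square_cell K (T1 T (T1 T ?p)) u (\<omega>' \<cdot> (T1 T ?d' \<cdot> T1 T ?\<epsilon>), \<omega> \<cdot> (T1 T ?d \<cdot> T1 T ?\<beta>))
      (?d' \<cdot> (?\<epsilon> \<cdot> T1 T ?\<epsilon>), ?d \<cdot> (?\<beta> \<cdot> T1 T ?\<beta>)) (?s' \<lhd> T1 T ?\<epsilon>, ?s \<lhd> T1 T ?\<beta>)"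
    using square_cell_rwhisker[OF stq T_square[OF asq] st] by (simp add: ty)
  have b3: "square_cell K (T1 T (T1 T ?p)) u (?d' \<cdot> (?\<epsilon> \<cdot> T1 T ?\<epsilon>), ?d \<cdot> (?\<beta> \<cdot> T1 T ?\<beta>))
      (?d' \<cdot> (?\<epsilon> \<cdot> mult T ?E), ?d \<cdot> (?\<beta> \<cdot> mult T ?B)) (?d' \<rhd> Mul (Dom P), ?d \<rhd> Mul (Cod P))"
    using square_cell_lwhisker[OF aasq sqd mc] by (simp add: ty)
  have b4: "square_cell K (T1 T (T1 T ?p)) u (?a', ?a) (\<omega>' \<cdot> (T1 T ?d' \<cdot> mult T ?E), \<omega> \<cdot> (T1 T ?d \<cdot> mult T ?B))
      (fst omega_mult \<lhd> T1 T (T1 T ?d'), snd omega_mult \<lhd> T1 T (T1 T ?d))"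
    using square_cell_rwhisker[OF omega_omega_square T_square[OF T_square[OF sqd]] omega_mult_cell] by (simp add: ty)
  have b5: "square_cell K (T1 T (T1 T ?p)) u (\<omega>' \<cdot> (T1 T ?d' \<cdot> mult T ?E), \<omega> \<cdot> (T1 T ?d \<cdot> mult T ?B))
      (?d' \<cdot> (?\<epsilon> \<cdot> mult T ?E), ?d \<cdot> (?\<beta> \<cdot> mult T ?B)) (?s' \<lhd> mult T ?E, ?s \<lhd> mult T ?B)"
    using square_cell_rwhisker[OF stq ms st] by (simp add: ty)
  have b12: "square_cell K (T1 T (T1 T ?p)) u (?a', ?a) (?d' \<cdot> (?\<epsilon> \<cdot> T1 T ?\<epsilon>), ?d \<cdot> (?\<beta> \<cdot> T1 T ?\<beta>))
      ((?s' \<lhd> T1 T ?\<epsilon>) \<bullet> (\<omega>' \<rhd> T2 T ?s'), (?s \<lhd> T1 T ?\<beta>) \<bullet> (\<omega> \<rhd> T2 T ?s))"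
    by (rule square_cell_vcomp[OF sqm b1 b2])
  note B = pullback_classifies_unique[OF pbm square_cell_vcomp[OF sqm b12 b3] square_cell_vcomp[OF sqm b4 b5]]
  have ClT_alg: "lax_morphism K T (ClT_alg P)"
    by (rule lax_morphismI) (use Omega_alg_pseudo in \<open>simp_all add: Cl_alg_sel Univ_mor_sel ty pseudo_algebra_def A B\<close>)
  have ClB_alg: "lax_morphism K T (ClB_alg P)"
    by (rule lax_morphismI) (use Omega_alg_pseudo in \<open>simp_all add: Cl_alg_sel Univ_mor_sel ty pseudo_algebra_def A B\<close>)
  have "alg_comp K T Univ_mor (ClT_alg P) = alg_comp K T (ClB_alg P) P"
  proof (rule alg_morI)
    show "Str (alg_comp K T Univ_mor (ClT_alg P)) = Str (alg_comp K T (ClB_alg P) P)"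
      using strict_comp_Str[OF Univ_morD(1) ClT_alg] comp_strict_Str[OF p(1) ClB_alg] S(7) by (simp add: Cl_alg_sel Univ_mor_sel)
  qed (use ds(7) in \<open>simp_all add: alg_comp_sel(1-3) Cl_alg_sel Univ_mor_sel\<close>)
  then show ?thesis
    using ClT_alg ClB_alg p(4) Univ_morD(4) by (simp add: PsAlg_square_iff Cl_alg_sel Univ_mor_sel)
qed

text \<open>
  Compatibility with the structure is an equation between comparison cells out of the pullback
  square \<open>(\<omega>' \<cdot> T A', \<omega> \<cdot> T A)\<close>.
\<close>

lemma classified_two_morphism:
  assumes P: "P \<in> small_strict K T S"
    and A: "square (PsAlg K T) P Univ_mor A' A" and B: "square (PsAlg K T) P Univ_mor B' B"
    and pb: "pullback_square K (Und P) u (Und A') (Und A)"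
    and \<gamma>: "square_cell K (Und P) u (Und A', Und A) (Und B', Und B) (\<gamma>', \<gamma>)"
  shows "alg_two_morphism K T (Cell A' B' \<gamma>')" "alg_two_morphism K T (Cell A B \<gamma>)"
proof -
  note p = small_strictD[OF P]
  note PL = lax_morphismD[OF p(5)]
  let ?p = "Und P" and ?\<epsilon> = "Act (Dom P)" and ?\<beta> = "Act (Cod P)"
  have a: "lax_morphism K T A'" "Dom A' = Dom P" "Cod A' = Omega_alg'" "lax_morphism K T A" "Dom A = Cod P" "Cod A = Omega_alg"
    and b: "lax_morphism K T B'" "Dom B' = Dom P" "Cod B' = Omega_alg'" "lax_morphism K T B" "Dom B = Cod P" "Cod B = Omega_alg"
    using A B by (simp_all add: PsAlg_square_iff Univ_mor_sel)
  note g = square_cellD[OF \<gamma>]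
  note ty = PL lax_morphismD[OF a(1)] lax_morphismD[OF a(4)] lax_morphismD[OF b(1)] lax_morphismD[OF b(4)]
    a(2,3,5,6) b(2,3,5,6) Univ_mor_sel g(1-6) lax_algebraD omega_cat
  note asq = strict_action_square[OF p(1)]
  note sqa = pullback_squareD[OF pb]
  have sqb: "square K ?p u (Und B') (Und B)" by (rule square_cell_target[OF sqa \<gamma>])
  have sa: "square_cell K (T1 T ?p) u (\<omega>' \<cdot> T1 T (Und A'), \<omega> \<cdot> T1 T (Und A)) (Und A' \<cdot> ?\<epsilon>, Und A \<cdot> ?\<beta>) (Str A', Str A)"
    using strict_square_Str[OF p(1) Univ_morD(1) A] by (intro square_cellI) (simp_all add: ty)
  have sb: "square_cell K (T1 T ?p) u (\<omega>' \<cdot> T1 T (Und B'), \<omega> \<cdot> T1 T (Und B)) (Und B' \<cdot> ?\<epsilon>, Und B \<cdot> ?\<beta>) (Str B', Str B)"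
    using strict_square_Str[OF p(1) Univ_morD(1) B] by (intro square_cellI) (simp_all add: ty)
  note sq = act_square[OF sqa]
  note E = pullback_classifies_unique[OF act_pullback[OF pb]
      square_cell_vcomp[OF sq sa square_cell_rwhisker[OF sqa asq \<gamma>]]
      square_cell_vcomp[OF sq act_cell[OF sqa \<gamma>] sb]]
  show "alg_two_morphism K T (Cell A' B' \<gamma>')" "alg_two_morphism K T (Cell A B \<gamma>)"
    using E a b by (simp_all add: alg_two_morphism_iff g Univ_mor_sel)
qed

text \<open>
  Underlying comparison cells are algebra 2-cells, so the universal property is that of the
  underlying squares.
\<close>

lemma alg_pullback_classifies:
  assumes P: "P \<in> small_strict K T S"
    and A: "square (PsAlg K T) P Univ_mor A' A" and B: "square (PsAlg K T) P Univ_mor B' B"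
    and pb: "pullback_square K (Und P) u (Und A') (Und A)"
  shows "\<exists>!\<Gamma>. square_cell (PsAlg K T) P Univ_mor (A', A) (B', B) \<Gamma>"
    and "square_cell (PsAlg K T) P Univ_mor (A', A) (B', B) \<Gamma> \<Longrightarrow>
      square_cell K (Und P) u (Und A', Und A) (Und B', Und B) (Und2 (fst \<Gamma>), Und2 (snd \<Gamma>))"
proof -
  note p = small_strictD[OF P]
  have ClB_alg: "alg_comp K T Univ_mor A' = alg_comp K T A P" "alg_comp K T Univ_mor B' = alg_comp K T B P"
    and ps: "pseudo_algebra K T (Dom P)" "pseudo_algebra K T (Cod P)"
      "Dom A' = Dom P" "Cod A' = Omega_alg'" "Dom A = Cod P" "Cod A = Omega_alg"
    using A B by (simp_all add: PsAlg_square_iff Univ_mor_sel PsAlg_simps)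
  have sqb: "square K (Und P) u (Und B') (Und B)"
    using strict_square_Str(2)[OF p(1) Univ_morD(1) B] B lax_morphismD[OF p(5)] lax_morphismD[of B'] lax_morphismD[of B] u_typing
    by (intro squareI) (simp_all add: PsAlg_square_iff Univ_mor_sel)
  have Und: "square_cell K (Und P) u (Und A', Und A) (Und B', Und B) (Und2 (fst \<Gamma>), Und2 (snd \<Gamma>))"
    "From (fst \<Gamma>) = A'" "To (fst \<Gamma>) = B'" "From (snd \<Gamma>) = A" "To (snd \<Gamma>) = B"
    if "square_cell (PsAlg K T) P Univ_mor (A', A) (B', B) \<Gamma>" for \<Gamma>
    using that alg_two_morphismD(5-7)[of "fst \<Gamma>"] alg_two_morphismD(5-7)[of "snd \<Gamma>"]
    by (auto simp: square_cell_def PsAlg_two_cell two_cell_def[of K] PsAlg_lwhisker PsAlg_rwhisker Univ_mor_sel)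
  show "square_cell (PsAlg K T) P Univ_mor (A', A) (B', B) \<Gamma> \<Longrightarrow>
      square_cell K (Und P) u (Und A', Und A) (Und B', Und B) (Und2 (fst \<Gamma>), Und2 (snd \<Gamma>))" by (rule Und(1))
  have ex: "\<exists>!\<gamma>. square_cell K (Und P) u (Und A', Und A) (Und B', Und B) \<gamma>"
    by (rule pullback_classifies(1)[OF pb sqb])
  then obtain \<gamma>' \<gamma> where \<gamma>: "square_cell K (Und P) u (Und A', Und A) (Und B', Und B) (\<gamma>', \<gamma>)" by auto
  note c = classified_two_morphism[OF P A B pb \<gamma>]
  show "\<exists>!\<Gamma>. square_cell (PsAlg K T) P Univ_mor (A', A) (B', B) \<Gamma>"
  proof (rule ex1I[of _ "(Cell A' B' \<gamma>', Cell A B \<gamma>)"])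
    show "square_cell (PsAlg K T) P Univ_mor (A', A) (B', B) (Cell A' B' \<gamma>', Cell A B \<gamma>)"
      using c ClB_alg ps Omega_alg_pseudo square_cellD(7)[OF \<gamma>]
      by (simp add: square_cell_def PsAlg_two_cell PsAlg_lwhisker PsAlg_rwhisker Univ_mor_sel)
    fix \<Gamma> assume G: "square_cell (PsAlg K T) P Univ_mor (A', A) (B', B) \<Gamma>"
    have "(Und2 (fst \<Gamma>), Und2 (snd \<Gamma>)) = (\<gamma>', \<gamma>)"
      using ex Und(1)[OF G] \<gamma> by blast
    then show "\<Gamma> = (Cell A' B' \<gamma>', Cell A B \<gamma>)"
      using Und(2-5)[OF G] by (intro prod_eqI alg_cellI) simp_all
  qed
qed

definition "alg_classifier = \<lparr>Univ = Univ_mor, ClT = ClT_alg, ClB = ClB_alg\<rparr>"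

lemma alg_classifier_simps: "Univ alg_classifier = Univ_mor" "ClT alg_classifier = ClT_alg" "ClB alg_classifier = ClB_alg"
  by (simp_all add: alg_classifier_def)

lemma alg_cell_invertible:
  assumes P: "P \<in> small_strict K T S"
    and A: "square (PsAlg K T) P Univ_mor A' A" and B: "square (PsAlg K T) P Univ_mor B' B"
    and pb: "pullback_square K (Und P) u (Und A') (Und A)" and pb': "pullback_square K (Und P) u (Und B') (Und B)"
    and \<Gamma>: "square_cell (PsAlg K T) P Univ_mor (A', A) (B', B) \<Gamma>"
  shows "invertible_two_cell (PsAlg K T) (fst \<Gamma>) \<and> invertible_two_cell (PsAlg K T) (snd \<Gamma>)"
proof -
  have "invertible_two_cell K (Und2 (fst \<Gamma>)) \<and> invertible_two_cell K (Und2 (snd \<Gamma>))"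
    using pullback_classifies(2)[OF pb pullback_squareD[OF pb'] pb' alg_pullback_classifies(2)[OF P A B pb \<Gamma>]] by simp
  moreover have "fst \<Gamma> \<in> Two (PsAlg K T)" "snd \<Gamma> \<in> Two (PsAlg K T)"
    using \<Gamma> by (simp_all add: square_cell_def two_cell_def)
  ultimately show ?thesis by (simp add: PsAlg_invertible)
qed

lemma PsAlg_representable:
  assumes "Car t = one" "tight_terminal (PsAlg K T) t"
  shows "representable_plumbus (PsAlg K T) alg_smallness t alg_classifier"
proof -
  interpret R: repletely_enhanced_2_category "PsAlg K T"
    by (rule PsAlg_replete) unfold_locales
  interpret Sm: smallness_structure "PsAlg K T" alg_smallness by (rule PsAlg_smallness)
  have pbK: "pullback_square K (Und P) u (Und (ClT_alg P)) (Und (ClB_alg P))" if "P \<in> small_strict K T S" for P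
    using classifying_square[OF small_strictD(2)[OF that]] by (simp add: Cl_alg_sel)
  have cl: "square (PsAlg K T) P Univ_mor (alg_comp K T (ClT_alg P') G) (alg_comp K T (ClB_alg P') F)"
    if "P' \<in> small_strict K T S" "square (PsAlg K T) P P' G F" for P P' G F
    using Alg.square_paste[OF that(2) classifying_lax[OF that(1)]] by (simp add: PsAlg_simps(11))
  have idsq: "square (PsAlg K T) Univ_mor Univ_mor (Id1 (PsAlg K T) (src (PsAlg K T) Univ_mor)) (Id1 (PsAlg K T) (tgt (PsAlg K T) Univ_mor))"
    by (rule Alg.square_Id1[OF Univ_morD(4)])
  show ?thesis
  proof
    show "tight_terminal (PsAlg K T) t" by fact
    show "Univ alg_classifier \<in> Small alg_smallness"
      by (simp add: alg_classifier_simps alg_smallness_simps Univ_mor_small)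
    show "pullback_square (PsAlg K T) P (Univ alg_classifier) (ClT alg_classifier P) (ClB alg_classifier P)"
      if "P \<in> Small alg_smallness" for P
    proof -
      have P: "P \<in> small_strict K T S" using that by (simp add: alg_smallness_simps)
      note p = small_strictD[OF P]
      show ?thesis
        using PsAlg_pullback[OF p(1,3) Univ_morD(1,3) classifying_lax[OF P]] pbK[OF P]
        by (simp add: alg_classifier_simps Univ_mor_sel)
    qed
    show "\<exists>!\<Gamma>. square_cell (PsAlg K T) P (Univ alg_classifier) (ClT alg_classifier P, ClB alg_classifier P)
        (ClT alg_classifier P' \<cdot>\<^bsub>PsAlg K T\<^esub> G, ClB alg_classifier P' \<cdot>\<^bsub>PsAlg K T\<^esub> F) \<Gamma>"
      if "P \<in> Small alg_smallness" "P' \<in> Small alg_smallness" "square (PsAlg K T) P P' G F" for P P' G F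
      using that alg_pullback_classifies(1)[OF _ classifying_lax cl pbK]
      by (simp add: alg_smallness_simps alg_classifier_simps PsAlg_simps(11))
    show "invertible_two_cell (PsAlg K T) (fst \<Gamma>) \<and> invertible_two_cell (PsAlg K T) (snd \<Gamma>)"
      if "P \<in> Small alg_smallness" "P' \<in> Small alg_smallness" and pb: "pullback_square (PsAlg K T) P P' G F"
        and \<Gamma>: "square_cell (PsAlg K T) P (Univ alg_classifier) (ClT alg_classifier P, ClB alg_classifier P)
        (ClT alg_classifier P' \<cdot>\<^bsub>PsAlg K T\<^esub> G, ClB alg_classifier P' \<cdot>\<^bsub>PsAlg K T\<^esub> F) \<Gamma>" for P P' G F \<Gamma>
    proof (rule alg_cell_invertible)
      show P: "P \<in> small_strict K T S" using that by (simp add: alg_smallness_simps)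
      have P': "P' \<in> small_strict K T S" using that by (simp add: alg_smallness_simps)
      show "square (PsAlg K T) P Univ_mor (ClT_alg P) (ClB_alg P)" by (rule classifying_lax[OF P])
      show "square (PsAlg K T) P Univ_mor (alg_comp K T (ClT_alg P') G) (alg_comp K T (ClB_alg P') F)"
        by (rule cl[OF P' Alg.pullback_squareD[OF pb]])
      show "pullback_square K (Und P) u (Und (ClT_alg P)) (Und (ClB_alg P))" by (rule pbK[OF P])
      show "pullback_square K (Und P) u (Und (alg_comp K T (ClT_alg P') G)) (Und (alg_comp K T (ClB_alg P') F))"
        unfolding alg_comp_sel by (rule pullback_paste[OF small_strict_pullback_Und[OF P P' pb] pbK[OF P']])
      show "square_cell (PsAlg K T) P Univ_mor (ClT_alg P, ClB_alg P) (alg_comp K T (ClT_alg P') G, alg_comp K T (ClB_alg P') F) \<Gamma>"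
        using \<Gamma> by (simp add: alg_classifier_simps PsAlg_simps(11))
    qed
    show "\<exists>\<Gamma>. square_cell (PsAlg K T) (Univ alg_classifier) (Univ alg_classifier)
          (ClT alg_classifier (Univ alg_classifier), ClB alg_classifier (Univ alg_classifier))
          (Id1 (PsAlg K T) (src (PsAlg K T) (Univ alg_classifier)), Id1 (PsAlg K T) (tgt (PsAlg K T) (Univ alg_classifier))) \<Gamma> \<and>
         invertible_two_cell (PsAlg K T) (fst \<Gamma>) \<and> invertible_two_cell (PsAlg K T) (snd \<Gamma>)"
    proof -
      have pbU: "pullback_square K (Und Univ_mor) u (Und (ClT_alg Univ_mor)) (Und (ClB_alg Univ_mor))" by (rule pbK[OF Univ_mor_small])
      have pbI: "pullback_square K (Und Univ_mor) u (Und (Id1 (PsAlg K T) (src (PsAlg K T) Univ_mor))) (Und (Id1 (PsAlg K T) (tgt (PsAlg K T) Univ_mor)))"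
        using u_Id_pullback by (simp add: PsAlg_simps(5,6,9) alg_id_sel Univ_mor_sel)
      obtain \<Gamma> where \<Gamma>: "square_cell (PsAlg K T) Univ_mor Univ_mor (ClT_alg Univ_mor, ClB_alg Univ_mor)
          (Id1 (PsAlg K T) (src (PsAlg K T) Univ_mor), Id1 (PsAlg K T) (tgt (PsAlg K T) Univ_mor)) \<Gamma>"
        using alg_pullback_classifies(1)[OF Univ_mor_small classifying_lax[OF Univ_mor_small] idsq pbU] by blast
      then show ?thesis
        using alg_cell_invertible[OF Univ_mor_small classifying_lax[OF Univ_mor_small] idsq pbU pbI \<Gamma>]
        unfolding alg_classifier_simps by blast
    qed
    show "Id1 (PsAlg K T) t \<in> Small alg_smallness"
    proof -
      have "t \<in> Ob (PsAlg K T)" using assms(2) by (simp add: tight_terminal_def)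
      then have t: "pseudo_algebra K T t" by (simp add: PsAlg_simps)
      note tl = lax_algebraD[OF pseudo_algebraD[OF t]]
      have "strict_morphism K T (alg_id K t)"
        using lax_morphism_id[OF pseudo_algebraD[OF t]] tl by (simp add: strict_morphism_def alg_id_sel Id1_comp)
      then show ?thesis
        using t Id1_one_small assms(1)
        by (simp add: alg_smallness_simps small_strict_def PsAlg_simps alg_id_sel strict_morphism_def)
    qed
  qed
qed

end

theorem corollary6p15:
  fixes K :: "('o, 'a, 'c) enh2cat" and S :: "'a smallness" and one :: 'o
    and C :: "'a classifier" and T :: "('o, 'a, 'c) e2monad"
  assumes "representable_plumbus K S one C"
    and "enhanced_2_monad K T"
    and "fully_opfibrantly_cartesian K S C T"
  shows "\<exists>S' one' C'. Small S' = small_strict K T S \<and>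
           representable_plumbus (PsAlg K T) S' one' C'"
proof -
  interpret cartesian_monad K S one C T
    using assms by (simp add: cartesian_monad_def cartesian_monad_axioms_def)
  obtain t where "Car t = one" "tight_terminal (PsAlg K T) t"
    using PsAlg_terminal[OF one_terminal] by blast
  then show ?thesis
    using PsAlg_representable alg_smallness_simps(1) by blast
qed

end
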